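(* Let $G$ be a group and let $\omega \in Z^3(G,\mathbb{T})$. Suppose there exists an $\omega$-anomalous action of $G$ on the Jiang--Su algebra $\mathcal{Z}$. Then $[\omega]=0$ in $H^3(G,\mathbb{T})$.
   Context: Groups are discrete. $\mathbb{T}$ is the unit circle in $\mathbb{C}$, regarded as a $G$-module with trivial action. A $3$-cocycle $\omega \in Z^3(G,\mathbb{T})$ is a function $\omega:G^3\to\mathbb{T}$ with $\omega(h,k,l)\,\omega(gh,k,l)^{-1}\omega(g,hk,l)\,\omega(g,h,kl)^{-1}\omega(g,h,k)=1$ for all $g,h,k,l\in G$; $H^3(G,\mathbb{T})$ is the usual group cohomology (3-cocycles modulo 3-coboundaries) and $[\omega]$ is the class of $\omega$; $[\omega]=0$ means the class is the neutral element. Anomalous actions: for $\omega\in Z^3(G,\mathbb{T})$, an $\omega$-anomalous action of $G$ on a unital C*-algebra $A$ consists of an automorphism $\theta_g\in\mathrm{Aut}(A)$ for every $g\in G$ and unitaries $u_{g,h}\in U(A)$ for $g,h\in G$ such that (1) $\theta_{gh}=\mathrm{Ad}(u_{g,h})\theta_g\theta_h$ for all $g,h\in G$, and (2) $\omega(g,h,k)\,u_{gh,k}u_{g,h}=u_{g,hk}\,\theta_g(u_{h,k})$ for all $g,h,k\in G$. Here $\mathrm{Ad}(u)(a)=uau^*$. The Jiang--Su algebra $\mathcal{Z}$ is the well-known infinite-dimensional, simple, separable, unital, nuclear C*-algebra with a unique tracial state and the same K-theory as $\mathbb{C}$, constructed by Jiang and Su. *)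

theory Defs
  imports
    "HOL-Analysis.Analysis"
    "HOL-Algebra.Coset"
    "Jordan_Normal_Form.Schur_Decomposition"
begin

section \<open>Unital C*-algebras\<close>

text \<open>
  Completeness and the complex structure sit on top of the library's real Banach algebras; the
  superclass \<^class>\<open>real_normed_algebra_1\<close> excludes the zero algebra.
\<close>

class unital_cstar_algebra = real_normed_algebra_1 + banach +
  fixes scaleC :: "complex \<Rightarrow> 'a \<Rightarrow> 'a"
    and star :: "'a \<Rightarrow> 'a"
  assumes scaleR_scaleC: "scaleR r x = scaleC (complex_of_real r) x"
    and scaleC_add_left: "scaleC (c + d) x = scaleC c x + scaleC d x"
    and scaleC_add_right: "scaleC c (x + y) = scaleC c x + scaleC c y"
    and scaleC_scaleC: "scaleC c (scaleC d x) = scaleC (c * d) x"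
    and mult_scaleC_left: "scaleC c x * y = scaleC c (x * y)"
    and mult_scaleC_right: "x * scaleC c y = scaleC c (x * y)"
    and norm_scaleC: "norm (scaleC c x) = cmod c * norm x"
    and star_add: "star (x + y) = star x + star y"
    and star_scaleC: "star (scaleC c x) = scaleC (cnj c) (star x)"
    and star_mult: "star (x * y) = star y * star x"
    and star_star: "star (star x) = x"
    and cstar_identity: "norm (star x * x) = (norm x)\<^sup>2"

definition is_unitary :: "'a::unital_cstar_algebra \<Rightarrow> bool" where
  "is_unitary u \<longleftrightarrow> star u * u = 1 \<and> u * star u = 1"

definition star_automorphism :: "('a::unital_cstar_algebra \<Rightarrow> 'a) \<Rightarrow> bool" where
  "star_automorphism \<theta> \<longleftrightarrow> bij \<theta> \<and>
     (\<forall>x y. \<theta> (x + y) = \<theta> x + \<theta> y) \<and>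
     (\<forall>c x. \<theta> (scaleC c x) = scaleC c (\<theta> x)) \<and>
     (\<forall>x y. \<theta> (x * y) = \<theta> x * \<theta> y) \<and>
     (\<forall>x. \<theta> (star x) = star (\<theta> x))"

definition Ad :: "'a::unital_cstar_algebra \<Rightarrow> 'a \<Rightarrow> 'a" where
  "Ad u a = u * a * star u"

definition tracial_state :: "('a::unital_cstar_algebra \<Rightarrow> complex) \<Rightarrow> bool" where
  "tracial_state \<tau> \<longleftrightarrow>
     (\<forall>x y. \<tau> (x + y) = \<tau> x + \<tau> y) \<and>
     (\<forall>c x. \<tau> (scaleC c x) = c * \<tau> x) \<and>
     (\<forall>x. \<tau> (star x * x) \<in> \<real> \<and> 0 \<le> Re (\<tau> (star x * x))) \<and>
     \<tau> 1 = 1 \<and>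
     (\<forall>x y. \<tau> (x * y) = \<tau> (y * x))"

definition closed_two_sided_ideal :: "'a::unital_cstar_algebra set \<Rightarrow> bool" where
  "closed_two_sided_ideal I \<longleftrightarrow> closed I \<and> 0 \<in> I \<and>
     (\<forall>x\<in>I. \<forall>y\<in>I. x + y \<in> I) \<and>
     (\<forall>c. \<forall>x\<in>I. scaleC c x \<in> I) \<and>
     (\<forall>a. \<forall>x\<in>I. a * x \<in> I \<and> x * a \<in> I)"

definition simple_cstar_algebra :: "'a::unital_cstar_algebra itself \<Rightarrow> bool" where
  "simple_cstar_algebra _ \<longleftrightarrow>
     (\<forall>I :: 'a set. closed_two_sided_ideal I \<longrightarrow> I = {0} \<or> I = UNIV)"

section \<open>The Jiang--Su algebra\<close>

text \<open>
  Identifying \<open>M\<^sub>p \<otimes> M\<^sub>q\<close> with the matrices of size \<open>p * q\<close>, the row (column) index \<open>i\<close>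
  encodes the pair \<open>(i div q, i mod q)\<close>.
\<close>

definition kronecker_mat :: "complex mat \<Rightarrow> complex mat \<Rightarrow> complex mat" where
  "kronecker_mat A B =
     mat (dim_row A * dim_row B) (dim_col A * dim_col B)
       (\<lambda>(i, j). A $$ (i div dim_row B, j div dim_col B) * B $$ (i mod dim_row B, j mod dim_col B))"

text \<open>
  The dimension drop algebra of all continuous \<open>f : [0,1] \<rightarrow> M\<^sub>p \<otimes> M\<^sub>q\<close> with
  \<open>f 0 \<in> M\<^sub>p \<otimes> 1\<close> and \<open>f 1 \<in> 1 \<otimes> M\<^sub>q\<close>. Its operations are pointwise; functions are taken
  to be extensional so that elements are equal as soon as they agree on \<open>[0,1]\<close>. Since matrices
  of a fixed size form a finite-dimensional space, norm continuity is continuity of all entries.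
\<close>

definition dim_drop :: "nat \<Rightarrow> nat \<Rightarrow> (real \<Rightarrow> complex mat) set" where
  "dim_drop p q = {f \<in> {0..1} \<rightarrow>\<^sub>E carrier_mat (p * q) (p * q).
     (\<forall>i<p * q. \<forall>j<p * q. continuous_on {0..1} (\<lambda>t. f t $$ (i, j))) \<and>
     (\<exists>a\<in>carrier_mat p p. f 0 = kronecker_mat a (1\<^sub>m q)) \<and>
     (\<exists>b\<in>carrier_mat q q. f 1 = kronecker_mat (1\<^sub>m p) b)}"

text \<open>
  Unital injective *-homomorphisms out of a dimension drop algebra. Injective *-homomorphisms
  between C*-algebras are isometric, so the supremum norm need not be mentioned.
\<close>

definition dim_drop_embedding ::
    "nat \<Rightarrow> nat \<Rightarrow> ((real \<Rightarrow> complex mat) \<Rightarrow> 'a::unital_cstar_algebra) \<Rightarrow> bool" where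
  "dim_drop_embedding p q \<phi> \<longleftrightarrow> inj_on \<phi> (dim_drop p q) \<and>
     \<phi> (\<lambda>t\<in>{0..1}. 1\<^sub>m (p * q)) = 1 \<and>
     (\<forall>f\<in>dim_drop p q. \<forall>g\<in>dim_drop p q. \<phi> (\<lambda>t\<in>{0..1}. f t + g t) = \<phi> f + \<phi> g) \<and>
     (\<forall>c. \<forall>f\<in>dim_drop p q. \<phi> (\<lambda>t\<in>{0..1}. c \<cdot>\<^sub>m f t) = scaleC c (\<phi> f)) \<and>
     (\<forall>f\<in>dim_drop p q. \<forall>g\<in>dim_drop p q. \<phi> (\<lambda>t\<in>{0..1}. f t * g t) = \<phi> f * \<phi> g) \<and>
     (\<forall>f\<in>dim_drop p q. \<phi> (\<lambda>t\<in>{0..1}. mat_adjoint (f t)) = star (\<phi> f))"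

text \<open>
  The inductive limit of a sequence of prime dimension drop algebras (those with \<open>p\<close> and \<open>q\<close>
  coprime) along unital injective connecting maps is described internally: an increasing sequence
  of unital copies of such algebras whose union is dense.
\<close>

definition prime_dim_drop_limit :: "'a::unital_cstar_algebra itself \<Rightarrow> bool" where
  "prime_dim_drop_limit _ \<longleftrightarrow>
     (\<exists>(p :: nat \<Rightarrow> nat) (q :: nat \<Rightarrow> nat) (\<phi> :: nat \<Rightarrow> (real \<Rightarrow> complex mat) \<Rightarrow> 'a).
        (\<forall>n. 0 < p n \<and> 0 < q n \<and> coprime (p n) (q n)) \<and>
        (\<forall>n. dim_drop_embedding (p n) (q n) (\<phi> n)) \<and>
        (\<forall>n. \<phi> n ` dim_drop (p n) (q n) \<subseteq> \<phi> (Suc n) ` dim_drop (p (Suc n)) (q (Suc n))) \<and>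
        closure (\<Union>n. \<phi> n ` dim_drop (p n) (q n)) = UNIV)"

text \<open>
  Jiang and Su construct a simple inductive limit of prime dimension drop algebras (with unital
  injective connecting maps) that has a unique tracial state, and their classification theorem
  shows that there is only one such C*-algebra up to isomorphism: prime dimension drop algebras
  have the K-theory of \<open>\<complex>\<close>, generated by the class of the unit, and this passes to the limit.
  Infinite dimension, separability and nuclearity are automatic for such limits.
\<close>

definition is_jiang_su :: "'a::unital_cstar_algebra itself \<Rightarrow> bool" where
  "is_jiang_su A \<longleftrightarrow> prime_dim_drop_limit A \<and> simple_cstar_algebra A \<and>
     (\<exists>!\<tau> :: 'a \<Rightarrow> complex. tracial_state \<tau>)"

section \<open>Third cohomology with coefficients in the circle\<close>

text \<open>
  Cochains are extensional functions on tuples of group elements with values in the unit circle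
  \<^term>\<open>sphere (0 :: complex) 1\<close>, on which the group acts trivially; they are not required to be
  normalised.
\<close>

definition cocycles3 :: "('g, 'm) monoid_scheme \<Rightarrow> ('g \<times> 'g \<times> 'g \<Rightarrow> complex) monoid" where
  "cocycles3 G =
    \<lparr>carrier = {\<omega> \<in> carrier G \<times> carrier G \<times> carrier G \<rightarrow>\<^sub>E sphere 0 1.
       \<forall>g\<in>carrier G. \<forall>h\<in>carrier G. \<forall>k\<in>carrier G. \<forall>l\<in>carrier G.
         \<omega> (h, k, l) * inverse (\<omega> (g \<otimes>\<^bsub>G\<^esub> h, k, l)) * \<omega> (g, h \<otimes>\<^bsub>G\<^esub> k, l)
           * inverse (\<omega> (g, h, k \<otimes>\<^bsub>G\<^esub> l)) * \<omega> (g, h, k) = 1},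
     monoid.mult = (\<lambda>\<omega> \<eta>. \<lambda>x\<in>carrier G \<times> carrier G \<times> carrier G. \<omega> x * \<eta> x),
     one = (\<lambda>x\<in>carrier G \<times> carrier G \<times> carrier G. 1)\<rparr>"

definition coboundary2 ::
    "('g, 'm) monoid_scheme \<Rightarrow> ('g \<times> 'g \<Rightarrow> complex) \<Rightarrow> 'g \<times> 'g \<times> 'g \<Rightarrow> complex" where
  "coboundary2 G c = (\<lambda>(g, h, k)\<in>carrier G \<times> carrier G \<times> carrier G.
     c (h, k) * inverse (c (g \<otimes>\<^bsub>G\<^esub> h, k)) * c (g, h \<otimes>\<^bsub>G\<^esub> k) * inverse (c (g, h)))"

definition coboundaries3 :: "('g, 'm) monoid_scheme \<Rightarrow> ('g \<times> 'g \<times> 'g \<Rightarrow> complex) set" where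
  "coboundaries3 G = coboundary2 G ` (carrier G \<times> carrier G \<rightarrow>\<^sub>E sphere 0 1)"

definition H3 :: "('g, 'm) monoid_scheme \<Rightarrow> ('g \<times> 'g \<times> 'g \<Rightarrow> complex) set monoid" where
  "H3 G = cocycles3 G Mod coboundaries3 G"

definition H3_class ::
    "('g, 'm) monoid_scheme \<Rightarrow> ('g \<times> 'g \<times> 'g \<Rightarrow> complex) \<Rightarrow> ('g \<times> 'g \<times> 'g \<Rightarrow> complex) set" where
  "H3_class G \<omega> = coboundaries3 G #>\<^bsub>cocycles3 G\<^esub> \<omega>"

text \<open>The quotient above is one of an abelian group by a subgroup.\<close>

lemma comm_group_cocycles3:
  assumes "group G"
  shows "comm_group (cocycles3 G)"
proof -
  interpret group G by fact
  let ?T = "carrier G \<times> carrier G \<times> carrier G"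
  show ?thesis
  proof (rule comm_groupI)
    fix x y assume "x \<in> carrier (cocycles3 G)" "y \<in> carrier (cocycles3 G)"
    then have x: "x \<in> ?T \<rightarrow>\<^sub>E sphere 0 1" and y: "y \<in> ?T \<rightarrow>\<^sub>E sphere 0 1"
      and cx: "\<And>g h k l. g \<in> carrier G \<Longrightarrow> h \<in> carrier G \<Longrightarrow> k \<in> carrier G \<Longrightarrow> l \<in> carrier G \<Longrightarrow>
         x (h, k, l) * inverse (x (g \<otimes>\<^bsub>G\<^esub> h, k, l)) * x (g, h \<otimes>\<^bsub>G\<^esub> k, l)
           * inverse (x (g, h, k \<otimes>\<^bsub>G\<^esub> l)) * x (g, h, k) = 1"
      and cy: "\<And>g h k l. g \<in> carrier G \<Longrightarrow> h \<in> carrier G \<Longrightarrow> k \<in> carrier G \<Longrightarrow> l \<in> carrier G \<Longrightarrow>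
         y (h, k, l) * inverse (y (g \<otimes>\<^bsub>G\<^esub> h, k, l)) * y (g, h \<otimes>\<^bsub>G\<^esub> k, l)
           * inverse (y (g, h, k \<otimes>\<^bsub>G\<^esub> l)) * y (g, h, k) = 1"
      by (auto simp: cocycles3_def)
    have "x (h, k, l) * y (h, k, l) * inverse (x (g \<otimes>\<^bsub>G\<^esub> h, k, l) * y (g \<otimes>\<^bsub>G\<^esub> h, k, l))
           * (x (g, h \<otimes>\<^bsub>G\<^esub> k, l) * y (g, h \<otimes>\<^bsub>G\<^esub> k, l))
           * inverse (x (g, h, k \<otimes>\<^bsub>G\<^esub> l) * y (g, h, k \<otimes>\<^bsub>G\<^esub> l)) * (x (g, h, k) * y (g, h, k)) = 1"
      if "g \<in> carrier G" "h \<in> carrier G" "k \<in> carrier G" "l \<in> carrier G" for g h k l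
      using arg_cong2[OF cx[OF that] cy[OF that], of "(*)"]
      by (simp add: inverse_mult_distrib ac_simps)
    moreover have "(\<lambda>a\<in>?T. x a * y a) \<in> ?T \<rightarrow>\<^sub>E sphere 0 1"
      using x y by (auto simp: PiE_iff norm_mult)
    ultimately show "x \<otimes>\<^bsub>cocycles3 G\<^esub> y \<in> carrier (cocycles3 G)"
      by (simp add: cocycles3_def)
  next
    show "\<one>\<^bsub>cocycles3 G\<^esub> \<in> carrier (cocycles3 G)"
      by (auto simp: cocycles3_def)
  next
    fix x assume "x \<in> carrier (cocycles3 G)"
    then have x: "x \<in> ?T \<rightarrow>\<^sub>E sphere 0 1"
      and cx: "\<And>g h k l. g \<in> carrier G \<Longrightarrow> h \<in> carrier G \<Longrightarrow> k \<in> carrier G \<Longrightarrow> l \<in> carrier G \<Longrightarrow>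
         x (h, k, l) * inverse (x (g \<otimes>\<^bsub>G\<^esub> h, k, l)) * x (g, h \<otimes>\<^bsub>G\<^esub> k, l)
           * inverse (x (g, h, k \<otimes>\<^bsub>G\<^esub> l)) * x (g, h, k) = 1"
      by (auto simp: cocycles3_def)
    let ?y = "\<lambda>a\<in>?T. inverse (x a)"
    have "inverse (x (h, k, l)) * inverse (inverse (x (g \<otimes>\<^bsub>G\<^esub> h, k, l)))
           * inverse (x (g, h \<otimes>\<^bsub>G\<^esub> k, l)) * inverse (inverse (x (g, h, k \<otimes>\<^bsub>G\<^esub> l)))
           * inverse (x (g, h, k)) = 1"
      if "g \<in> carrier G" "h \<in> carrier G" "k \<in> carrier G" "l \<in> carrier G" for g h k l
      using arg_cong[OF cx[OF that], of inverse] by (simp only: inverse_mult_distrib inverse_1)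
    moreover have "?y \<in> ?T \<rightarrow>\<^sub>E sphere 0 1"
      using x by (auto simp: PiE_iff norm_inverse)
    ultimately have "?y \<in> carrier (cocycles3 G)"
      by (simp add: cocycles3_def)
    moreover have "?y \<otimes>\<^bsub>cocycles3 G\<^esub> x = \<one>\<^bsub>cocycles3 G\<^esub>"
    proof -
      have "x a \<noteq> 0" if "a \<in> ?T" for a
        using PiE_mem[OF x that] by auto
      then show ?thesis
        by (auto simp: cocycles3_def fun_eq_iff restrict_def)
    qed
    ultimately show "\<exists>y\<in>carrier (cocycles3 G). y \<otimes>\<^bsub>cocycles3 G\<^esub> x = \<one>\<^bsub>cocycles3 G\<^esub>"
      by blast
  qed (auto simp: cocycles3_def PiE_def extensional_def fun_eq_iff algebra_simps restrict_def)
qed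

lemma subgroup_coboundaries3:
  assumes "group G"
  shows "subgroup (coboundaries3 G) (cocycles3 G)"
proof -
  interpret group G by fact
  interpret Z: comm_group "cocycles3 G" by (rule comm_group_cocycles3) fact
  let ?D = "carrier G \<times> carrier G"
  let ?T = "carrier G \<times> carrier G \<times> carrier G"
  have nz: "c (g, h) \<noteq> 0" if "c \<in> ?D \<rightarrow>\<^sub>E sphere 0 1" "g \<in> carrier G" "h \<in> carrier G"
    for c :: "_ \<Rightarrow> complex" and g h
    using PiE_mem[OF that(1), of "(g, h)"] that by auto
  have n1: "cmod (c (g, h)) = 1" if "c \<in> ?D \<rightarrow>\<^sub>E sphere 0 1" "g \<in> carrier G" "h \<in> carrier G"
    for c g h
    using PiE_mem[OF that(1), of "(g, h)"] that by auto
  have closed: "coboundary2 G c \<in> carrier (cocycles3 G)" if c: "c \<in> ?D \<rightarrow>\<^sub>E sphere 0 1" for c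
  proof -
    have "coboundary2 G c \<in> ?T \<rightarrow>\<^sub>E sphere 0 1"
      by (auto simp: coboundary2_def norm_mult norm_inverse n1[OF c])
    moreover have "coboundary2 G c (h, k, l) * inverse (coboundary2 G c (g \<otimes>\<^bsub>G\<^esub> h, k, l))
        * coboundary2 G c (g, h \<otimes>\<^bsub>G\<^esub> k, l) * inverse (coboundary2 G c (g, h, k \<otimes>\<^bsub>G\<^esub> l))
        * coboundary2 G c (g, h, k) = 1"
      if "g \<in> carrier G" "h \<in> carrier G" "k \<in> carrier G" "l \<in> carrier G" for g h k l
      using that by (simp add: coboundary2_def m_assoc nz[OF c] field_simps)
    ultimately show ?thesis
      by (simp add: cocycles3_def)
  qed
  show ?thesis
  proof (rule Z.subgroupI)
    show "coboundaries3 G \<subseteq> carrier (cocycles3 G)"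
      using closed by (auto simp: coboundaries3_def)
    have "(\<lambda>a\<in>?D. 1) \<in> ?D \<rightarrow>\<^sub>E sphere (0::complex) 1"
      by auto
    then show "coboundaries3 G \<noteq> {}"
      unfolding coboundaries3_def by blast
  next
    fix a assume "a \<in> coboundaries3 G"
    then obtain c where c: "c \<in> ?D \<rightarrow>\<^sub>E sphere 0 1" and a: "a = coboundary2 G c"
      by (auto simp: coboundaries3_def)
    let ?d = "\<lambda>x\<in>?D. inverse (c x)"
    have d: "?d \<in> ?D \<rightarrow>\<^sub>E sphere 0 1"
      using c by (auto simp: PiE_iff norm_inverse)
    have "coboundary2 G ?d \<otimes>\<^bsub>cocycles3 G\<^esub> a = \<one>\<^bsub>cocycles3 G\<^esub>"
      by (auto simp: a cocycles3_def coboundary2_def fun_eq_iff restrict_def nz[OF c] field_simps)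
    then have "inv\<^bsub>cocycles3 G\<^esub> a = coboundary2 G ?d"
      using closed[OF c] closed[OF d] a by (metis Z.inv_equality)
    then show "inv\<^bsub>cocycles3 G\<^esub> a \<in> coboundaries3 G"
      using d unfolding coboundaries3_def by blast
  next
    fix a b assume "a \<in> coboundaries3 G" "b \<in> coboundaries3 G"
    then obtain c d where c: "c \<in> ?D \<rightarrow>\<^sub>E sphere 0 1" and a: "a = coboundary2 G c"
      and d: "d \<in> ?D \<rightarrow>\<^sub>E sphere 0 1" and b: "b = coboundary2 G d"
      by (auto simp: coboundaries3_def)
    let ?e = "\<lambda>x\<in>?D. c x * d x"
    have e: "?e \<in> ?D \<rightarrow>\<^sub>E sphere 0 1"
      using c d by (auto simp: PiE_iff norm_mult)
    have "a \<otimes>\<^bsub>cocycles3 G\<^esub> b = coboundary2 G ?e"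
      by (auto simp: a b cocycles3_def coboundary2_def fun_eq_iff restrict_def)
    then show "a \<otimes>\<^bsub>cocycles3 G\<^esub> b \<in> coboundaries3 G"
      using e unfolding coboundaries3_def by blast
  qed
qed

section \<open>Anomalous actions\<close>

definition anomalous_action ::
    "('g, 'm) monoid_scheme \<Rightarrow> ('g \<times> 'g \<times> 'g \<Rightarrow> complex) \<Rightarrow>
     ('g \<Rightarrow> 'a \<Rightarrow> 'a) \<Rightarrow> ('g \<Rightarrow> 'g \<Rightarrow> 'a::unital_cstar_algebra) \<Rightarrow> bool" where
  "anomalous_action G \<omega> \<theta> u \<longleftrightarrow>
     (\<forall>g\<in>carrier G. star_automorphism (\<theta> g)) \<and>
     (\<forall>g\<in>carrier G. \<forall>h\<in>carrier G. is_unitary (u g h)) \<and>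
     (\<forall>g\<in>carrier G. \<forall>h\<in>carrier G. \<theta> (g \<otimes>\<^bsub>G\<^esub> h) = Ad (u g h) \<circ> \<theta> g \<circ> \<theta> h) \<and>
     (\<forall>g\<in>carrier G. \<forall>h\<in>carrier G. \<forall>k\<in>carrier G.
        scaleC (\<omega> (g, h, k)) (u (g \<otimes>\<^bsub>G\<^esub> h) k * u g h) = u g (h \<otimes>\<^bsub>G\<^esub> k) * \<theta> g (u h k))"

end

theory Submission
  imports Defs
begin

text \<open>
  The de la Harpe--Skandalis determinant of the unique trace \<open>\<tau>\<close> is a homomorphism \<open>\<Delta>\<close> from the
  unitary group to \<open>\<complex>\<^sup>\<times>\<close> with \<open>\<Delta> (\<lambda> 1) = \<lambda>\<close> that is invariant under automorphisms. Applied to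
  \<open>\<omega>(g,h,k) u(gh,k) u(g,h) = u(g,hk) \<theta>\<^sub>g(u(h,k))\<close> it exhibits \<open>\<omega>\<close> as the coboundary of
  \<open>\<Delta> \<circ> u\<close>, after normalising to modulus one.

  One puts \<open>\<Delta> (x\<^sub>1 \<cdots> x\<^sub>n) = exp (\<tau> (log x\<^sub>1) + \<cdots> + \<tau> (log x\<^sub>n))\<close> for \<open>x\<^sub>i\<close> close to 1. This is
  well defined since, by density, a relation among the \<open>x\<^sub>i\<close> may be moved into a dimension drop
  algebra. There \<open>\<tau>\<close> only sees the normalised trace in the fibres, and the sum of the traces of the
  logarithms is a continuous function \<open>H\<close> with \<open>exp (p q H) = 1\<close> everywhere, \<open>exp (p H(0)) = 1\<close> and
  \<open>exp (q H(1)) = 1\<close> because the determinants of the fibres multiply. As \<open>p\<close> and \<open>q\<close> are coprime,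
  \<open>H\<close> is a constant in \<open>2\<pi>i\<int>\<close>.

  Every unitary is a product of elements close to 1: after approximation it lies in a dimension drop
  algebra, elementary matrices remove its values at the two ends, Gaussian elimination reduces the
  remaining loop to a diagonal one, and its winding number is killed since \<open>p\<close> and \<open>q\<close> are coprime.
\<close>

section \<open>C*-algebra preliminaries\<close>

text \<open>The embeddings of dimension drop algebras are given purely algebraically, and neither
  traces nor automorphisms come with a bound. Norm estimates are extracted from the C*-identity:
  self-adjoint elements are written as real parts of unitaries, whose norm is known, and norms in a
  dimension drop algebra are obtained corner by corner from functions times matrix units. As the
  units themselves violate the boundary conditions, each of them carries a coefficient vanishing at
  the forbidden ends, and such coefficients have to be factored inside their ideal.

  Factors near 1 may be arbitrary invertible elements instead of unitaries. This admits 1 + x with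
  x^2 = 0, which is a power of 1 + x/n, and so makes elementary matrices available. The price is
  that \<Delta> takes values in the nonzero complex numbers, whence the normalisation at the end.
  Coprimality acts through the same Bezout identity px = qy + 1 in both halves: it gives the
  existence of factorisations and the uniqueness of their logarithm modulo 2\<pi>i.\<close>

lemma scaleC_one [simp]: "scaleC 1 (x::'a::unital_cstar_algebra) = x"
  using scaleR_scaleC[of 1 x] by simp

lemma scaleC_zero_left [simp]: "scaleC 0 (x::'a::unital_cstar_algebra) = 0"
  using scaleR_scaleC[of 0 x] by simp

lemma scaleC_zero_right [simp]: "scaleC c (0::'a::unital_cstar_algebra) = 0"
  using scaleC_add_right[of c 0 0] by simp

lemma scaleC_minus_left: "scaleC (- c) (x::'a::unital_cstar_algebra) = - scaleC c x"
  using scaleC_add_left[of c "-c" x] by (simp add: add_eq_0_iff)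

lemma scaleC_diff_left: "scaleC (c - d) (x::'a::unital_cstar_algebra) = scaleC c x - scaleC d x"
  using scaleC_add_left[of c "-d" x] by (simp add: scaleC_minus_left)

lemma scaleC_minus_right: "scaleC c (- x) = - scaleC c (x::'a::unital_cstar_algebra)"
  using scaleC_add_right[of c x "-x"] by (simp add: add_eq_0_iff)

lemma star_zero [simp]: "star (0::'a::unital_cstar_algebra) = 0"
  using star_add[of "0::'a" 0] by simp

lemma star_minus: "star (- x) = - star (x::'a::unital_cstar_algebra)"
  using star_add[of x "-x"] by (simp add: add_eq_0_iff)

lemma star_diff: "star (x - y) = star x - star (y::'a::unital_cstar_algebra)"
  using star_add[of x "-y"] by (simp add: star_minus)

lemma star_one [simp]: "star (1::'a::unital_cstar_algebra) = 1"
proof -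
  have "star (star (1::'a) * 1) = star 1 * 1" by (simp only: star_mult star_star)
  then show ?thesis by (simp add: star_star)
qed

lemma star_scaleR: "star (r *\<^sub>R x) = r *\<^sub>R star (x::'a::unital_cstar_algebra)"
  by (simp add: scaleR_scaleC star_scaleC)

lemma star_power: "star (x ^ n) = star (x::'a::unital_cstar_algebra) ^ n"
  by (induction n) (auto simp: star_mult power_commutes)

lemma norm_star [simp]: "norm (star x) = norm (x::'a::unital_cstar_algebra)"
proof -
  have le: "norm y \<le> norm (star y)" for y :: 'a
  proof (cases "norm y = 0")
    case False
    have "(norm y)\<^sup>2 \<le> norm (star y) * norm y"
      using cstar_identity[of y] norm_mult_ineq[of "star y" y] by simp
    then show ?thesis
      using False by (simp add: power2_eq_square)
  qed simp
  from le[of x] le[of "star x"] show ?thesis by (simp add: star_star)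
qed

lemma bounded_linear_star: "bounded_linear (star :: 'a::unital_cstar_algebra \<Rightarrow> 'a)"
  by (rule bounded_linear_intro[where K=1]) (auto simp: star_add star_scaleR)

lemma norm_unitary: "is_unitary u \<Longrightarrow> norm (u::'a::unital_cstar_algebra) = 1"
  using cstar_identity[of u] norm_ge_zero[of u] unfolding is_unitary_def
  by (smt (verit) norm_one power2_eq_1_iff)

lemma is_unitary_mult: "is_unitary u \<Longrightarrow> is_unitary v \<Longrightarrow> is_unitary (u * v :: 'a::unital_cstar_algebra)"
  unfolding is_unitary_def star_mult by (metis mult.assoc mult_1_left mult_1_right)

section \<open>Square roots and real parts of unitaries\<close>

lemma abs_half_gchoose_le: "\<bar>(1/2 :: real) gchoose k\<bar> \<le> 1"
proof (induction k)
  case (Suc k)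
  \<comment> \<open>Successive coefficients have ratio (1/2 - k) / (k + 1), of modulus at most
    1.\<close>
  have "(1/2 :: real) gchoose (Suc k) = (1/2 gchoose k) * ((1/2 - real k) / real (Suc k))"
    using gbinomial_mult_1[of "1/2::real" k] by (simp add: field_simps)
  moreover have "\<bar>(1/2 - real k) / real (Suc k)\<bar> \<le> 1"
    by (simp add: abs_le_iff field_simps)
  ultimately show ?case
    using Suc by (simp only: abs_mult mult_le_one abs_ge_zero)
qed simp

text \<open>The square root is the binomial series of \<open>(1 - z) powr (1/2)\<close>.\<close>

lemma ex_selfadjoint_sqrt:
  fixes z :: "'a::unital_cstar_algebra"
  assumes z: "norm z < 1" "star z = z"
  obtains y where "star y = y" "y * y = 1 - z" "\<And>x. x * z = z * x \<Longrightarrow> x * y = y * x"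
proof -
  define c where "c k = (-1) ^ k * ((1/2 :: real) gchoose k)" for k
  define a where "a k = c k *\<^sub>R z ^ k" for k
  have nc: "\<bar>c k\<bar> \<le> 1" for k
    using abs_half_gchoose_le[of k] by (simp add: c_def abs_mult)
  have na: "norm (a k) \<le> norm z ^ k" for k
  proof -
    have "norm (a k) \<le> \<bar>c k\<bar> * norm (z ^ k)" by (simp add: a_def)
    also have "\<dots> \<le> 1 * norm z ^ k"
      using nc[of k] norm_power_ineq[of z k] by (intro mult_mono) auto
    finally show ?thesis by simp
  qed
  have sn: "summable (\<lambda>k. norm (a k))"
    by (rule summable_comparison_test[OF _ summable_geometric[of "norm z"]])
       (use z na in auto)
  have sa: "summable a" using sn by (rule summable_norm_cancel)
  define y where "y = suminf a"
  \<comment> \<open>Vandermonde: the convolution square of the coefficients of (1 - z)^(1/2) gives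
    those of 1 - z.\<close>
  have conv: "(\<Sum>i\<le>k. c i * c (k - i)) = (if k = 0 then 1 else if k = 1 then -1 else 0)" for k
  proof -
    have "(\<Sum>i\<le>k. c i * c (k - i)) = (-1) ^ k * (\<Sum>i\<le>k. ((1/2::real) gchoose i) * ((1/2::real) gchoose (k - i)))"
      unfolding sum_distrib_left
    proof (intro sum.cong refl)
      fix i assume "i \<in> {..k}"
      then have "(-1::real) ^ k = (-1) ^ i * (-1) ^ (k - i)"
        by (simp flip: power_add)
      then show "c i * c (k - i) = (-1) ^ k * (((1/2::real) gchoose i) * ((1/2::real) gchoose (k - i)))"
        by (simp add: c_def)
    qed
    also have "(\<Sum>i\<le>k. ((1/2::real) gchoose i) * ((1/2::real) gchoose (k - i))) = 1 gchoose k"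
      using gbinomial_Vandermonde[where a = "1/2::real" and b = "1/2" and n = k] by (simp add: atLeast0AtMost)
    also have "\<dots> = of_nat (1 choose k)"
      using binomial_gbinomial[of 1 k, where ?'a = real] by simp
    finally show ?thesis
      by (cases k; cases "k - 1") auto
  qed
  have "(\<lambda>k. \<Sum>i\<le>k. a i * a (k - i)) sums (y * y)"
    unfolding y_def by (rule Cauchy_product_sums[OF sn sn])
  moreover have "(\<Sum>i\<le>k. a i * a (k - i)) = (if k = 0 then 1 else if k = 1 then - z else 0)" for k
  proof -
    have "(\<Sum>i\<le>k. a i * a (k - i)) = (\<Sum>i\<le>k. (c i * c (k - i)) *\<^sub>R z ^ k)"
      by (intro sum.cong refl) (simp add: a_def flip: power_add)
    also have "\<dots> = (\<Sum>i\<le>k. c i * c (k - i)) *\<^sub>R z ^ k"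
      by (simp add: scaleR_sum_left)
    finally show ?thesis using conv[of k] by auto
  qed
  ultimately have "(\<lambda>k. if k = 0 then 1 else if k = 1 then - z else 0) sums (y * y)" by simp
  moreover have "(\<lambda>k. if k = 0 then 1 else if k = 1 then - z else 0) sums
      (\<Sum>k\<in>{0,1::nat}. if k = 0 then 1 else if k = 1 then - z else 0)"
    by (rule sums_finite) auto
  ultimately have yy: "y * y = 1 - z"
    by (auto dest: sums_unique2)
  have "star y = suminf (\<lambda>k. star (a k))"
    unfolding y_def by (rule bounded_linear.suminf[OF bounded_linear_star sa])
  also have "\<dots> = y"
    by (simp add: y_def a_def[abs_def] star_scaleR star_power z)
  finally have "star y = y" .
  moreover have "x * y = y * x" if x: "x * z = z * x" for x
  proof -
    have "x * z ^ k = z ^ k * x" for k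
      by (induction k) (use x in \<open>auto simp: mult.assoc, metis mult.assoc\<close>)
    then have "(\<lambda>k. x * a k) = (\<lambda>k. a k * x)" by (simp add: a_def fun_eq_iff)
    then show ?thesis
      unfolding y_def using suminf_mult[OF sa, of x] suminf_mult2[OF sa, of x] by simp
  qed
  ultimately show thesis using yy that by blast
qed

text \<open>With y the root of 1 - x^2, the unitary is x + iy: y commutes with x because x commutes
  with x^2, so the cross terms cancel. Bounds known on unitaries thereby pass to self-adjoint
  elements, in place of spectral theory.\<close>

lemma selfadjoint_eq_Re_unitary:
  fixes x :: "'a::unital_cstar_algebra"
  assumes "norm x < 1" "star x = x"
  obtains u where "is_unitary u" "x = (1/2) *\<^sub>R (u + star u)"
proof -
  have "norm (x * x) < 1"
    using assms cstar_identity[of x] by (simp add: abs_square_less_1)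
  moreover have "star (x * x) = x * x" by (simp add: star_mult assms)
  ultimately obtain y where y: "star y = y" "y * y = 1 - x * x"
    "\<And>w. w * (x * x) = (x * x) * w \<Longrightarrow> w * y = y * w"
    using ex_selfadjoint_sqrt by blast
  have xy: "x * y = y * x" by (rule y) (simp add: mult.assoc)
  define u where "u = x + scaleC \<i> y"
  have su: "star u = x - scaleC \<i> y"
    by (simp add: u_def star_add star_scaleC assms y scaleC_minus_left)
  have "scaleC \<i> y * scaleC \<i> y = - (y * y)"
    by (simp add: mult_scaleC_left mult_scaleC_right scaleC_scaleC scaleC_minus_left)
  moreover have "x * scaleC \<i> y = scaleC \<i> y * x"
    by (simp add: mult_scaleC_left mult_scaleC_right xy)
  ultimately have "star u * u = 1" "u * star u = 1"
    using y(2) unfolding su unfolding u_def by (simp_all add: algebra_simps)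
  moreover have "x = (1/2) *\<^sub>R (u + star u)"
    unfolding su by (simp add: u_def flip: scaleR_2)
  ultimately show thesis using that by (simp add: is_unitary_def)
qed

lemma selfadjoint_eq_scaled_Re_unitary:
  fixes x :: "'a::unital_cstar_algebra"
  assumes "norm x < r" "star x = x"
  obtains u where "is_unitary u" "x = (r/2) *\<^sub>R (u + star u)"
proof -
  have r: "0 < r" using assms(1) norm_ge_zero order_le_less_trans by blast
  have "norm ((1/r) *\<^sub>R x) < 1" "star ((1/r) *\<^sub>R x) = (1/r) *\<^sub>R x"
    using r assms by (auto simp: star_scaleR)
  then obtain u where u: "is_unitary u" "(1/r) *\<^sub>R x = (1/2) *\<^sub>R (u + star u)"
    using selfadjoint_eq_Re_unitary by blast
  have "x = r *\<^sub>R ((1/r) *\<^sub>R x)" using r by simp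
  also have "\<dots> = (r/2) *\<^sub>R (u + star u)" by (simp add: u(2))
  finally show thesis using u(1) that by blast
qed

section \<open>Boundedness of tracial states and automorphisms\<close>

lemma tracial_stateD:
  assumes "tracial_state \<tau>"
  shows "\<tau> (x + y) = \<tau> x + \<tau> y" "\<tau> (scaleC c x) = c * \<tau> x" "\<tau> 1 = 1" "\<tau> (x * y) = \<tau> (y * x)"
    "\<tau> 0 = 0" "\<tau> (- x) = - \<tau> x" "\<tau> (x - y) = \<tau> x - \<tau> y"
    "\<tau> (r *\<^sub>R x) = r *\<^sub>R \<tau> x"
proof -
  show 1: "\<tau> (x + y) = \<tau> x + \<tau> y" "\<tau> (scaleC c x) = c * \<tau> x" "\<tau> 1 = 1" "\<tau> (x * y) = \<tau> (y * x)"
    for x y c using assms unfolding tracial_state_def by blast+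
  show z: "\<tau> 0 = 0" using 1(2)[of 0 0] by simp
  show m: "\<tau> (- x) = - \<tau> x" for x using 1(1)[of x "-x"] by (simp add: z add_eq_0_iff)
  show "\<tau> (x - y) = \<tau> x - \<tau> y" using 1(1)[of x "-y"] by (simp add: m)
  show "\<tau> (r *\<^sub>R x) = r *\<^sub>R \<tau> x" by (simp add: scaleR_scaleC 1 scaleR_conv_of_real)
qed

text \<open>Cauchy-Schwarz for u and 1, from positivity of \<open>\<tau>\<close> on
  \<open>star (u - s) * (u - s)\<close> at suitable scalars s.\<close>

lemma tracial_state_unitary_le:
  assumes \<tau>: "tracial_state \<tau>" and u: "is_unitary u"
  shows "cmod (\<tau> u) \<le> 1"
proof -
  note t = tracial_stateD[OF \<tau>]
  define w where "w = u - scaleC (\<tau> u) 1"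
  define v where "v = star u - scaleC (cnj (\<tau> (star u))) 1"
  have *: "0 \<le> Re (\<tau> (star x * x))" "\<tau> (star x * x) \<in> \<real>" for x
    using \<tau> unfolding tracial_state_def by blast+
  define c where "c = \<tau> u" define d where "d = \<tau> (star u)"
  have e: "\<tau> (star (u - scaleC s 1) * (u - scaleC s 1)) = 1 - cnj s * c - s * d + cnj s * s" for s
    using u by (simp add: star_diff star_scaleC algebra_simps t mult_scaleC_left mult_scaleC_right
        scaleC_scaleC is_unitary_def c_def d_def)
  \<comment> \<open>Hermitian symmetry has to be derived: reality at s = 1 compares the imaginary
    parts of c and d, reality at s = \<i> their real parts.\<close>
  have "1 - cnj 1 * c - 1 * d + cnj 1 * 1 \<in> \<real>" "1 - cnj \<i> * c - \<i> * d + cnj \<i> * \<i> \<in> \<real>"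
    using *(2)[of "u - scaleC 1 1"] *(2)[of "u - scaleC \<i> 1"] unfolding e by auto
  then have d: "d = cnj c"
    by (auto simp: complex_is_Real_iff complex_eq_iff)
  \<comment> \<open>The choice s = c minimises the expression and leaves 1 - |c|^2.\<close>
  have "0 \<le> Re (1 - cnj c * c - c * d + cnj c * c)"
    using *(1)[of "u - scaleC c 1"] unfolding e .
  then have "(cmod c)\<^sup>2 \<le> 1" unfolding d cmod_power2 by (simp add: power2_eq_square)
  then show ?thesis unfolding c_def by (simp add: abs_square_le_1)
qed

lemma tracial_state_selfadjoint_le:
  assumes \<tau>: "tracial_state \<tau>" and x: "star x = x"
  shows "cmod (\<tau> x) \<le> norm x"
proof (rule field_le_epsilon)
  fix e :: real assume "e > 0"
  \<comment> \<open>The excess e puts x / r inside the open unit ball, where the series for the root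
    converges.\<close>
  define r where "r = norm x + e"
  have r: "r > 0" "norm x < r" using \<open>e > 0\<close> by (auto simp: r_def add_nonneg_pos)
  obtain u where u: "is_unitary u" "x = (r/2) *\<^sub>R (u + star u)"
    using selfadjoint_eq_scaled_Re_unitary[OF r(2) x] by blast
  then have "\<tau> x = (r/2) *\<^sub>R (\<tau> u + \<tau> (star u))"
    by (simp add: tracial_stateD[OF \<tau>])
  then have "cmod (\<tau> x) \<le> (r/2) * (cmod (\<tau> u) + cmod (\<tau> (star u)))"
    using norm_triangle_ineq[of "\<tau> u" "\<tau> (star u)"] r by simp
  also have "\<dots> \<le> (r/2) * (1 + 1)"
    using r tracial_state_unitary_le[OF \<tau>, of u] tracial_state_unitary_le[OF \<tau>, of "star u"] u(1)
    by (intro mult_left_mono add_mono) (auto simp: is_unitary_def star_star)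
  finally show "cmod (\<tau> x) \<le> norm x + e" by (simp add: r_def)
qed

lemma Re_Im_decomposition:
  fixes x :: "'a::unital_cstar_algebra"
  obtains a b where "star a = a" "star b = b" "x = a + scaleC \<i> b" "norm a \<le> norm x" "norm b \<le> norm x"
proof -
  define a where "a = (1/2) *\<^sub>R (x + star x)"
  define b where "b = scaleC (- \<i> / 2) (x - star x)"
  have "star a = a" unfolding a_def star_scaleR star_add star_star by (simp only: add.commute)
  have "star b = scaleC (\<i> / 2) (star x - x)" by (simp add: b_def star_scaleC star_diff star_star)
  also have "\<dots> = b"
    using scaleC_minus_left[of "\<i> / 2" "x - star x"] scaleC_minus_right[of "\<i> / 2" "x - star x"]
    by (simp add: b_def)
  finally have "star b = b" .
  have "scaleC \<i> b = scaleC (complex_of_real (1/2)) (x - star x)"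
    by (simp add: b_def scaleC_scaleC)
  then have "a + scaleC \<i> b = (1/2) *\<^sub>R (x + star x) + (1/2) *\<^sub>R (x - star x)"
    by (simp only: scaleR_scaleC a_def)
  also have "\<dots> = (1/2) *\<^sub>R (2 *\<^sub>R x)"
    unfolding scaleR_add_right[symmetric] by (simp add: scaleR_2)
  also have "\<dots> = x" by simp
  finally have "x = a + scaleC \<i> b" ..
  moreover have "norm a \<le> norm x" using norm_triangle_ineq[of x "star x"] by (simp add: a_def)
  moreover have "norm b \<le> norm x"
    using norm_triangle_ineq4[of x "star x"] by (simp add: b_def norm_scaleC norm_divide)
  ultimately show thesis using \<open>star a = a\<close> \<open>star b = b\<close> that by blast
qed

lemma bounded_linear_tracial_state:
  fixes \<tau> :: "'a::unital_cstar_algebra \<Rightarrow> complex"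
  assumes \<tau>: "tracial_state \<tau>"
  shows "bounded_linear \<tau>"
proof (rule bounded_linear_intro[where K=2])
  fix x :: 'a
  obtain a b where ab: "star a = a" "star b = b" "x = a + scaleC \<i> b" "norm a \<le> norm x" "norm b \<le> norm x"
    by (rule Re_Im_decomposition)
  \<comment> \<open>The constant 2 comes from the two self-adjoint parts, each of norm at most that
    of x.\<close>
  have "cmod (\<tau> x) \<le> cmod (\<tau> a) + cmod (\<tau> b)"
    unfolding ab(3) using norm_triangle_ineq[of "\<tau> a" "\<i> * \<tau> b"]
    by (simp add: tracial_stateD[OF \<tau>] norm_mult)
  also have "\<dots> \<le> norm x + norm x"
    using tracial_state_selfadjoint_le[OF \<tau>] ab by (intro add_mono) (meson order_trans)+
  finally show "cmod (\<tau> x) \<le> norm x * 2" by simp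
qed (auto simp: tracial_stateD[OF \<tau>])

lemma star_automorphismD:
  assumes "star_automorphism \<theta>"
  shows "\<theta> (x + y) = \<theta> x + \<theta> y" "\<theta> (scaleC c x) = scaleC c (\<theta> x)" "\<theta> (x * y) = \<theta> x * \<theta> y"
    "\<theta> (star x) = star (\<theta> x)" "\<theta> 1 = 1" "\<theta> (x - y) = \<theta> x - \<theta> y" "\<theta> (r *\<^sub>R x) = r *\<^sub>R \<theta> x"
    "\<theta> (x ^ n) = \<theta> x ^ n"
proof -
  show 1: "\<theta> (x + y) = \<theta> x + \<theta> y" "\<theta> (scaleC c x) = scaleC c (\<theta> x)" "\<theta> (x * y) = \<theta> x * \<theta> y"
    "\<theta> (star x) = star (\<theta> x)" for x y c
    using assms unfolding star_automorphism_def by blast+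
  obtain e where e: "\<theta> e = 1"
    using assms unfolding star_automorphism_def by (metis bij_pointE)
  show one: "\<theta> 1 = 1" using 1(3)[of e 1] e by simp
  show "\<theta> (x - y) = \<theta> x - \<theta> y" using 1(1)[of "x - y" y] by (simp add: algebra_simps)
  show "\<theta> (r *\<^sub>R x) = r *\<^sub>R \<theta> x" by (simp add: scaleR_scaleC 1)
  show "\<theta> (x ^ n) = \<theta> x ^ n" by (induction n) (auto simp: 1 one)
qed

text \<open>A self-adjoint element is a multiple of the real part of a unitary, which
  \<open>\<theta>\<close> sends to a unitary, hence to norm 1; the C*-identity reduces general x to
  \<open>star x * x\<close>.\<close>

lemma star_automorphism_norm_le:
  assumes \<theta>: "star_automorphism \<theta>"
  shows "norm (\<theta> x) \<le> norm x"
proof -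
  note t = star_automorphismD[OF \<theta>]
  have sa: "norm (\<theta> x) \<le> norm x" if x: "star x = x" for x
  proof (rule field_le_epsilon)
    fix e :: real assume "e > 0"
    define r where "r = norm x + e"
    have r: "r > 0" "norm x < r" using \<open>e > 0\<close> by (auto simp: r_def add_nonneg_pos)
    obtain u where u: "is_unitary u" "x = (r/2) *\<^sub>R (u + star u)"
      using selfadjoint_eq_scaled_Re_unitary[OF r(2) x] by blast
    then have "\<theta> x = (r/2) *\<^sub>R (\<theta> u + star (\<theta> u))" by (simp add: t)
    moreover have "is_unitary (\<theta> u)"
      using u(1) unfolding is_unitary_def by (metis t(3-5))
    ultimately have "norm (\<theta> x) \<le> (r/2) * (1 + 1)"
      using norm_triangle_ineq[of "\<theta> u" "star (\<theta> u)"] r norm_unitary[of "\<theta> u"] by simp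
    then show "norm (\<theta> x) \<le> norm x + e" by (simp add: r_def)
  qed
  have "(norm (\<theta> x))\<^sup>2 = norm (\<theta> (star x * x))"
    unfolding t by (rule cstar_identity[symmetric])
  also have "\<dots> \<le> (norm x)\<^sup>2"
    using sa[of "star x * x"] by (simp add: star_mult star_star cstar_identity)
  finally show ?thesis by (rule power2_le_imp_le) simp
qed

lemma bounded_linear_star_automorphism:
  "star_automorphism \<theta> \<Longrightarrow> bounded_linear \<theta>"
  by (rule bounded_linear_intro[where K=1])
     (auto simp: star_automorphismD star_automorphism_norm_le)

lemma tracial_state_comp_automorphism:
  assumes "tracial_state \<tau>" "star_automorphism \<theta>"
  shows "tracial_state (\<tau> \<circ> \<theta>)"
  using assms(1) unfolding tracial_state_def comp_def star_automorphismD[OF assms(2)] by blast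

section \<open>Elements near the unit\<close>

text \<open>The Neumann series; its tail from the first power on is the difference of the inverse
  and 1, and is dominated by a geometric series.\<close>

lemma geometric_inverse:
  fixes v :: "'a::{real_normed_algebra_1, banach}"
  assumes v: "norm v < 1"
  obtains y where "(1 - v) * y = 1" "y * (1 - v) = 1" "norm (y - 1) \<le> norm v / (1 - norm v)"
proof -
  have sm: "summable (\<lambda>k. v ^ k)" by (rule complete_algebra_summable_geometric[OF v])
  have sn: "summable (\<lambda>k. norm v ^ Suc k)" using v by (simp add: summable_mult summable_geometric)
  have s1: "summable (\<lambda>k. v ^ Suc k)"
    using sm by (subst summable_Suc_iff)
  have eq: "(\<Sum>k. v ^ k) = 1 + (\<Sum>k. v ^ Suc k)"
    using suminf_split_head[OF sm] by simp
  have l: "v * (\<Sum>k. v ^ k) = (\<Sum>k. v ^ Suc k)" using suminf_mult[OF sm, of v] by simp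
  have r: "(\<Sum>k. v ^ k) * v = (\<Sum>k. v ^ Suc k)"
    using suminf_mult2[OF sm, of v] by (simp add: power_commutes)
  have le: "norm (v ^ Suc k) \<le> norm v ^ Suc k" for k by (rule norm_power_ineq)
  have "norm (\<Sum>k. v ^ Suc k) \<le> (\<Sum>k. norm (v ^ Suc k))"
    by (rule summable_norm) (rule summable_comparison_test'[OF sn, of 0], use le in simp)
  also have "\<dots> \<le> (\<Sum>k. norm v ^ Suc k)"
    by (rule suminf_le[OF le _ sn]) (rule summable_comparison_test'[OF sn, of 0], use le in simp)
  also have "\<dots> = norm v * (\<Sum>k. norm v ^ k)"
    using v by (simp add: suminf_mult summable_geometric)
  also have "\<dots> = norm v / (1 - norm v)" using v by (simp add: suminf_geometric)
  finally have "norm ((\<Sum>k. v ^ k) - 1) \<le> norm v / (1 - norm v)" unfolding eq by simp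
  moreover have "(1 - v) * (\<Sum>k. v ^ k) = 1" by (simp only: left_diff_distrib l) (simp add: eq)
  moreover have "(\<Sum>k. v ^ k) * (1 - v) = 1" by (simp only: right_diff_distrib r) (simp add: eq)
  ultimately show thesis using that by blast
qed

text \<open>
  Only the bound on \<open>x\<close> matters for the logarithm; the bound on the inverse makes the set
  of products of such elements a group.
\<close>

definition near_one :: "'a::real_normed_algebra_1 \<Rightarrow> bool" where
  "near_one x \<longleftrightarrow> norm (x - 1) < 1/2 \<and> (\<exists>y. x * y = 1 \<and> y * x = 1 \<and> norm (y - 1) < 1/2)"

definition near_products :: "'a::real_normed_algebra_1 set" where
  "near_products = {prod_list xs | xs. \<forall>x\<in>set xs. near_one x}"

text \<open>At distance r < 1/4 the Neumann bound r / (1 - r) is below 1/3, hence below the 1/2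
  required of the inverse.\<close>

lemma near_oneI:
  fixes x :: "'a::{real_normed_algebra_1, banach}"
  assumes "norm (x - 1) < 1/4"
  shows "near_one x"
proof -
  have n: "norm (1 - x) < 1/4" using assms by (simp add: norm_minus_commute)
  obtain y where y: "(1 - (1 - x)) * y = 1" "y * (1 - (1 - x)) = 1"
    "norm (y - 1) \<le> norm (1 - x) / (1 - norm (1 - x))"
    by (rule geometric_inverse[of "1 - x"]) (use n in auto)
  have "norm (1 - x) / (1 - norm (1 - x)) < 1/2" using n by (simp add: field_simps)
  then have "norm (y - 1) < 1/2" using y(3) by linarith
  then show ?thesis using y(1,2) assms unfolding near_one_def by auto
qed

lemma near_oneI2:
  assumes "x * y = 1" "y * x = 1" "norm (x - 1) < 1/2" "norm (y - 1) < 1/2"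
  shows "near_one x"
  using assms unfolding near_one_def by blast

lemma near_one_in_near_products: "near_one x \<Longrightarrow> x \<in> near_products"
  unfolding near_products_def by (intro CollectI exI[of _ "[x]"]) simp

lemma one_in_near_products: "1 \<in> near_products"
  unfolding near_products_def by (intro CollectI exI[of _ "[]"]) simp

lemma mult_in_near_products: "x \<in> near_products \<Longrightarrow> y \<in> near_products \<Longrightarrow> x * y \<in> near_products"
  unfolding near_products_def
proof clarify
  fix xs ys :: "'a list" assume "\<forall>x\<in>set xs. near_one x" "\<forall>x\<in>set ys. near_one x"
  then show "\<exists>zs. prod_list xs * prod_list ys = prod_list zs \<and> (\<forall>x\<in>set zs. near_one x)"
    by (intro exI[of _ "xs @ ys"]) auto
qed

lemma power_in_near_products: "x \<in> near_products \<Longrightarrow> x ^ n \<in> near_products"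
  by (induction n) (auto intro: one_in_near_products mult_in_near_products)

lemma near_products_inverse:
  assumes "x \<in> near_products"
  obtains y where "y \<in> near_products" "x * y = 1" "y * x = 1"
proof -
  from assms obtain xs where xs: "x = prod_list xs" "\<forall>x\<in>set xs. near_one x"
    unfolding near_products_def by blast
  from xs(2) have "\<exists>y\<in>near_products. prod_list xs * y = 1 \<and> y * prod_list xs = 1"
  proof (induction xs)
    case Nil then show ?case by (intro bexI[of _ 1]) (auto intro: one_in_near_products)
  next
    case (Cons a xs)
    then obtain y where y: "y \<in> near_products" "prod_list xs * y = 1" "y * prod_list xs = 1" by auto
    from Cons.prems obtain b where b: "near_one b" "a * b = 1" "b * a = 1"
      unfolding near_one_def by auto
    have "a * prod_list xs * (y * b) = a * (prod_list xs * y) * b" by (simp only: mult.assoc)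
    moreover have "y * b * (a * prod_list xs) = y * (b * a) * prod_list xs" by (simp only: mult.assoc)
    ultimately show ?case
      using y b by (intro bexI[of _ "y * b"]) (auto intro: mult_in_near_products near_one_in_near_products)
  qed
  then show thesis using that xs(1) by blast
qed

text \<open>The form in which the group property is used: known factors are multiplied on during a
  reduction and removed afterwards.\<close>

lemma near_products_cancel_left:
  assumes "g \<in> near_products" "g * f \<in> near_products"
  shows "f \<in> near_products"
proof -
  obtain y where y: "y \<in> near_products" "y * g = 1"
    using near_products_inverse[OF assms(1)] by blast
  have "f = y * (g * f)" using y(2) by (simp flip: mult.assoc)
  then show ?thesis using mult_in_near_products[OF y(1) assms(2)] by simp
qed

lemma near_products_cancel_right:
  assumes "g \<in> near_products" "f * g \<in> near_products"
  shows "f \<in> near_products"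
proof -
  obtain y where y: "y \<in> near_products" "g * y = 1"
    using near_products_inverse[OF assms(1)] by blast
  have "f = (f * g) * y" using y(2) by (simp add: mult.assoc)
  then show ?thesis using mult_in_near_products[OF assms(2) y(1)] by simp
qed

text \<open>Since x^2 = 0, 1 + x is the n-th power of 1 + x/n, whose inverse is 1 - x/n; taking n >
  2 \<open>norm x\<close> brings both within 1/2 of 1. Elementary matrices of any size are thus
  covered.\<close>

lemma one_plus_nilpotent_in_near_products:
  fixes x :: "'a::real_normed_algebra_1"
  assumes x: "x * x = 0"
  shows "1 + x \<in> near_products"
proof -
  obtain n :: nat where n: "n > 0" "2 * norm x < real n"
    using reals_Archimedean2[of "2 * norm x"] by (metis norm_ge_zero mult_nonneg_nonneg
        of_nat_0_less_iff order_le_less_trans zero_le_numeral)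
  define v where "v = (1 / real n) *\<^sub>R x"
  have vv: "v * v = 0" by (simp add: v_def x)
  have nv: "norm v < 1/2" using n by (simp add: v_def field_simps)
  have "near_one (1 + v)"
    by (rule near_oneI2[of _ "1 - v"]) (use vv nv in \<open>auto simp: algebra_simps\<close>)
  then have "(1 + v) ^ n \<in> near_products"
    by (intro power_in_near_products near_one_in_near_products)
  moreover have "(1 + v) ^ k = 1 + real k *\<^sub>R v" for k
    by (induction k) (auto simp: algebra_simps vv)
  then have "(1 + v) ^ n = 1 + x" using n by (simp add: v_def)
  ultimately show ?thesis by simp
qed

text \<open>\<open>star u * w\<close> is within 1/4 of 1 because \<open>star u\<close> has norm 1.
  It therefore suffices to factor an approximant w, which may fail to be unitary.\<close>

lemma unitary_in_near_products:
  fixes u w :: "'a::unital_cstar_algebra"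
  assumes w: "w \<in> near_products" and u: "is_unitary u" and wu: "norm (w - u) < 1/4"
  shows "u \<in> near_products"
proof -
  define m where "m = star u * w"
  have "m - 1 = star u * (w - u)" using u by (simp add: m_def is_unitary_def right_diff_distrib)
  then have "norm (m - 1) \<le> norm (star u) * norm (w - u)" by (metis norm_mult_ineq)
  then have "norm (m - 1) < 1/4" using u wu norm_unitary[of u] by simp
  then have "m \<in> near_products" by (intro near_one_in_near_products near_oneI)
  moreover have "u * m = w" using u by (simp add: m_def is_unitary_def flip: mult.assoc)
  ultimately show ?thesis using near_products_cancel_right w by metis
qed

lemma prod_list_approx:
  fixes xs :: "'a::real_normed_algebra_1 list"
  assumes "\<And>i. i < length xs \<Longrightarrow> (\<lambda>k. X k i) \<longlonglongrightarrow> xs ! i"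
  shows "(\<lambda>k. prod_list (map (X k) [0..<length xs])) \<longlonglongrightarrow> prod_list xs"
  using assms
proof (induction xs rule: rev_induct)
  case (snoc x xs)
  have "(\<lambda>k. X k i) \<longlonglongrightarrow> xs ! i" if "i < length xs" for i
    using snoc.prems[of i] that by (simp add: nth_append)
  then have "(\<lambda>k. prod_list (map (X k) [0..<length xs])) \<longlonglongrightarrow> prod_list xs" by (rule snoc.IH)
  moreover have "(\<lambda>k. X k (length xs)) \<longlonglongrightarrow> x" using snoc.prems[of "length xs"] by simp
  ultimately have "(\<lambda>k. prod_list (map (X k) [0..<length xs]) * X k (length xs)) \<longlonglongrightarrow> prod_list xs * x"
    by (rule tendsto_mult)
  then show ?case by simp
qed simp

section \<open>The logarithm near the unit\<close>

text \<open>The coefficient of z^(n+1) in log(1 + z); the shift of the index skips the absent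
  constant term.\<close>

definition log_coeff :: "nat \<Rightarrow> real" where
  "log_coeff n = (-1) ^ n / real (Suc n)"

definition near_log :: "'a::{real_normed_algebra_1, banach} \<Rightarrow> 'a" where
  "near_log x = (\<Sum>n. log_coeff n *\<^sub>R (x - 1) ^ Suc n)"

lemma abs_log_coeff_le: "\<bar>log_coeff n\<bar> \<le> 1"
  by (simp add: log_coeff_def power_abs)

lemma norm_log_term_le:
  fixes x :: "'a::{real_normed_algebra_1, banach}"
  assumes "norm (x - 1) \<le> r"
  shows "norm (log_coeff n *\<^sub>R (x - 1) ^ Suc n) \<le> r ^ Suc n"
proof -
  have "norm (log_coeff n *\<^sub>R (x - 1) ^ Suc n) \<le> 1 * norm ((x - 1) ^ Suc n)"
    using abs_log_coeff_le[of n] unfolding norm_scaleR by (intro mult_right_mono) auto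
  also have "\<dots> \<le> norm (x - 1) ^ Suc n" using norm_power_ineq[of "x - 1" "Suc n"] by simp
  also have "\<dots> \<le> r ^ Suc n" using assms by (intro power_mono) auto
  finally show ?thesis .
qed

lemma summable_power_Suc: "0 \<le> r \<Longrightarrow> r < 1 \<Longrightarrow> summable (\<lambda>n. r ^ Suc n :: real)"
  by (simp add: summable_mult summable_geometric)

lemma summable_log_series:
  fixes x :: "'a::{real_normed_algebra_1, banach}"
  assumes "norm (x - 1) < 1"
  shows "summable (\<lambda>n. log_coeff n *\<^sub>R (x - 1) ^ Suc n)"
  by (rule summable_comparison_test'[OF summable_power_Suc[OF norm_ge_zero assms], of 0])
     (use norm_log_term_le[of x] in simp)

lemma near_log_one [simp]: "near_log 1 = 0"
  by (simp add: near_log_def)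

text \<open>Weierstrass test: on the ball of radius 1/2 the n-th term has norm at most 2^-(n+1), so
  the sum is a uniform limit of polynomials.\<close>

lemma tendsto_near_log:
  fixes x :: "'a::{real_normed_algebra_1, banach}"
  assumes X: "X \<longlonglongrightarrow> x" and x: "norm (x - 1) < 1/2"
  shows "(\<lambda>k. near_log (X k)) \<longlonglongrightarrow> near_log x"
proof -
  let ?B = "ball (1::'a) (1/2)"
  have "uniform_limit ?B (\<lambda>n x. \<Sum>i<n. log_coeff i *\<^sub>R (x - 1) ^ Suc i) near_log sequentially"
    unfolding near_log_def
  proof (rule Weierstrass_m_test[where M = "\<lambda>n. (1/2) ^ Suc n"])
    show "norm (log_coeff n *\<^sub>R (x - 1) ^ Suc n) \<le> (1/2) ^ Suc n" if "x \<in> ?B" for n x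
      using that by (intro norm_log_term_le) (simp add: dist_norm norm_minus_commute)
  qed (rule summable_power_Suc, auto)
  then have "continuous_on ?B (near_log :: 'a \<Rightarrow> 'a)"
    by (rule uniform_limit_theorem[rotated]) (auto intro!: always_eventually continuous_intros)
  moreover have "x \<in> ?B" using x by (simp add: dist_norm norm_minus_commute)
  ultimately have "isCont near_log x" by (simp add: continuous_on_eq_continuous_at)
  then show ?thesis using X by (rule isCont_tendsto_compose)
qed

lemma star_automorphism_near_log:
  assumes "star_automorphism \<theta>" "norm (x - 1) < 1"
  shows "\<theta> (near_log x) = near_log (\<theta> x)"
  unfolding near_log_def
  using bounded_linear.suminf[OF bounded_linear_star_automorphism[OF assms(1)] summable_log_series[OF assms(2)]]
  by (simp only: star_automorphismD[OF assms(1)])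

section \<open>Dimension drop algebras in terms of matrix entries\<close>

text \<open>
  Matrices are handled as functions of two indices, of which only the values below the size
  matter; \<open>drop_fun\<close> is membership in \<^const>\<open>dim_drop\<close> for the curried entries.
\<close>

definition cmat_mult :: "nat \<Rightarrow> (nat \<Rightarrow> nat \<Rightarrow> complex) \<Rightarrow> (nat \<Rightarrow> nat \<Rightarrow> complex) \<Rightarrow> nat \<Rightarrow> nat \<Rightarrow> complex" where
  "cmat_mult n A B i j = (\<Sum>k<n. A i k * B k j)"

definition cmat_one :: "nat \<Rightarrow> nat \<Rightarrow> complex" where
  "cmat_one i j = of_bool (i = j)"

text \<open>The entries of a \<otimes> 1 in the div-mod encoding of index pairs;
  \<open>kron_right\<close> is 1 \<otimes> b.\<close>

definition kron_left :: "nat \<Rightarrow> (nat \<Rightarrow> nat \<Rightarrow> complex) \<Rightarrow> nat \<Rightarrow> nat \<Rightarrow> complex" where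
  [simp]: "kron_left q a i j = of_bool (i mod q = j mod q) * a (i div q) (j div q)"

definition kron_right :: "nat \<Rightarrow> (nat \<Rightarrow> nat \<Rightarrow> complex) \<Rightarrow> nat \<Rightarrow> nat \<Rightarrow> complex" where
  [simp]: "kron_right q b i j = of_bool (i div q = j div q) * b (i mod q) (j mod q)"

definition drop_fun :: "nat \<Rightarrow> nat \<Rightarrow> (real \<Rightarrow> nat \<Rightarrow> nat \<Rightarrow> complex) \<Rightarrow> bool" where
  "drop_fun p q F \<longleftrightarrow>
     (\<forall>i<p * q. \<forall>j<p * q. continuous_on {0..1} (\<lambda>t. F t i j)) \<and>
     (\<exists>a. \<forall>i<p * q. \<forall>j<p * q. F 0 i j = kron_left q a i j) \<and>
     (\<exists>b. \<forall>i<p * q. \<forall>j<p * q. F 1 i j = kron_right q b i j)"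

lemma drop_funI:
  assumes "\<And>i j. i < p * q \<Longrightarrow> j < p * q \<Longrightarrow> continuous_on {0..1} (\<lambda>t. F t i j)"
    and "\<And>i j. i < p * q \<Longrightarrow> j < p * q \<Longrightarrow> F 0 i j = kron_left q a i j"
    and "\<And>i j. i < p * q \<Longrightarrow> j < p * q \<Longrightarrow> F 1 i j = kron_right q b i j"
  shows "drop_fun p q F"
proof -
  have "\<exists>a. \<forall>i<p * q. \<forall>j<p * q. F 0 i j = kron_left q a i j"
    by (rule exI[of _ a]) (simp add: assms(2))
  moreover have "\<exists>b. \<forall>i<p * q. \<forall>j<p * q. F 1 i j = kron_right q b i j"
    by (rule exI[of _ b]) (simp add: assms(3))
  moreover have "\<forall>i<p * q. \<forall>j<p * q. continuous_on {0..1} (\<lambda>t. F t i j)"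
    using assms(1) by simp
  ultimately show ?thesis unfolding drop_fun_def by (intro conjI)
qed

lemma drop_funE:
  assumes "drop_fun p q F"
  obtains a b where "\<And>i j. i < p * q \<Longrightarrow> j < p * q \<Longrightarrow> continuous_on {0..1} (\<lambda>t. F t i j)"
    "\<And>i j. i < p * q \<Longrightarrow> j < p * q \<Longrightarrow> F 0 i j = kron_left q a i j"
    "\<And>i j. i < p * q \<Longrightarrow> j < p * q \<Longrightarrow> F 1 i j = kron_right q b i j"
proof -
  note D = assms[unfolded drop_fun_def]
  obtain a where a: "\<forall>i<p * q. \<forall>j<p * q. F 0 i j = kron_left q a i j"
    using D[THEN conjunct2, THEN conjunct1] by (rule exE)
  obtain b where b: "\<forall>i<p * q. \<forall>j<p * q. F 1 i j = kron_right q b i j"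
    using D[THEN conjunct2, THEN conjunct2] by (rule exE)
  show thesis
    by (rule that[of a b]) (use D[THEN conjunct1] a b in simp_all)
qed

definition drop_mat :: "nat \<Rightarrow> nat \<Rightarrow> (real \<Rightarrow> nat \<Rightarrow> nat \<Rightarrow> complex) \<Rightarrow> real \<Rightarrow> complex mat" where
  "drop_mat p q F = (\<lambda>t\<in>{0..1}. mat (p * q) (p * q) (\<lambda>(i, j). F t i j))"

lemma sum_div_mod:
  fixes f :: "nat \<Rightarrow> nat \<Rightarrow> 'b::comm_monoid_add"
  assumes "0 < q"
  shows "(\<Sum>k<p * q. f (k div q) (k mod q)) = (\<Sum>r<p. \<Sum>c<q. f r c)"
proof -
  have "(\<Sum>r<p. \<Sum>c<q. f r c) = (\<Sum>(r, c)\<in>{..<p} \<times> {..<q}. f r c)"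
    by (rule sum.cartesian_product)
  also have "\<dots> = (\<Sum>k<p * q. f (k div q) (k mod q))"
  proof (rule sum.reindex_bij_witness[where i = "\<lambda>k. (k div q, k mod q)" and j = "\<lambda>(r, c). r * q + c"])
    fix x assume "x \<in> {..<p} \<times> {..<q}"
    then obtain r c where x: "x = (r, c)" "r < p" "c < q" by auto
    have "r * q + c < p * q"
      using x mult_le_mono1[of "Suc r" p q] by simp
    then show "(case x of (r, c) \<Rightarrow> r * q + c) \<in> {..<p * q}" by (simp add: x)
  qed (use assms in \<open>auto simp: div_less_iff_less_mult\<close>)
  finally show ?thesis ..
qed

lemma cmat_mult_one: "i < n \<Longrightarrow> cmat_mult n A cmat_one i j = (if j < n then A i j else 0)"
  "i < n \<Longrightarrow> cmat_mult n cmat_one A i j = A i j"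
  by (auto simp: cmat_mult_def cmat_one_def of_bool_def if_distrib if_distribR sum.delta cong: if_cong)

lemma cmat_mult_assoc:
  "cmat_mult n (cmat_mult n A B) C i j = cmat_mult n A (cmat_mult n B C) i j"
proof -
  have "cmat_mult n (cmat_mult n A B) C i j = (\<Sum>k<n. \<Sum>l<n. A i l * B l k * C k j)"
    by (simp add: cmat_mult_def sum_distrib_right)
  also have "\<dots> = (\<Sum>l<n. \<Sum>k<n. A i l * B l k * C k j)" by (rule sum.swap)
  also have "\<dots> = cmat_mult n A (cmat_mult n B C) i j"
    by (simp add: cmat_mult_def sum_distrib_left mult.assoc)
  finally show ?thesis .
qed

lemma cmat_mult_cong:
  "(\<And>k. k < n \<Longrightarrow> A i k = A' i k) \<Longrightarrow> (\<And>k. k < n \<Longrightarrow> B k j = B' k j) \<Longrightarrow>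
   cmat_mult n A B i j = cmat_mult n A' B' i j"
  by (simp add: cmat_mult_def)

lemma kron_left_mult:
  assumes q: "0 < q"
  shows "cmat_mult (p * q) (kron_left q a) (kron_left q c) i j = kron_left q (cmat_mult p a c) i j"
proof -
  have "cmat_mult (p * q) (kron_left q a) (kron_left q c) i j =
      (\<Sum>r<p. \<Sum>s<q. of_bool (i mod q = s) * a (i div q) r * (of_bool (s = j mod q) * c r (j div q)))"
    unfolding cmat_mult_def kron_left_def by (rule sum_div_mod[OF q])
  also have "\<dots> = (\<Sum>r<p. \<Sum>s<q. if s = i mod q then of_bool (i mod q = j mod q) * (a (i div q) r * c r (j div q)) else 0)"
    by (intro sum.cong refl) auto
  also have "\<dots> = kron_left q (cmat_mult p a c) i j"
    using q by (simp add: cmat_mult_def sum_distrib_left)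
  finally show ?thesis .
qed

lemma kron_right_mult:
  assumes q: "0 < q" and i: "i < p * q"
  shows "cmat_mult (p * q) (kron_right q b) (kron_right q d) i j = kron_right q (cmat_mult q b d) i j"
proof -
  have ip: "i div q < p" using i q by (simp add: div_less_iff_less_mult)
  have "cmat_mult (p * q) (kron_right q b) (kron_right q d) i j =
      (\<Sum>r<p. \<Sum>s<q. of_bool (i div q = r) * b (i mod q) s * (of_bool (r = j div q) * d s (j mod q)))"
    unfolding cmat_mult_def kron_right_def by (rule sum_div_mod[OF q])
  also have "\<dots> = (\<Sum>r<p. if r = i div q then (\<Sum>s<q. of_bool (i div q = j div q) * (b (i mod q) s * d s (j mod q))) else 0)"
    by (intro sum.cong refl) auto
  also have "\<dots> = kron_right q (cmat_mult q b d) i j"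
    using ip by (simp add: cmat_mult_def sum_distrib_left)
  finally show ?thesis .
qed

lemma div_mod_eq_iff: "(i::nat) = j \<longleftrightarrow> i div q = j div q \<and> i mod q = j mod q"
proof
  assume h: "i div q = j div q \<and> i mod q = j mod q"
  have "i = i div q * q + i mod q" by simp
  also have "\<dots> = j" by (simp only: h[THEN conjunct1] h[THEN conjunct2] div_mult_mod_eq)
  finally show "i = j" .
qed simp

lemma kron_cmat_one: "kron_left q (\<lambda>i j. c * cmat_one i j) i j = c * cmat_one i j"
  "kron_right q (\<lambda>i j. c * cmat_one i j) i j = c * cmat_one i j"
  using div_mod_eq_iff[of i j q] by (auto simp: cmat_one_def)

lemma drop_fun_add:
  assumes F: "drop_fun p q F" and G: "drop_fun p q G"
  shows "drop_fun p q (\<lambda>t i j. F t i j + G t i j)"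
proof (rule drop_funE[OF F], rule drop_funE[OF G], goal_cases)
  case (1 a b c d)
  then show ?thesis
    by (intro drop_funI[where a = "\<lambda>i j. a i j + c i j" and b = "\<lambda>i j. b i j + d i j"])
       (auto intro!: continuous_intros simp: distrib_left)
qed

lemma drop_fun_scale:
  assumes F: "drop_fun p q F"
  shows "drop_fun p q (\<lambda>t i j. c * F t i j)"
proof (rule drop_funE[OF F], goal_cases)
  case (1 a b)
  then show ?thesis
    by (intro drop_funI[where a = "\<lambda>i j. c * a i j" and b = "\<lambda>i j. c * b i j"])
       (auto intro!: continuous_intros)
qed

lemma drop_fun_adjoint:
  assumes F: "drop_fun p q F"
  shows "drop_fun p q (\<lambda>t i j. cnj (F t j i))"
proof (rule drop_funE[OF F], goal_cases)
  case (1 a b)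
  then show ?thesis
    by (intro drop_funI[where a = "\<lambda>i j. cnj (a j i)" and b = "\<lambda>i j. cnj (b j i)"])
       (auto intro!: continuous_intros)
qed

lemma drop_fun_mult:
  assumes q: "0 < q" and F: "drop_fun p q F" and G: "drop_fun p q G"
  shows "drop_fun p q (\<lambda>t. cmat_mult (p * q) (F t) (G t))"
proof -
  obtain a b where cF: "\<And>i j. i < p * q \<Longrightarrow> j < p * q \<Longrightarrow> continuous_on {0..1} (\<lambda>t. F t i j)"
    and a: "\<And>i j. i < p * q \<Longrightarrow> j < p * q \<Longrightarrow> F 0 i j = kron_left q a i j"
    and b: "\<And>i j. i < p * q \<Longrightarrow> j < p * q \<Longrightarrow> F 1 i j = kron_right q b i j"
    by (rule drop_funE[OF F]) (rule that; assumption)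
  obtain c d where cG: "\<And>i j. i < p * q \<Longrightarrow> j < p * q \<Longrightarrow> continuous_on {0..1} (\<lambda>t. G t i j)"
    and c: "\<And>i j. i < p * q \<Longrightarrow> j < p * q \<Longrightarrow> G 0 i j = kron_left q c i j"
    and d: "\<And>i j. i < p * q \<Longrightarrow> j < p * q \<Longrightarrow> G 1 i j = kron_right q d i j"
    by (rule drop_funE[OF G]) (rule that; assumption)
  have "cmat_mult (p * q) (F 0) (G 0) i j = kron_left q (cmat_mult p a c) i j"
    if "i < p * q" "j < p * q" for i j
    unfolding kron_left_mult[OF q, symmetric] by (rule cmat_mult_cong) (use a c that in auto)
  moreover have "cmat_mult (p * q) (F 1) (G 1) i j = kron_right q (cmat_mult q b d) i j"
    if "i < p * q" "j < p * q" for i j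
    unfolding kron_right_mult[OF q that(1), symmetric] by (rule cmat_mult_cong) (use b d that in auto)
  moreover have "continuous_on {0..1} (\<lambda>t. cmat_mult (p * q) (F t) (G t) i j)"
    if "i < p * q" "j < p * q" for i j
    using that unfolding cmat_mult_def by (intro continuous_intros cF cG) auto
  ultimately show ?thesis
    by (intro drop_funI[where a = "cmat_mult p a c" and b = "cmat_mult q b d"]) simp_all
qed

lemma drop_mat_in_dim_drop:
  assumes "0 < q" and F: "drop_fun p q F"
  shows "drop_mat p q F \<in> dim_drop p q"
proof -
  obtain a b where c: "\<And>i j. i < p * q \<Longrightarrow> j < p * q \<Longrightarrow> continuous_on {0..1} (\<lambda>t. F t i j)"
    and a: "\<And>i j. i < p * q \<Longrightarrow> j < p * q \<Longrightarrow> F 0 i j = kron_left q a i j"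
    and b: "\<And>i j. i < p * q \<Longrightarrow> j < p * q \<Longrightarrow> F 1 i j = kron_right q b i j"
    by (rule drop_funE[OF F]) (rule that; assumption)
  have lt: "i div q < p" if "i < p * q" for i using that assms(1) by (simp add: div_less_iff_less_mult)
  have "continuous_on {0..1} (\<lambda>t. drop_mat p q F t $$ (i, j))" if "i < p * q" "j < p * q" for i j
  proof -
    have "continuous_on {0..1} (\<lambda>t. F t i j)" using c that by blast
    then show ?thesis
      by (rule continuous_on_eq) (use that in \<open>simp add: drop_mat_def\<close>)
  qed
  moreover have "drop_mat p q F 0 = kronecker_mat (mat p p (\<lambda>(i, j). a i j)) (1\<^sub>m q)"
    using a lt assms(1) by (intro eq_matI) (auto simp: drop_mat_def kronecker_mat_def)
  moreover have "drop_mat p q F 1 = kronecker_mat (1\<^sub>m p) (mat q q (\<lambda>(i, j). b i j))"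
    using b lt assms(1) by (intro eq_matI) (auto simp: drop_mat_def kronecker_mat_def)
  moreover have "drop_mat p q F \<in> {0..1} \<rightarrow>\<^sub>E carrier_mat (p * q) (p * q)"
    by (auto simp: drop_mat_def)
  ultimately show ?thesis
    unfolding dim_drop_def by (blast intro: mat_carrier)
qed

lemma dim_drop_eq_drop_mat:
  assumes "0 < q" "f \<in> dim_drop p q"
  obtains F where "drop_fun p q F" "f = drop_mat p q F"
proof -
  define F where "F t i j = f t $$ (i, j)" for t i j
  obtain a b where a: "a \<in> carrier_mat p p" "f 0 = kronecker_mat a (1\<^sub>m q)"
    and b: "b \<in> carrier_mat q q" "f 1 = kronecker_mat (1\<^sub>m p) b"
    using assms(2) unfolding dim_drop_def by blast
  have lt: "i div q < p" if "i < p * q" for i using that assms(1) by (simp add: div_less_iff_less_mult)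
  have h0: "\<forall>i<p * q. \<forall>j<p * q. F 0 i j = of_bool (i mod q = j mod q) * a $$ (i div q, j div q)"
    using a lt assms(1) by (auto simp: F_def kronecker_mat_def)
  have h1: "\<forall>i<p * q. \<forall>j<p * q. F 1 i j = of_bool (i div q = j div q) * b $$ (i mod q, j mod q)"
    using b lt assms(1) by (auto simp: F_def kronecker_mat_def)
  have h: "\<forall>i<p * q. \<forall>j<p * q. continuous_on {0..1} (\<lambda>t. F t i j)"
    using assms(2) unfolding dim_drop_def F_def by blast
  have ok: "drop_fun p q F"
    using h h0 h1
    by (intro drop_funI[where a = "\<lambda>i j. a $$ (i, j)" and b = "\<lambda>i j. b $$ (i, j)"]) simp_all
  have f: "f \<in> {0..1} \<rightarrow>\<^sub>E carrier_mat (p * q) (p * q)"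
    using assms(2) unfolding dim_drop_def by blast
  have "f = drop_mat p q F"
  proof
    fix t
    show "f t = drop_mat p q F t"
    proof (cases "t \<in> {0..1}")
      case True
      then have "f t \<in> carrier_mat (p * q) (p * q)" using f by blast
      then show ?thesis using True by (intro eq_matI) (auto simp: drop_mat_def F_def)
    next
      case False
      then show ?thesis using f by (auto simp: drop_mat_def PiE_def extensional_def)
    qed
  qed
  with ok show thesis by (rule that)
qed

text \<open>A unital embedding seen through entry functions. These have irrelevant values outside
  the interval and beyond the matrix size, so \<open>cong\<close> makes \<open>\<Phi>\<close> blind
  to them and \<open>inj\<close> recovers only the relevant ones.\<close>

locale drop_embedding =
  fixes p q N :: nat and \<Phi> :: "(real \<Rightarrow> nat \<Rightarrow> nat \<Rightarrow> complex) \<Rightarrow> 'a::unital_cstar_algebra"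
  assumes p: "0 < p" and q: "0 < q" and N_def: "N = p * q" and coprime_pq: "coprime p q"
    and cong: "(\<And>t i j. t \<in> {0..1} \<Longrightarrow> i < N \<Longrightarrow> j < N \<Longrightarrow> F t i j = G t i j) \<Longrightarrow> \<Phi> F = \<Phi> G"
    and inj: "drop_fun p q F \<Longrightarrow> drop_fun p q G \<Longrightarrow> \<Phi> F = \<Phi> G \<Longrightarrow>
      t \<in> {0..1} \<Longrightarrow> i < N \<Longrightarrow> j < N \<Longrightarrow> F t i j = G t i j"
    and one: "\<Phi> (\<lambda>t. cmat_one) = 1"
    and add: "drop_fun p q F \<Longrightarrow> drop_fun p q G \<Longrightarrow> \<Phi> (\<lambda>t i j. F t i j + G t i j) = \<Phi> F + \<Phi> G"
    and scale: "drop_fun p q F \<Longrightarrow> \<Phi> (\<lambda>t i j. c * F t i j) = scaleC c (\<Phi> F)"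
    and mult: "drop_fun p q F \<Longrightarrow> drop_fun p q G \<Longrightarrow> \<Phi> (\<lambda>t. cmat_mult N (F t) (G t)) = \<Phi> F * \<Phi> G"
    and adjoint: "drop_fun p q F \<Longrightarrow> \<Phi> (\<lambda>t i j. cnj (F t j i)) = star (\<Phi> F)"

lemma drop_embedding_of_dim_drop_embedding:
  assumes pq: "0 < p" "0 < q" "coprime p q" and \<phi>: "dim_drop_embedding p q \<phi>"
  shows "drop_embedding p q (p * q) (\<phi> \<circ> drop_mat p q)"
    and "\<phi> ` dim_drop p q = (\<phi> \<circ> drop_mat p q) ` {F. drop_fun p q F}"
proof -
  note dd = drop_mat_in_dim_drop[OF pq(2)]
  have sum: "(\<lambda>t\<in>{0..1}. drop_mat p q F t + drop_mat p q G t) = drop_mat p q (\<lambda>t i j. F t i j + G t i j)" for F G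
    by (auto simp: drop_mat_def fun_eq_iff restrict_def intro!: eq_matI)
  have scale: "(\<lambda>t\<in>{0..1}. c \<cdot>\<^sub>m drop_mat p q F t) = drop_mat p q (\<lambda>t i j. c * F t i j)" for F c
    by (auto simp: drop_mat_def fun_eq_iff restrict_def intro!: eq_matI)
  have mult: "(\<lambda>t\<in>{0..1}. drop_mat p q F t * drop_mat p q G t) = drop_mat p q (\<lambda>t. cmat_mult (p * q) (F t) (G t))" for F G
    by (auto simp: drop_mat_def fun_eq_iff restrict_def cmat_mult_def scalar_prod_def atLeast0LessThan
        intro!: eq_matI sum.cong)
  have adj: "(\<lambda>t\<in>{0..1}. mat_adjoint (drop_mat p q F t)) = drop_mat p q (\<lambda>t i j. cnj (F t j i))" for F
    by (auto simp: drop_mat_def fun_eq_iff restrict_def mat_adjoint_def mat_of_rows_def intro!: eq_matI)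
  have one: "drop_mat p q (\<lambda>t. cmat_one) = (\<lambda>t\<in>{0..1}. 1\<^sub>m (p * q))"
    by (auto simp: drop_mat_def fun_eq_iff restrict_def cmat_one_def intro!: eq_matI)
  note \<phi>' = \<phi>[unfolded dim_drop_embedding_def]
  note \<phi>0 = \<phi>'[THEN conjunct1]
    and \<phi>1 = \<phi>'[THEN conjunct2, THEN conjunct1]
    and \<phi>2 = \<phi>'[THEN conjunct2, THEN conjunct2, THEN conjunct1, THEN bspec, THEN bspec]
    and \<phi>3 = \<phi>'[THEN conjunct2, THEN conjunct2, THEN conjunct2, THEN conjunct1, THEN spec, THEN bspec]
    and \<phi>4 = \<phi>'[THEN conjunct2, THEN conjunct2, THEN conjunct2, THEN conjunct2, THEN conjunct1,
      THEN bspec, THEN bspec]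
    and \<phi>5 = \<phi>'[THEN conjunct2, THEN conjunct2, THEN conjunct2, THEN conjunct2, THEN conjunct2, THEN bspec]
  show "drop_embedding p q (p * q) (\<phi> \<circ> drop_mat p q)"
  proof
    fix F G :: "real \<Rightarrow> nat \<Rightarrow> nat \<Rightarrow> complex"
    assume "\<And>t i j. t \<in> {0..1} \<Longrightarrow> i < p * q \<Longrightarrow> j < p * q \<Longrightarrow> F t i j = G t i j"
    then have "drop_mat p q F = drop_mat p q G"
      by (auto simp: drop_mat_def fun_eq_iff restrict_def intro!: eq_matI)
    then show "(\<phi> \<circ> drop_mat p q) F = (\<phi> \<circ> drop_mat p q) G" by simp
  next
    fix F G :: "real \<Rightarrow> nat \<Rightarrow> nat \<Rightarrow> complex" and t :: real and i j
    assume FG: "drop_fun p q F" "drop_fun p q G" "(\<phi> \<circ> drop_mat p q) F = (\<phi> \<circ> drop_mat p q) G"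
      and tij: "t \<in> {0..1}" "i < p * q" "j < p * q"
    then have "drop_mat p q F = drop_mat p q G"
      using inj_onD[OF \<phi>0 _ dd dd] by simp
    then have "drop_mat p q F t $$ (i, j) = drop_mat p q G t $$ (i, j)" by simp
    then show "F t i j = G t i j" using tij by (simp add: drop_mat_def)
  next
    show "(\<phi> \<circ> drop_mat p q) (\<lambda>t. cmat_one) = 1" by (simp add: one \<phi>1)
  next
    fix F G assume "drop_fun p q F" "drop_fun p q G"
    then show "(\<phi> \<circ> drop_mat p q) (\<lambda>t i j. F t i j + G t i j) = (\<phi> \<circ> drop_mat p q) F + (\<phi> \<circ> drop_mat p q) G"
      using \<phi>2[OF dd dd] by (simp only: comp_def sum)
  next
    fix F c assume "drop_fun p q F"
    then show "(\<phi> \<circ> drop_mat p q) (\<lambda>t i j. c * F t i j) = scaleC c ((\<phi> \<circ> drop_mat p q) F)"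
      using \<phi>3[OF dd] by (simp only: comp_def scale)
  next
    fix F G assume "drop_fun p q F" "drop_fun p q G"
    then show "(\<phi> \<circ> drop_mat p q) (\<lambda>t. cmat_mult (p * q) (F t) (G t)) = (\<phi> \<circ> drop_mat p q) F * (\<phi> \<circ> drop_mat p q) G"
      using \<phi>4[OF dd dd] by (simp only: comp_def mult)
  next
    fix F assume "drop_fun p q F"
    then show "(\<phi> \<circ> drop_mat p q) (\<lambda>t i j. cnj (F t j i)) = star ((\<phi> \<circ> drop_mat p q) F)"
      using \<phi>5[OF dd] by (simp only: comp_def adj)
  qed (use pq in auto)
  show "\<phi> ` dim_drop p q = (\<phi> \<circ> drop_mat p q) ` {F. drop_fun p q F}"
  proof (intro equalityI subsetI)
    fix x assume "x \<in> \<phi> ` dim_drop p q"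
    then obtain f where f: "f \<in> dim_drop p q" "x = \<phi> f" by blast
    obtain F where "drop_fun p q F" "f = drop_mat p q F"
      by (rule dim_drop_eq_drop_mat[OF pq(2) f(1)])
    then show "x \<in> (\<phi> \<circ> drop_mat p q) ` {F. drop_fun p q F}" using f(2) by auto
  qed (use dd in auto)
qed

context drop_embedding
begin

abbreviation "ok \<equiv> drop_fun p q"

lemma N_pos: "0 < N" using p q by (simp add: N_def)

lemma div_less: "i < N \<Longrightarrow> i div q < p" using q by (simp add: N_def div_less_iff_less_mult)

lemma ok_mult: "ok F \<Longrightarrow> ok G \<Longrightarrow> ok (\<lambda>t. cmat_mult N (F t) (G t))"
  using drop_fun_mult[OF q] by (simp add: N_def)

lemma ok_continuous: "ok F \<Longrightarrow> i < N \<Longrightarrow> j < N \<Longrightarrow> continuous_on {0..1} (\<lambda>t. F t i j)"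
  by (simp add: drop_fun_def N_def)

lemma ok_cmat_one_scaled: "continuous_on {0..1} s \<Longrightarrow> ok (\<lambda>t i j. s t * cmat_one i j)"
  by (rule drop_funI[where a = "\<lambda>i j. s 0 * cmat_one i j" and b = "\<lambda>i j. s 1 * cmat_one i j"])
     (simp_all only: kron_cmat_one continuous_on_mult_right)

lemma ok_one: "ok (\<lambda>t. cmat_one)"
  using ok_cmat_one_scaled[of "\<lambda>_. 1"] by simp

lemma ok_zero: "ok (\<lambda>t i j. 0)"
  by (intro drop_funI[where a = "\<lambda>i j. 0" and b = "\<lambda>i j. 0"]) auto

lemma zero: "\<Phi> (\<lambda>t i j. 0) = 0"
  using scale[OF ok_zero, of 0] by simp

lemma ok_sum: "finite I \<Longrightarrow> (\<And>x. x \<in> I \<Longrightarrow> ok (F x)) \<Longrightarrow> ok (\<lambda>t i j. \<Sum>x\<in>I. F x t i j)"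
  by (induction I rule: finite_induct) (auto intro: ok_zero drop_fun_add)

lemma sum: "finite I \<Longrightarrow> (\<And>x. x \<in> I \<Longrightarrow> ok (F x)) \<Longrightarrow> \<Phi> (\<lambda>t i j. \<Sum>x\<in>I. F x t i j) = (\<Sum>x\<in>I. \<Phi> (F x))"
  by (induction I rule: finite_induct) (auto simp: zero add ok_sum)

end

section \<open>Matrix units with function coefficients\<close>

text \<open>The ideal of admissible coefficients: a matrix unit that may violate the boundary
  conditions at the points of Z is multiplied only by functions vanishing there.\<close>

definition cont_vanishing :: "real set \<Rightarrow> (real \<Rightarrow> complex) set" where
  "cont_vanishing Z = {s. continuous_on {0..1} s \<and> (\<forall>z\<in>Z. s z = 0)}"

lemma cont_vanishingD: "s \<in> cont_vanishing Z \<Longrightarrow> continuous_on {0..1} s"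
  by (simp add: cont_vanishing_def)

lemma cont_vanishing_add: "s \<in> cont_vanishing Z \<Longrightarrow> r \<in> cont_vanishing Z \<Longrightarrow> (\<lambda>t. s t + r t) \<in> cont_vanishing Z"
  by (auto simp: cont_vanishing_def intro!: continuous_intros)

lemma cont_vanishing_zero: "(\<lambda>t. 0) \<in> cont_vanishing Z"
  by (auto simp: cont_vanishing_def)

lemma cont_vanishing_mult: "continuous_on {0..1} s \<Longrightarrow> r \<in> cont_vanishing Z \<Longrightarrow> (\<lambda>t. s t * r t) \<in> cont_vanishing Z"
  by (auto simp: cont_vanishing_def intro!: continuous_intros)

lemma cont_vanishing_compose:
  "continuous_on UNIV f \<Longrightarrow> f 0 = 0 \<Longrightarrow> s \<in> cont_vanishing Z \<Longrightarrow> (\<lambda>t. f (s t)) \<in> cont_vanishing Z"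
  by (auto simp: cont_vanishing_def intro: continuous_on_compose2)

text \<open>At 0 the value is 0 by the convention for division, and the modulus, sqrt |z|, tends to
  0.\<close>

lemma continuous_divide_sqrt_norm:
  "continuous_on UNIV (\<lambda>z. z / complex_of_real (sqrt (cmod z)))"
proof -
  let ?f = "\<lambda>z. z / complex_of_real (sqrt (cmod z))"
  have "isCont ?f z" for z
  proof (cases "z = 0")
    case True
    have "(\<lambda>z. sqrt (cmod z)) \<midarrow>0\<rightarrow> sqrt (cmod 0)"
      by (intro tendsto_intros)
    then have "(\<lambda>z. cmod (?f z)) \<midarrow>0\<rightarrow> 0"
      by (simp add: norm_divide real_div_sqrt)
    then have "?f \<midarrow>0\<rightarrow> 0" by (rule tendsto_norm_zero_cancel)
    then show ?thesis by (simp add: True isCont_def)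
  qed (auto intro!: continuous_intros)
  then show ?thesis by (simp add: continuous_on_eq_continuous_at)
qed

text \<open>Split s into sqrt |s| and s / sqrt |s|. Then s e_ij = (a e_ik)(b e_kj) with both factors
  in the algebra, which replaces e_ij = e_ik e_kj where the bare units are missing.\<close>

lemma cont_vanishing_factor:
  assumes "s \<in> cont_vanishing Z"
  obtains a b where "a \<in> cont_vanishing Z" "b \<in> cont_vanishing Z" "s = (\<lambda>t. a t * b t)"
proof (rule that)
  show "(\<lambda>t. complex_of_real (sqrt (cmod (s t)))) \<in> cont_vanishing Z"
    by (rule cont_vanishing_compose[OF _ _ assms, of "\<lambda>z. complex_of_real (sqrt (cmod z))"])
       (auto intro!: continuous_intros)
  show "(\<lambda>t. s t / complex_of_real (sqrt (cmod (s t)))) \<in> cont_vanishing Z"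
    by (rule cont_vanishing_compose[OF continuous_divide_sqrt_norm _ assms]) simp
qed (simp add: fun_eq_iff)

lemma continuous_bounded_unit_interval:
  fixes s :: "real \<Rightarrow> complex"
  assumes "continuous_on {0..1} s"
  obtains M where "0 < M" "\<And>t. t \<in> {0..1} \<Longrightarrow> cmod (s t) \<le> M"
proof -
  have "bounded (s ` {0..1})"
    by (intro compact_imp_bounded compact_continuous_image assms) simp
  then show thesis using that unfolding bounded_pos by auto
qed

text \<open>A constant full system of m by m matrix units in M_N; the dimension drop algebra is only
  required to contain their multiples by functions vanishing on Z. One set of lemmas then serves the
  interior, each end and the scalar functions.\<close>

locale matrix_units = drop_embedding p q N \<Phi>
  for p q N :: nat and \<Phi> :: "(real \<Rightarrow> nat \<Rightarrow> nat \<Rightarrow> complex) \<Rightarrow> 'a::unital_cstar_algebra" +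
  fixes Z :: "real set" and m :: nat and e :: "nat \<Rightarrow> nat \<Rightarrow> nat \<Rightarrow> nat \<Rightarrow> complex"
  assumes m: "0 < m"
    and units_ok: "i < m \<Longrightarrow> j < m \<Longrightarrow> s \<in> cont_vanishing Z \<Longrightarrow> drop_fun p q (\<lambda>t k l. s t * e i j k l)"
    and units_mult: "i < m \<Longrightarrow> j < m \<Longrightarrow> r < m \<Longrightarrow> l < m \<Longrightarrow> a < N \<Longrightarrow> b < N \<Longrightarrow>
      cmat_mult N (e i j) (e r l) a b = of_bool (j = r) * e i l a b"
    and units_adjoint: "i < m \<Longrightarrow> j < m \<Longrightarrow> a < N \<Longrightarrow> b < N \<Longrightarrow> cnj (e i j b a) = e j i a b"
    and units_sum: "a < N \<Longrightarrow> b < N \<Longrightarrow> (\<Sum>i<m. e i i a b) = cmat_one a b"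
    and units_nonzero: "i < m \<Longrightarrow> \<exists>a<N. \<exists>b<N. e i i a b \<noteq> 0"
begin

abbreviation "S \<equiv> cont_vanishing Z"

definition "X s i j = \<Phi> (\<lambda>t k l. s t * e i j k l)"

lemma X_cong: "(\<And>t. t \<in> {0..1} \<Longrightarrow> s t = r t) \<Longrightarrow> X s i j = X r i j"
  unfolding X_def by (rule cong) simp

lemma X_add:
  assumes "i < m" "j < m" "s \<in> S" "r \<in> S"
  shows "X (\<lambda>t. s t + r t) i j = X s i j + X r i j"
  using add[OF units_ok[OF assms(1-3)] units_ok[OF assms(1,2,4)]] by (simp add: X_def distrib_right)

lemma X_scale:
  assumes "i < m" "j < m" "s \<in> S"
  shows "X (\<lambda>t. c * s t) i j = scaleC c (X s i j)"
  using scale[OF units_ok[OF assms], of c] by (simp add: X_def mult.assoc)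

lemma X_zero: "X (\<lambda>t. 0) i j = 0"
  by (simp add: X_def zero)

lemma X_mult:
  assumes "i < m" "j < m" "k < m" "l < m" "s \<in> S" "r \<in> S"
  shows "X s i j * X r k l = (if j = k then X (\<lambda>t. s t * r t) i l else 0)"
proof -
  have "X s i j * X r k l = \<Phi> (\<lambda>t. cmat_mult N (\<lambda>a b. s t * e i j a b) (\<lambda>a b. r t * e k l a b))"
    unfolding X_def by (rule mult[symmetric]) (use units_ok assms in auto)
  also have "\<dots> = \<Phi> (\<lambda>t a b. of_bool (j = k) * (s t * r t * e i l a b))"
  proof (rule cong)
    fix t :: real and a b assume "a < N" "b < N"
    have "cmat_mult N (\<lambda>a b. s t * e i j a b) (\<lambda>a b. r t * e k l a b) a b =
        s t * r t * cmat_mult N (e i j) (e k l) a b"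
      by (simp add: cmat_mult_def sum_distrib_left mult.assoc mult.left_commute)
    also have "\<dots> = of_bool (j = k) * (s t * r t * e i l a b)"
      using units_mult[OF assms(1-4) \<open>a < N\<close> \<open>b < N\<close>] by simp
    finally show "cmat_mult N (\<lambda>a b. s t * e i j a b) (\<lambda>a b. r t * e k l a b) a b =
        of_bool (j = k) * (s t * r t * e i l a b)" .
  qed
  also have "\<dots> = (if j = k then X (\<lambda>t. s t * r t) i l else 0)"
    by (simp add: X_def zero)
  finally show ?thesis .
qed

lemma X_star:
  assumes "i < m" "j < m" "s \<in> S"
  shows "star (X s i j) = X (\<lambda>t. cnj (s t)) j i"
proof -
  have "star (X s i j) = \<Phi> (\<lambda>t a b. cnj (s t * e i j b a))"
    unfolding X_def by (rule adjoint[symmetric]) (use units_ok assms in auto)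
  also have "\<dots> = X (\<lambda>t. cnj (s t)) j i"
    unfolding X_def by (rule cong) (use units_adjoint[OF assms(1,2)] in simp)
  finally show ?thesis .
qed

section \<open>Norms of functions times matrix units\<close>

lemma X_circle_mult:
  assumes "i < m" "f \<in> S" "g \<in> S"
  shows "(1 + X f i i) * (1 + X g i i) = 1 + X (\<lambda>t. f t + g t + f t * g t) i i"
proof -
  have fg: "(\<lambda>t. f t * g t) \<in> S" using cont_vanishing_mult assms cont_vanishingD by blast
  \<comment> \<open>The coefficient f + g + fg is (1 + f)(1 + g) - 1, the product of the diagonal
    entries with the unit removed.\<close>
  have "X (\<lambda>t. f t + g t + f t * g t) i i = X f i i + X g i i + X f i i * X g i i"
    using assms fg by (simp add: X_add X_mult cont_vanishing_add)
  then show ?thesis by (simp add: algebra_simps)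
qed

text \<open>With \<theta> = arcsin r the element u = 1 + (e^(i\<theta>) - 1) e_ii is unitary, and
  \<open>u - star u\<close> is 2i r e_ii, of norm at most 2. Since arcsin 0 = 0, the coefficients
  stay admissible.\<close>

lemma norm_X_real_le_1:
  assumes i: "i < m" and r: "(\<lambda>t. complex_of_real (r t)) \<in> S" and r1: "\<And>t. t \<in> {0..1} \<Longrightarrow> \<bar>r t\<bar> \<le> 1"
  shows "norm (X (\<lambda>t. complex_of_real (r t)) i i) \<le> 1"
proof -
  define \<theta> where "\<theta> t = arcsin (r t)" for t
  have "continuous_on {0..1} r"
    using continuous_on_Re[OF cont_vanishingD[OF r]] by simp
  then have c: "continuous_on {0..1} \<theta>"
    unfolding \<theta>_def using r1 by (intro continuous_on_arcsin) (simp_all add: abs_le_iff minus_le_iff)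
  have f: "(\<lambda>t. cis (c * \<theta> t) - 1) \<in> S" for c
    using c r by (auto simp: cont_vanishing_def \<theta>_def intro!: continuous_intros)
  let ?f = "\<lambda>c t. cis (c * \<theta> t) - 1"
  have 1: "(1 + X (?f c) i i) * (1 + X (?f (- c)) i i) = 1" for c
  proof -
    have "(1 + X (?f c) i i) * (1 + X (?f (- c)) i i) = 1 + X (\<lambda>t. ?f c t + ?f (- c) t + ?f c t * ?f (- c) t) i i"
      by (rule X_circle_mult[OF i f f])
    also have "(\<lambda>t. ?f c t + ?f (- c) t + ?f c t * ?f (- c) t) = (\<lambda>t. 0)"
      by (simp add: algebra_simps cis_mult)
    finally show ?thesis by (simp add: X_zero)
  qed
  define u where "u = 1 + X (?f 1) i i"
  have su: "star u = 1 + X (?f (-1)) i i"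
    using X_star[OF i i f, of 1] by (simp add: u_def star_add cis_cnj)
  have "is_unitary u" using 1[of 1] 1[of "-1"] by (simp add: is_unitary_def su) (simp add: u_def)
  then have nu: "norm u = 1" by (rule norm_unitary)
  have "u - star u = X (?f 1) i i + scaleC (-1) (X (?f (-1)) i i)"
    unfolding su by (simp add: u_def scaleC_minus_left)
  also have "\<dots> = X (?f 1) i i + X (\<lambda>t. (-1) * ?f (-1) t) i i"
    by (simp only: X_scale[OF i i f])
  also have "\<dots> = X (\<lambda>t. ?f 1 t + (-1) * ?f (-1) t) i i"
    by (rule X_add[OF i i f cont_vanishing_mult[OF continuous_on_const f], symmetric])
  also have "\<dots> = X (\<lambda>t. 2 * \<i> * complex_of_real (r t)) i i"
    by (rule X_cong) (use r1 in \<open>auto simp: \<theta>_def complex_eq_iff abs_le_iff cos_arcsin\<close>)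
  also have "\<dots> = scaleC (2 * \<i>) (X (\<lambda>t. complex_of_real (r t)) i i)"
    by (rule X_scale[OF i i r])
  finally have "2 * norm (X (\<lambda>t. complex_of_real (r t)) i i) = norm (u - star u)"
    by (simp add: norm_scaleC norm_mult)
  also have "\<dots> \<le> 2" using norm_triangle_ineq4[of u "star u"] nu by simp
  finally show ?thesis by simp
qed

lemma norm_X_square:
  assumes "i < m" "j < m" "s \<in> S"
  shows "(norm (X s i j))\<^sup>2 = norm (X (\<lambda>t. complex_of_real ((cmod (s t))\<^sup>2)) j j)"
proof -
  have c: "(\<lambda>t. cnj (s t)) \<in> S"
    using assms(3) by (auto simp: cont_vanishing_def intro!: continuous_intros)
  have "(norm (X s i j))\<^sup>2 = norm (star (X s i j) * X s i j)" by (rule cstar_identity[symmetric])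
  also have "star (X s i j) * X s i j = X (\<lambda>t. cnj (s t) * s t) j j"
    using assms c by (simp add: X_star X_mult)
  also have "\<dots> = X (\<lambda>t. complex_of_real ((cmod (s t))\<^sup>2)) j j"
    by (rule X_cong) (simp only: complex_norm_square mult.commute)
  finally show ?thesis .
qed

text \<open>The C*-identity turns s e_ij into |s|^2 e_jj; after division by c^2 the coefficient is
  real and at most 1.\<close>

lemma norm_X_le:
  assumes ij: "i < m" "j < m" and s: "s \<in> S" and c: "0 < c" "\<And>t. t \<in> {0..1} \<Longrightarrow> cmod (s t) \<le> c"
  shows "norm (X s i j) \<le> c"
proof -
  define r where "r t = (cmod (s t))\<^sup>2 / c\<^sup>2" for t
  have r: "(\<lambda>t. complex_of_real (r t)) \<in> S"
    using s c(1) by (auto simp: cont_vanishing_def r_def intro!: continuous_intros)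
  have "norm (X (\<lambda>t. complex_of_real (r t)) j j) \<le> 1"
    by (rule norm_X_real_le_1[OF ij(2) r]) (use c in \<open>simp add: r_def power_mono\<close>)
  moreover have "X (\<lambda>t. complex_of_real ((cmod (s t))\<^sup>2)) j j = scaleC (complex_of_real (c\<^sup>2)) (X (\<lambda>t. complex_of_real (r t)) j j)"
    unfolding X_scale[OF ij(2) ij(2) r, symmetric] by (rule X_cong) (use c in \<open>simp add: r_def\<close>)
  ultimately have "(norm (X s i j))\<^sup>2 = c\<^sup>2 * norm (X (\<lambda>t. complex_of_real (r t)) j j)"
    unfolding norm_X_square[OF ij s] by (simp only: norm_scaleC norm_of_real abs_power2)
  also have "\<dots> \<le> c\<^sup>2 * 1"
    by (intro mult_left_mono) (use \<open>_ \<le> 1\<close> in auto)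
  finally have "(norm (X s i j))\<^sup>2 \<le> c\<^sup>2" by simp
  then show ?thesis by (rule power2_le_imp_le) (use c in simp)
qed

text \<open>
  If \<open>norm (X s i j)\<close> were smaller than the peak value \<open>r t\<^sub>0\<close>, then the part \<open>g\<close> of \<open>r\<close>
  above a level in between would satisfy \<open>g = r\<^sup>k h\<^sub>k\<close> with \<open>X g\<close> of norm tending to 0, although
  \<open>g \<noteq> 0\<close>.
\<close>

lemma norm_X_ge:
  assumes ij: "i < m" "j < m" and s: "s \<in> S" and t0: "t0 \<in> {0..1}"
  shows "cmod (s t0) \<le> norm (X s i j)"
proof (rule ccontr)
  define r where "r t = (cmod (s t))\<^sup>2" for t
  let ?R = "\<lambda>t. complex_of_real (r t)"
  define \<rho> where "\<rho> = norm (X ?R j j)"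
  assume "\<not> ?thesis"
  then have "(norm (X s i j))\<^sup>2 < (cmod (s t0))\<^sup>2" by (simp add: power_strict_mono)
  then have "\<rho> < r t0" unfolding norm_X_square[OF ij s] by (simp add: \<rho>_def r_def)
  then obtain r1 where r1: "\<rho> < r1" "r1 < r t0" using dense by blast
  have r1_pos: "0 < r1" using r1 by (simp add: \<rho>_def le_less_trans[OF norm_ge_zero])
  have cs: "continuous_on {0..1} r" unfolding r_def using cont_vanishingD[OF s] by (intro continuous_intros)
  have R: "?R \<in> S" using s by (auto simp: cont_vanishing_def r_def intro!: continuous_intros)
  define g where "g t = max 0 (r t - r1)" for t
  \<comment> \<open>The maximum with \<open>r1\<close> leaves g / r^k unchanged where g is nonzero
    and keeps the quotient continuous elsewhere.\<close>
  define h where "h k t = complex_of_real (g t / (max (r t) r1) ^ k)" for k t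
  have h: "h k \<in> S" for k
    using s r1_pos unfolding cont_vanishing_def h_def g_def
    by (auto intro!: continuous_intros cs simp: r_def less_max_iff_disj)
  have hS: "X (h k) j j = X ?R j j * X (h (Suc k)) j j" for k
  proof -
    have "X ?R j j * X (h (Suc k)) j j = X (\<lambda>t. ?R t * h (Suc k) t) j j"
      using X_mult[OF ij(2) ij(2) ij(2) ij(2) R h] by simp
    also have "\<dots> = X (h k) j j"
    proof (rule X_cong)
      fix t :: real
      show "?R t * h (Suc k) t = h k t"
        using r1_pos by (cases "r t \<le> r1") (auto simp: h_def g_def max_def)
    qed
    finally show ?thesis ..
  qed
  obtain M where M: "0 < M" "\<And>t. t \<in> {0..1} \<Longrightarrow> cmod (h 0 t) \<le> M"
    using continuous_bounded_unit_interval[OF cont_vanishingD[OF h]] by metis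
  have "norm (X (h 0) j j) \<le> \<rho> ^ k * (M / r1 ^ k)" for k
  proof -
    have "norm (X (h 0) j j) \<le> \<rho> ^ k * norm (X (h k) j j)"
    proof (induction k)
      case (Suc k)
      have "norm (X (h k) j j) \<le> \<rho> * norm (X (h (Suc k)) j j)"
        unfolding hS[of k] \<rho>_def by (rule norm_mult_ineq)
      then have "\<rho> ^ k * norm (X (h k) j j) \<le> \<rho> ^ k * (\<rho> * norm (X (h (Suc k)) j j))"
        by (intro mult_left_mono) (auto simp: \<rho>_def)
      then show ?case using Suc by (simp add: mult.assoc mult.left_commute)
    qed simp
    also have "norm (X (h k) j j) \<le> M / r1 ^ k"
    proof (rule norm_X_le[OF ij(2) ij(2) h])
      fix t :: real assume "t \<in> {0..1}"
      then have "g t \<le> M" using M(2)[of t] by (simp add: h_def g_def)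
      then have "g t / max (r t) r1 ^ k \<le> M / r1 ^ k"
        using M(1) r1_pos by (intro frac_le power_mono zero_less_power) (auto simp: g_def)
      moreover have "0 \<le> g t / max (r t) r1 ^ k" using r1_pos by (auto simp: g_def)
      ultimately show "cmod (h k t) \<le> M / r1 ^ k" unfolding h_def norm_of_real by simp
    qed (use M r1_pos in simp)
    finally show ?thesis by (simp add: \<rho>_def mult_left_mono)
  qed
  \<comment> \<open>As \<open>\<rho>\<close> is below \<open>r1\<close>, the bound tends to 0 with k
    while the left-hand side is fixed.\<close>
  then have le: "norm (X (h 0) j j) \<le> M * (\<rho> / r1) ^ k" for k
    by (simp add: power_divide mult.commute)
  have "(\<lambda>k. M * (\<rho> / r1) ^ k) \<longlonglongrightarrow> M * 0"
    using r1 r1_pos by (intro tendsto_intros LIMSEQ_power_zero) (simp add: \<rho>_def)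
  then have "norm (X (h 0) j j) \<le> 0"
    using le by (intro LIMSEQ_le_const[where X = "\<lambda>k. M * (\<rho> / r1) ^ k"]) auto
  then have "X (h 0) j j = \<Phi> (\<lambda>t i j. 0)" by (simp add: zero)
  moreover obtain a b where ab: "a < N" "b < N" "e j j a b \<noteq> 0" using units_nonzero[OF ij(2)] by blast
  ultimately have "h 0 t0 * e j j a b = 0"
    unfolding X_def using inj[OF units_ok[OF ij(2) ij(2) h] ok_zero _ t0 ab(1,2)] by blast
  then show False using ab r1 by (simp add: h_def g_def)
qed

section \<open>Traces of functions times matrix units\<close>

lemma X_trace_off_diagonal:
  assumes \<tau>: "tracial_state \<tau>" and ij: "i < m" "j < m" "i \<noteq> j" and s: "s \<in> S"
  shows "\<tau> (X s i j) = 0"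
proof -
  obtain a b where ab: "a \<in> S" "b \<in> S" "s = (\<lambda>t. a t * b t)" using cont_vanishing_factor[OF s] by blast
  \<comment> \<open>In the opposite order the inner indices j and i differ, so the product is 0 and
    the trace with it.\<close>
  have "X s i j = X a i i * X b i j" using ij ab by (simp add: X_mult)
  moreover have "X b i j * X a i i = 0" using ij ab by (simp add: X_mult)
  ultimately show ?thesis using tracial_stateD(4,5)[OF \<tau>] by metis
qed

text \<open>With s = ab, s e_ii is (a e_ij)(b e_ji), and the product in the opposite order is s
  e_jj.\<close>

lemma X_trace_diagonal_eq:
  assumes \<tau>: "tracial_state \<tau>" and ij: "i < m" "j < m" and s: "s \<in> S"
  shows "\<tau> (X s i i) = \<tau> (X s j j)"
proof -
  obtain a b where ab: "a \<in> S" "b \<in> S" "s = (\<lambda>t. a t * b t)" using cont_vanishing_factor[OF s] by blast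
  have "X s i i = X a i j * X b j i" using ij ab by (simp add: X_mult)
  moreover have "X b j i * X a i j = X s j j" using ij ab by (simp add: X_mult mult.commute)
  ultimately show ?thesis using tracial_stateD(4)[OF \<tau>] by metis
qed

lemma ok_scalar:
  assumes "s \<in> S"
  shows "ok (\<lambda>t i j. s t * cmat_one i j)"
proof -
  have "ok (\<lambda>t a b. \<Sum>i<m. s t * e i i a b)"
    by (rule ok_sum) (use units_ok assms in auto)
  then obtain a b where h: "\<And>i j. i < p * q \<Longrightarrow> j < p * q \<Longrightarrow> continuous_on {0..1} (\<lambda>t. \<Sum>k<m. s t * e k k i j)"
    "\<And>i j. i < p * q \<Longrightarrow> j < p * q \<Longrightarrow> (\<Sum>k<m. s 0 * e k k i j) = kron_left q a i j"
    "\<And>i j. i < p * q \<Longrightarrow> j < p * q \<Longrightarrow> (\<Sum>k<m. s 1 * e k k i j) = kron_right q b i j"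
    by (rule drop_funE) (rule that; assumption)
  have eq: "(\<Sum>k<m. s t * e k k i j) = s t * cmat_one i j" if "i < p * q" "j < p * q" for t i j
    using units_sum[of i j] that by (simp add: N_def flip: sum_distrib_left)
  show ?thesis
    by (rule drop_funI[where a = a and b = b]) (use h eq in simp_all)
qed

text \<open>The m diagonal corners have equal trace and add up to the scalar function s. The trace
  on a corner is therefore determined by its values on scalar functions.\<close>

lemma X_trace_diagonal:
  assumes \<tau>: "tracial_state \<tau>" and i: "i < m" and s: "s \<in> S"
  shows "of_nat m * \<tau> (X s i i) = \<tau> (\<Phi> (\<lambda>t i j. s t * cmat_one i j))"
proof -
  have "\<Phi> (\<lambda>t i j. s t * cmat_one i j) = \<Phi> (\<lambda>t a b. \<Sum>i<m. s t * e i i a b)"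
    by (rule cong) (simp add: units_sum flip: sum_distrib_left)
  also have "\<dots> = (\<Sum>i<m. X s i i)"
    unfolding X_def by (rule sum) (use units_ok s in auto)
  finally have "\<tau> (\<Phi> (\<lambda>t i j. s t * cmat_one i j)) = \<tau> (\<Sum>j<m. X s j j)" by simp
  also have "\<dots> = (\<Sum>j<m. \<tau> (X s j j))"
    by (rule linear_sum[OF bounded_linear.linear[OF bounded_linear_tracial_state[OF \<tau>]]])
  also have "\<dots> = (\<Sum>j<m. \<tau> (X s i i))"
    by (intro sum.cong refl X_trace_diagonal_eq[OF \<tau>]) (use i s in auto)
  finally show ?thesis by simp
qed

section \<open>Elementary and diagonal elements as products of elements near the unit\<close>

lemma one_plus_X_in_near_products:
  assumes "i < m" "j < m" "i \<noteq> j" "s \<in> S"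
  shows "1 + X s i j \<in> near_products"
  by (rule one_plus_nilpotent_in_near_products) (use assms in \<open>simp add: X_mult\<close>)

lemma exp_minus_one_in_S: "g \<in> S \<Longrightarrow> (\<lambda>t. exp (c * g t) - 1) \<in> S"
  by (auto simp: cont_vanishing_def intro!: continuous_intros)

text \<open>Take the n-th root exp(g/n). For n > M/d its coefficient, and that of its inverse, is at
  most 1/4 on the interval, which \<open>norm_X_le\<close> turns into a norm bound.\<close>

lemma exp_X_in_near_products:
  assumes i: "i < m" and g: "g \<in> S"
  shows "1 + X (\<lambda>t. exp (g t) - 1) i i \<in> near_products"
proof -
  let ?f = "\<lambda>c t. exp (c * g t) - 1"
  note f = exp_minus_one_in_S[OF g]
  obtain M where M: "0 < M" "\<And>t. t \<in> {0..1} \<Longrightarrow> cmod (g t) \<le> M"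
    using continuous_bounded_unit_interval[OF cont_vanishingD[OF g]] by metis
  have "isCont (exp :: complex \<Rightarrow> complex) 0" by simp
  then obtain d where d: "0 < d" "\<And>z. cmod z < d \<Longrightarrow> cmod (exp z - 1) < 1/4"
    unfolding continuous_at_eps_delta by (force simp: dist_norm dest: spec[of _ "1/4"])
  obtain n :: nat where n: "M / d < real n" using reals_Archimedean2 by blast
  then have n0: "0 < real n" using M d by (smt (verit) divide_pos_pos)
  have small: "cmod (?f c t) \<le> 1/4" if "cmod c = 1 / real n" "t \<in> {0..1}" for c t
  proof -
    have "cmod (c * g t) \<le> M / real n"
      using M(2)[OF that(2)] n0 by (simp add: norm_mult that(1) divide_right_mono)
    also have "\<dots> < d" using n n0 d by (simp add: field_simps)
    finally show ?thesis using d(2) by (simp add: less_imp_le)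
  qed
  have mult: "(1 + X (?f c) i i) * (1 + X (?f d) i i) = 1 + X (?f (c + d)) i i" for c d
  proof -
    have "(1 + X (?f c) i i) * (1 + X (?f d) i i) = 1 + X (\<lambda>t. ?f c t + ?f d t + ?f c t * ?f d t) i i"
      by (rule X_circle_mult[OF i f f])
    also have "(\<lambda>t. ?f c t + ?f d t + ?f c t * ?f d t) = ?f (c + d)"
      by (simp add: fun_eq_iff algebra_simps exp_add)
    finally show ?thesis .
  qed
  let ?c = "complex_of_real (1 / real n)"
  have "near_one (1 + X (?f ?c) i i)"
  proof (rule near_oneI2)
    show "(1 + X (?f ?c) i i) * (1 + X (?f (- ?c)) i i) = 1" unfolding mult by (simp add: X_zero)
    show "(1 + X (?f (- ?c)) i i) * (1 + X (?f ?c) i i) = 1" unfolding mult by (simp add: X_zero)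
    have "norm (X (?f c) i i) \<le> 1/4" if "cmod c = 1 / real n" for c
      by (rule norm_X_le[OF i i f]) (use small that in auto)
    from this[of ?c] this[of "- ?c"]
    show "norm (1 + X (?f ?c) i i - 1) < 1/2" "norm (1 + X (?f (- ?c)) i i - 1) < 1/2"
      by (simp_all add: norm_divide)
  qed
  then have "(1 + X (?f ?c) i i) ^ n \<in> near_products"
    by (intro power_in_near_products near_one_in_near_products)
  moreover have "(1 + X (?f ?c) i i) ^ k = 1 + X (?f (of_nat k * ?c)) i i" for k
  proof (induction k)
    case (Suc k)
    then show ?case using mult[of ?c "of_nat k * ?c"] by (simp add: distrib_right add_divide_distrib)
  qed (simp add: X_zero)
  ultimately show ?thesis using n0 by simp
qed

text \<open>Whitehead's factorisation of \<open>diag(1 + ab, (1 + ab)\<^sup>-\<^sup>1)\<close> into elementary matrices.\<close>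

lemma whitehead_in_near_products:
  assumes ij: "i < m" "j < m" "i \<noteq> j" and f: "f \<in> S" and nz: "\<And>t. t \<in> {0..1} \<Longrightarrow> 1 + f t \<noteq> 0"
  shows "(1 + X f i i) * (1 + X (\<lambda>t. - f t / (1 + f t)) j j) \<in> near_products"
proof -
  obtain a b where a: "a \<in> S" and b: "b \<in> S" and "f = (\<lambda>t. a t * b t)"
    using cont_vanishing_factor[OF f] by blast
  then have ab: "f t = a t * b t" for t by simp
  have inv: "continuous_on {0..1} (\<lambda>t. - (1 / (1 + f t)))"
    using nz by (intro continuous_intros cont_vanishingD[OF f]) auto
  \<comment> \<open>These clear the off-diagonal entries of (1 + a e_ij)(1 + b e_ji), whose (i, i)
    entry is 1 + f: from the left b + b'(1 + f) = 0, from the right a + (1 + f) a' = 0. What is left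
    in corner j is 1 + f' = 1 / (1 + f).\<close>
  define a' where "a' t = - (1 / (1 + f t)) * a t" for t
  define b' where "b' t = - (1 / (1 + f t)) * b t" for t
  define f' where "f' t = - (1 / (1 + f t)) * f t" for t
  have a': "a' \<in> S" and b': "b' \<in> S" and f': "f' \<in> S"
    unfolding a'_def b'_def f'_def by (intro cont_vanishing_mult inv a b f)+
  note S = a b f a' b' f'
  have e: "X a i j * X b j i = X f i i" using S ij ab by (simp add: X_mult flip: ab)
  have 1: "(1 + X a i j) * (1 + X b j i) = 1 + X f i i + X a i j + X b j i"
    using e by (simp add: algebra_simps)
  have z: "X b' j i * X b j i = 0" using S ij by (simp add: X_mult)
  have "X b' j i * X f i i = X (\<lambda>t. b' t * f t) j i" using S ij by (simp add: X_mult)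
  also have "X b' j i + \<dots> + X b j i = X (\<lambda>t. b' t + b' t * f t + b t) j i"
    using S ij cont_vanishing_mult[OF cont_vanishingD[OF b'] f]
    by (simp add: X_add cont_vanishing_add)
  also have "\<dots> = X (\<lambda>t. 0) j i"
  proof (rule X_cong)
    fix t :: real assume "t \<in> {0..1}"
    from nz[OF this] have "b' t * (1 + f t) = - b t" by (simp add: b'_def)
    then show "b' t + b' t * f t + b t = 0" by (simp add: algebra_simps)
  qed
  finally have cancel1: "X b' j i + X b' j i * X f i i + X b j i = 0"
    by (simp add: X_zero)
  have "X b' j i * X a i j = X (\<lambda>t. b' t * a t) j j" using S ij by (simp add: X_mult)
  also have "\<dots> = X f' j j" by (rule X_cong) (simp add: b'_def f'_def ab)
  finally have e2: "X b' j i * X a i j = X f' j j" .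
  have 2: "(1 + X b' j i) * (1 + X f i i + X a i j + X b j i) = 1 + X f i i + X a i j + X f' j j"
    using cancel1 z e2 by (simp add: algebra_simps)
  have "X a i j + (X a' i j + X f i i * X a' i j) = X (\<lambda>t. a t + (a' t + f t * a' t)) i j"
    using S ij cont_vanishing_mult[OF cont_vanishingD[OF f] a']
    by (simp add: X_add X_mult cont_vanishing_add)
  also have "\<dots> = X (\<lambda>t. 0) i j"
  proof (rule X_cong)
    fix t :: real assume "t \<in> {0..1}"
    from nz[OF this] have "a' t * (1 + f t) = - a t" by (simp add: a'_def)
    then show "a t + (a' t + f t * a' t) = 0" by (simp add: algebra_simps)
  qed
  finally have cancel2: "X a i j + (X a' i j + X f i i * X a' i j) = 0" by (simp add: X_zero)
  have z2: "X a i j * X a' i j = 0" "X f' j j * X a' i j = 0" "X f i i * X f' j j = 0"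
    using S ij by (simp_all add: X_mult)
  have "(1 + X f i i + X a i j + X f' j j) * (1 + X a' i j) =
      1 + X f i i + X f' j j + (X a i j + (X a' i j + X f i i * X a' i j))"
    using z2 by (simp add: algebra_simps)
  also have "\<dots> = (1 + X f i i) * (1 + X f' j j)"
    unfolding cancel2 using z2 by (simp add: algebra_simps)
  finally have "(1 + X f i i) * (1 + X f' j j) =
      (1 + X b' j i) * ((1 + X a i j) * (1 + X b j i)) * (1 + X a' i j)"
    unfolding 1 2 ..
  also have "\<dots> \<in> near_products"
    using ij S by (intro mult_in_near_products one_plus_X_in_near_products) auto
  finally show ?thesis by (simp add: f'_def[abs_def])
qed

end

section \<open>The matrix algebra spanned by the units\<close>

context matrix_units
begin

text \<open>The unital homomorphism of M_m into M_N that carries the standard units to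
  \<open>e\<close>. For the systems attached to an end of the interval its image is the whole fibre
  there.\<close>

definition unit_comb :: "(nat \<Rightarrow> nat \<Rightarrow> complex) \<Rightarrow> nat \<Rightarrow> nat \<Rightarrow> complex" where
  "unit_comb A k l = (\<Sum>i<m. \<Sum>j<m. A i j * e i j k l)"

lemma unit_comb_cong: "(\<And>i j. i < m \<Longrightarrow> j < m \<Longrightarrow> A i j = B i j) \<Longrightarrow> unit_comb A = unit_comb B"
  by (auto simp: unit_comb_def fun_eq_iff intro!: sum.cong)

lemma unit_comb_add: "unit_comb (\<lambda>i j. A i j + B i j) k l = unit_comb A k l + unit_comb B k l"
  by (simp add: unit_comb_def distrib_right sum.distrib)

lemma unit_comb_scale: "unit_comb (\<lambda>i j. c * A i j) k l = c * unit_comb A k l"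
  by (simp add: unit_comb_def sum_distrib_left mult.assoc)

lemma unit_comb_single:
  assumes "i < m" "j < m"
  shows "unit_comb (\<lambda>a b. of_bool (a = i \<and> b = j)) k l = e i j k l"
proof -
  have "unit_comb (\<lambda>a b. of_bool (a = i \<and> b = j)) k l = (\<Sum>a<m. if a = i then (\<Sum>b<m. if b = j then e i j k l else 0) else 0)"
    unfolding unit_comb_def by (intro sum.cong refl) (auto intro!: sum.cong)
  then show ?thesis using assms by simp
qed

lemma unit_comb_one:
  assumes "k < N" "l < N"
  shows "unit_comb cmat_one k l = cmat_one k l"
proof -
  have "unit_comb cmat_one k l = (\<Sum>i<m. \<Sum>j<m. if j = i then e i i k l else 0)"
    unfolding unit_comb_def by (intro sum.cong refl) (auto simp: cmat_one_def)
  also have "\<dots> = cmat_one k l" using units_sum[OF assms] by simp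
  finally show ?thesis .
qed

lemma unit_comb_mult:
  assumes kl: "k < N" "l < N"
  shows "cmat_mult N (unit_comb A) (unit_comb B) k l = unit_comb (cmat_mult m A B) k l"
proof -
  have "cmat_mult N (unit_comb A) (unit_comb B) k l =
      (\<Sum>y<N. \<Sum>i<m. \<Sum>j<m. \<Sum>r<m. \<Sum>s<m. A i j * B r s * (e i j k y * e r s y l))"
    unfolding cmat_mult_def unit_comb_def
    by (simp only: sum_distrib_right, simp only: sum_distrib_left, simp only: mult_ac)
  also have "\<dots> = (\<Sum>i<m. \<Sum>j<m. \<Sum>r<m. \<Sum>s<m. \<Sum>y<N. A i j * B r s * (e i j k y * e r s y l))"
    by (rule trans[OF sum.swap], rule sum.cong[OF refl], rule trans[OF sum.swap], rule sum.cong[OF refl],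
        rule trans[OF sum.swap], rule sum.cong[OF refl], rule sum.swap)
  also have "\<dots> = (\<Sum>i<m. \<Sum>j<m. \<Sum>r<m. \<Sum>s<m. if r = j then A i j * B j s * e i s k l else 0)"
  proof (intro sum.cong refl)
    fix i j r s assume h: "i \<in> {..<m}" "j \<in> {..<m}" "r \<in> {..<m}" "s \<in> {..<m}"
    have "(\<Sum>y<N. A i j * B r s * (e i j k y * e r s y l)) = A i j * B r s * cmat_mult N (e i j) (e r s) k l"
      by (simp add: cmat_mult_def sum_distrib_left)
    then show "(\<Sum>y<N. A i j * B r s * (e i j k y * e r s y l)) = (if r = j then A i j * B j s * e i s k l else 0)"
      using units_mult[of i j r s k l] h kl by auto
  qed
  also have "\<dots> = (\<Sum>i<m. \<Sum>j<m. \<Sum>r<m. if r = j then (\<Sum>s<m. A i j * B j s * e i s k l) else 0)"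
    by (intro sum.cong refl) auto
  also have "\<dots> = (\<Sum>i<m. \<Sum>j<m. \<Sum>s<m. A i j * B j s * e i s k l)" by simp
  also have "\<dots> = (\<Sum>i<m. \<Sum>s<m. \<Sum>j<m. A i j * B j s * e i s k l)"
    by (intro sum.cong refl sum.swap)
  also have "\<dots> = unit_comb (cmat_mult m A B) k l"
    by (simp add: unit_comb_def cmat_mult_def sum_distrib_right)
  finally show ?thesis .
qed

lemma unit_comb_ok:
  assumes c: "\<And>i j. i < m \<Longrightarrow> j < m \<Longrightarrow> c i j \<in> S"
  shows "ok (\<lambda>t. unit_comb (\<lambda>i j. c i j t))"
    and "\<Phi> (\<lambda>t. unit_comb (\<lambda>i j. c i j t)) = (\<Sum>i<m. \<Sum>j<m. X (c i j) i j)"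
proof -
  have o: "ok (\<lambda>t k l. \<Sum>j<m. c i j t * e i j k l)" if "i < m" for i
    by (rule ok_sum) (use c units_ok that in auto)
  show "ok (\<lambda>t. unit_comb (\<lambda>i j. c i j t))"
    unfolding unit_comb_def[abs_def] by (rule ok_sum) (use o in auto)
  have "\<Phi> (\<lambda>t. unit_comb (\<lambda>i j. c i j t)) = (\<Sum>i<m. \<Phi> (\<lambda>t k l. \<Sum>j<m. c i j t * e i j k l))"
    unfolding unit_comb_def[abs_def] by (rule sum) (use o in auto)
  also have "\<dots> = (\<Sum>i<m. \<Sum>j<m. X (c i j) i j)"
    unfolding X_def by (intro sum.cong refl sum) (use c units_ok in auto)
  finally show "\<Phi> (\<lambda>t. unit_comb (\<lambda>i j. c i j t)) = (\<Sum>i<m. \<Sum>j<m. X (c i j) i j)" .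
qed

text \<open>Off-diagonal terms have trace 0, and each diagonal term contributes 1/m of the trace of
  a scalar function.\<close>

lemma unit_comb_trace_state:
  assumes \<tau>: "tracial_state \<tau>" and c: "\<And>i j. i < m \<Longrightarrow> j < m \<Longrightarrow> c i j \<in> S"
  shows "\<tau> (\<Phi> (\<lambda>t. unit_comb (\<lambda>i j. c i j t))) =
    \<tau> (\<Phi> (\<lambda>t k l. (\<Sum>i<m. c i i t) * cmat_one k l)) / of_nat m"
proof -
  have lin: "\<tau> (\<Sum>x\<in>I. f x) = (\<Sum>x\<in>I. \<tau> (f x))" for I :: "'i set" and f
    by (rule linear_sum[OF bounded_linear.linear[OF bounded_linear_tracial_state[OF \<tau>]]])
  have "(\<Sum>j<m. \<tau> (X (c i j) i j)) = \<tau> (X (c i i) i i)" if "i < m" for i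
  proof -
    have "(\<Sum>j<m. \<tau> (X (c i j) i j)) = (\<Sum>j<m. if j = i then \<tau> (X (c i i) i i) else 0)"
      by (intro sum.cong refl) (use X_trace_off_diagonal[OF \<tau>] c that in auto)
    then show ?thesis using that by simp
  qed
  moreover have "\<Phi> (\<lambda>t. unit_comb (\<lambda>i j. c i j t)) = (\<Sum>i<m. \<Sum>j<m. X (c i j) i j)"
    by (rule unit_comb_ok(2)) (rule c)
  ultimately have "of_nat m * \<tau> (\<Phi> (\<lambda>t. unit_comb (\<lambda>i j. c i j t))) = (\<Sum>i<m. of_nat m * \<tau> (X (c i i) i i))"
    by (simp add: lin sum_distrib_left)
  also have "\<dots> = (\<Sum>i<m. \<tau> (\<Phi> (\<lambda>t k l. c i i t * cmat_one k l)))"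
    by (intro sum.cong refl X_trace_diagonal[OF \<tau>]) (use c in auto)
  also have "\<dots> = \<tau> (\<Phi> (\<lambda>t k l. \<Sum>i<m. c i i t * cmat_one k l))"
    unfolding lin[symmetric] by (subst sum) (use ok_scalar c in auto)
  also have "\<dots> = \<tau> (\<Phi> (\<lambda>t k l. (\<Sum>i<m. c i i t) * cmat_one k l))"
    by (simp only: sum_distrib_right)
  finally show ?thesis using m by (simp add: eq_divide_eq mult.commute)
qed

lemma ok_unit_comb:
  assumes "s \<in> S"
  shows "ok (\<lambda>t k l. s t * unit_comb A k l)"
proof -
  have "(\<lambda>t. s t * A i j) \<in> S" for i j
    using assms by (auto simp: cont_vanishing_def intro!: continuous_intros)
  then have "ok (\<lambda>t. unit_comb (\<lambda>i j. s t * A i j))" by (rule unit_comb_ok(1)[of "\<lambda>i j t. s t * A i j"])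
  then show ?thesis by (simp add: unit_comb_scale[abs_def])
qed

end

section \<open>The four systems of matrix units of a dimension drop algebra\<close>

context drop_embedding
begin

text \<open>\<open>unitE\<close> spans all of M_N and takes coefficients vanishing at both ends.
  \<open>unitL\<close>, the units e_ij \<otimes> 1, respects the condition at 0 and takes
  coefficients vanishing at 1; \<open>unitR\<close>, the units 1 \<otimes> e_ij, is its mirror
  image. \<open>unitI\<close> is the unit alone and takes all continuous coefficients.\<close>

definition "unitE i j k l = (of_bool (k = i \<and> l = j) :: complex)"
definition "unitL i j k l = (of_bool (k div q = i \<and> l div q = j \<and> k mod q = l mod q) :: complex)"
definition "unitR i j k l = (of_bool (k mod q = i \<and> l mod q = j \<and> k div q = l div q) :: complex)"
definition "unitI (i::nat) (j::nat) = cmat_one"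

lemma mult_add_less: "r < p \<Longrightarrow> c < q \<Longrightarrow> r * q + c < N"
  using mult_le_mono1[of "Suc r" p q] by (simp add: N_def)

lemma sum_N: "(\<Sum>k<N. f (k div q) (k mod q)) = (\<Sum>r<p. \<Sum>c<q. f r c)" for f :: "nat \<Rightarrow> nat \<Rightarrow> complex"
  unfolding N_def by (rule sum_div_mod[OF q])

lemma matrix_units_E: "matrix_units p q N \<Phi> {0, 1} N unitE"
proof
  show "0 < N" by (rule N_pos)
next
  fix i j s assume "s \<in> cont_vanishing {0, 1}"
  then show "ok (\<lambda>t k l. s t * unitE i j k l)"
    by (intro drop_funI[where a = "\<lambda>_ _. 0" and b = "\<lambda>_ _. 0"])
       (auto simp: cont_vanishing_def intro!: continuous_intros)
next
  fix i j r l a b assume "j < N" "r < N"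
  have "cmat_mult N (unitE i j) (unitE r l) a b = (\<Sum>k<N. if k = j then of_bool (j = r) * unitE i l a b else 0)"
    unfolding cmat_mult_def by (intro sum.cong refl) (auto simp: unitE_def)
  then show "cmat_mult N (unitE i j) (unitE r l) a b = of_bool (j = r) * unitE i l a b"
    using \<open>j < N\<close> by simp
next
  fix a b assume "a < N" "b < N"
  have "(\<Sum>i<N. unitE i i a b) = (\<Sum>i<N. if i = a then cmat_one a b else 0)"
    by (intro sum.cong refl) (auto simp: unitE_def cmat_one_def)
  then show "(\<Sum>i<N. unitE i i a b) = cmat_one a b" using \<open>a < N\<close> by simp
qed (auto simp: unitE_def)

lemma matrix_units_L: "matrix_units p q N \<Phi> {1} p unitL"
proof
  show "0 < p" by (rule p)
next
  fix i j s assume "s \<in> cont_vanishing {1}"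
  then show "ok (\<lambda>t k l. s t * unitL i j k l)"
    by (intro drop_funI[where a = "\<lambda>k l. s 0 * of_bool (k = i \<and> l = j)" and b = "\<lambda>_ _. 0"])
       (auto simp: cont_vanishing_def unitL_def intro!: continuous_intros)
next
  fix i j r l a b assume h: "i < p" "j < p" "r < p" "l < p" "a < N" "b < N"
  have "cmat_mult N (unitL i j) (unitL r l) a b = (\<Sum>k<N. of_bool (a div q = i \<and> k div q = j \<and> a mod q = k mod q) *
      of_bool (k div q = r \<and> b div q = l \<and> k mod q = b mod q))"
    by (simp add: cmat_mult_def unitL_def)
  also have "\<dots> = (\<Sum>x<p. \<Sum>c<q. of_bool (a div q = i \<and> x = j \<and> a mod q = c) * of_bool (x = r \<and> b div q = l \<and> c = b mod q))"
    by (rule sum_N)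
  also have "\<dots> = (\<Sum>x<p. \<Sum>c<q. if c = a mod q then of_bool (j = r \<and> x = j) * unitL i l a b else 0)"
    by (intro sum.cong refl) (auto simp: unitL_def)
  also have "\<dots> = (\<Sum>x<p. if x = j then of_bool (j = r) * unitL i l a b else 0)"
    by (intro sum.cong refl) (use q in auto)
  also have "\<dots> = of_bool (j = r) * unitL i l a b" using h by simp
  finally show "cmat_mult N (unitL i j) (unitL r l) a b = of_bool (j = r) * unitL i l a b" .
next
  fix a b assume h: "a < N" "b < N"
  have "(\<Sum>i<p. unitL i i a b) = (\<Sum>i<p. if i = a div q then cmat_one a b else 0)"
    by (intro sum.cong refl) (use div_mod_eq_iff[of a b q] in \<open>auto simp: unitL_def cmat_one_def\<close>)
  then show "(\<Sum>i<p. unitL i i a b) = cmat_one a b" using div_less[OF h(1)] by simp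
next
  fix i assume "i < p"
  then show "\<exists>a<N. \<exists>b<N. unitL i i a b \<noteq> 0"
    using mult_add_less[of i 0] q by (intro exI[of _ "i * q"] conjI) (auto simp: unitL_def)
qed (auto simp: unitL_def)

lemma matrix_units_R: "matrix_units p q N \<Phi> {0} q unitR"
proof
  show "0 < q" by (rule q)
next
  fix i j s assume "s \<in> cont_vanishing {0}"
  then show "ok (\<lambda>t k l. s t * unitR i j k l)"
    by (intro drop_funI[where b = "\<lambda>k l. s 1 * of_bool (k = i \<and> l = j)" and a = "\<lambda>_ _. 0"])
       (auto simp: cont_vanishing_def unitR_def intro!: continuous_intros)
next
  fix i j r l a b assume h: "i < q" "j < q" "r < q" "l < q" "a < N" "b < N"
  have "cmat_mult N (unitR i j) (unitR r l) a b = (\<Sum>k<N. of_bool (a mod q = i \<and> k mod q = j \<and> a div q = k div q) *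
      of_bool (k mod q = r \<and> b mod q = l \<and> k div q = b div q))"
    by (simp add: cmat_mult_def unitR_def)
  also have "\<dots> = (\<Sum>x<p. \<Sum>c<q. of_bool (a mod q = i \<and> c = j \<and> a div q = x) * of_bool (c = r \<and> b mod q = l \<and> x = b div q))"
    by (rule sum_N)
  also have "\<dots> = (\<Sum>x<p. \<Sum>c<q. if c = j then of_bool (j = r \<and> x = a div q) * unitR i l a b else 0)"
    by (intro sum.cong refl) (auto simp: unitR_def)
  also have "\<dots> = (\<Sum>x<p. if x = a div q then of_bool (j = r) * unitR i l a b else 0)"
    by (intro sum.cong refl) (use h in auto)
  also have "\<dots> = of_bool (j = r) * unitR i l a b" using div_less h by simp
  finally show "cmat_mult N (unitR i j) (unitR r l) a b = of_bool (j = r) * unitR i l a b" .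
next
  fix a b assume h: "a < N" "b < N"
  have "(\<Sum>i<q. unitR i i a b) = (\<Sum>i<q. if i = a mod q then cmat_one a b else 0)"
    by (intro sum.cong refl) (use div_mod_eq_iff[of a b q] in \<open>auto simp: unitR_def cmat_one_def\<close>)
  then show "(\<Sum>i<q. unitR i i a b) = cmat_one a b" using q by simp
next
  fix i assume "i < q"
  then show "\<exists>a<N. \<exists>b<N. unitR i i a b \<noteq> 0"
    using mult_add_less[of 0 i] p by (intro exI[of _ i] conjI) (auto simp: unitR_def)
qed (auto simp: unitR_def)

lemma matrix_units_I: "matrix_units p q N \<Phi> {} 1 unitI"
proof
  fix i j s assume "s \<in> cont_vanishing {}"
  then show "ok (\<lambda>t k l. s t * unitI i j k l)"
    unfolding unitI_def by (intro ok_cmat_one_scaled cont_vanishingD)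
next
  fix i j r l a b assume "i < (1::nat)" "j < (1::nat)" "r < (1::nat)" "l < (1::nat)" "a < N" "b < N"
  then show "cmat_mult N (unitI i j) (unitI r l) a b = of_bool (j = r) * unitI i l a b"
    by (simp add: unitI_def cmat_mult_one)
next
  show "\<exists>a<N. \<exists>b<N. unitI i i a b \<noteq> 0" for i
    using N_pos by (intro exI[of _ 0]) (simp add: unitI_def cmat_one_def)
qed (auto simp: unitI_def cmat_one_def)

interpretation E: matrix_units p q N \<Phi> "{0, 1}" N unitE by (rule matrix_units_E)
interpretation L: matrix_units p q N \<Phi> "{1}" p unitL by (rule matrix_units_L)
interpretation R: matrix_units p q N \<Phi> "{0}" q unitR by (rule matrix_units_R)
interpretation I: matrix_units p q N \<Phi> "{}" 1 unitI by (rule matrix_units_I)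

lemma unit_comb_E: "k < N \<Longrightarrow> l < N \<Longrightarrow> E.unit_comb A k l = A k l"
proof -
  assume kl: "k < N" "l < N"
  have "E.unit_comb A k l = (\<Sum>i<N. if i = k then (\<Sum>j<N. if j = l then A k l else 0) else 0)"
    unfolding E.unit_comb_def by (intro sum.cong refl) (auto simp: unitE_def intro!: sum.cong)
  then show ?thesis using kl by simp
qed

lemma unit_comb_L: "k < N \<Longrightarrow> l < N \<Longrightarrow> L.unit_comb a k l = kron_left q a k l"
proof -
  assume kl: "k < N" "l < N"
  have "L.unit_comb a k l = (\<Sum>i<p. if i = k div q then (\<Sum>j<p. if j = l div q then kron_left q a k l else 0) else 0)"
    unfolding L.unit_comb_def by (intro sum.cong refl) (auto simp: unitL_def intro!: sum.cong)
  then show ?thesis using div_less kl by simp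
qed

lemma unit_comb_R: "k < N \<Longrightarrow> l < N \<Longrightarrow> R.unit_comb b k l = kron_right q b k l"
proof -
  assume kl: "k < N" "l < N"
  have "R.unit_comb b k l = (\<Sum>i<q. if i = k mod q then (\<Sum>j<q. if j = l mod q then kron_right q b k l else 0) else 0)"
    unfolding R.unit_comb_def by (intro sum.cong refl) (auto simp: unitR_def intro!: sum.cong)
  then show ?thesis using q by simp
qed

text \<open>The central copy of C[0,1], which meets both boundary conditions; traces in the whole
  algebra are reduced to traces on it.\<close>

definition "scalar s = \<Phi> (\<lambda>t i j. s t * cmat_one i j)"

lemma scalar_cong: "(\<And>t. t \<in> {0..1} \<Longrightarrow> s t = r t) \<Longrightarrow> scalar s = scalar r"
  unfolding scalar_def by (rule cong) simp

lemma scalar_add: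
  "continuous_on {0..1} s \<Longrightarrow> continuous_on {0..1} r \<Longrightarrow> scalar (\<lambda>t. s t + r t) = scalar s + scalar r"
  using add[OF ok_cmat_one_scaled ok_cmat_one_scaled, of s r] by (simp add: scalar_def distrib_right)

lemma scalar_scale: "continuous_on {0..1} s \<Longrightarrow> scalar (\<lambda>t. c * s t) = scaleC c (scalar s)"
  using scale[OF ok_cmat_one_scaled, of s c] by (simp add: scalar_def mult.assoc)

lemma scalar_const: "scalar (\<lambda>t. c) = scaleC c 1"
  using scalar_scale[of "\<lambda>t. 1" c] one by (simp add: scalar_def)

text \<open>The one-element system without vanishing condition makes \<open>norm_X_le\<close> a
  statement about scalar functions.\<close>

lemma norm_scalar_le:
  assumes "continuous_on {0..1} s" "0 < c" "\<And>t. t \<in> {0..1} \<Longrightarrow> cmod (s t) \<le> c"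
  shows "norm (scalar s) \<le> c"
proof -
  show ?thesis
    using I.norm_X_le[of 0 0 s c] assms by (simp add: I.X_def scalar_def unitI_def cont_vanishing_def)
qed

text \<open>Cut down by bumps in the corners \<open>(i, i)\<close> and \<open>(j, j)\<close> to isolate one entry.\<close>

lemma entry_le_norm:
  assumes F: "ok F" and ij: "i < N" "j < N" and t: "t \<in> {0..1}"
  shows "cmod (F t i j) \<le> norm (\<Phi> F)"
proof -
  have inner: "cmod (F t0 i j) \<le> norm (\<Phi> F)" if t0: "t0 \<in> {0<..<1}" for t0
  proof -
    \<comment> \<open>A bump that vanishes at both ends, is 1 at \<open>t0\<close>, and is at most 1
      throughout.\<close>
    define r where "r t = min 1 (t * (1 - t) / (t0 * (1 - t0)))" for t :: real
    let ?b = "\<lambda>t. complex_of_real (r t)"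
    have pos: "0 < t0 * (1 - t0)" using t0 by simp
    have b: "?b \<in> E.S"
      using pos by (auto simp: cont_vanishing_def r_def intro!: continuous_intros)
    have r1: "r t0 = 1" using t0 by (simp add: r_def)
    have rle: "cmod (?b t) \<le> 1" if "t \<in> {0..1}" for t
    proof -
      have "0 \<le> t * (1 - t) / (t0 * (1 - t0))" using that pos by (intro divide_nonneg_pos mult_nonneg_nonneg) auto
      then show ?thesis unfolding norm_of_real by (simp add: r_def)
    qed
    have n: "norm (E.X ?b k k) \<le> 1" if "k < N" for k
      by (rule E.norm_X_le[OF that that b]) (use rle in auto)
    let ?s = "\<lambda>t. F t i j * (?b t * ?b t)"
    have s: "?s \<in> E.S"
      by (intro cont_vanishing_mult b ok_continuous[OF F] ij cont_vanishingD[OF b])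
    have "E.X ?b i i * \<Phi> F * E.X ?b j j =
        \<Phi> (\<lambda>t. cmat_mult N (cmat_mult N (\<lambda>k l. ?b t * unitE i i k l) (F t)) (\<lambda>k l. ?b t * unitE j j k l))"
      unfolding E.X_def using E.units_ok[OF ij(1) ij(1) b] E.units_ok[OF ij(2) ij(2) b] F
      by (simp add: mult ok_mult)
    also have "\<dots> = E.X ?s i j"
      unfolding E.X_def
    proof (rule cong)
      fix t :: real and k l assume kl: "k < N" "l < N"
      have 1: "cmat_mult N (\<lambda>k l. ?b t * unitE i i k l) (F t) k x = of_bool (k = i) * ?b t * F t i x" for x
      proof -
        have "cmat_mult N (\<lambda>k l. ?b t * unitE i i k l) (F t) k x =
            (\<Sum>y<N. if y = i then of_bool (k = i) * ?b t * F t i x else 0)"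
          unfolding cmat_mult_def by (intro sum.cong refl) (auto simp: unitE_def)
        then show ?thesis using ij by simp
      qed
      have "cmat_mult N (cmat_mult N (\<lambda>k l. ?b t * unitE i i k l) (F t)) (\<lambda>k l. ?b t * unitE j j k l) k l =
          (\<Sum>y<N. if y = j then ?s t * unitE i j k l else 0)"
        unfolding cmat_mult_def[of N "cmat_mult _ _ _"] 1 by (intro sum.cong refl) (auto simp: unitE_def)
      then show "cmat_mult N (cmat_mult N (\<lambda>k l. ?b t * unitE i i k l) (F t)) (\<lambda>k l. ?b t * unitE j j k l) k l =
          ?s t * unitE i j k l"
        using ij by simp
    qed
    finally have eq: "E.X ?b i i * \<Phi> F * E.X ?b j j = E.X ?s i j" .
    have "cmod (F t0 i j) = cmod (?s t0)" by (simp add: r1)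
    also have "\<dots> \<le> norm (E.X ?s i j)"
      by (rule E.norm_X_ge[OF ij s]) (use t0 in auto)
    also have "\<dots> \<le> norm (E.X ?b i i * \<Phi> F) * norm (E.X ?b j j)"
      unfolding eq[symmetric] by (rule norm_mult_ineq)
    also have "\<dots> \<le> norm (\<Phi> F) * 1"
    proof (intro mult_mono n ij)
      have "norm (E.X ?b i i * \<Phi> F) \<le> norm (E.X ?b i i) * norm (\<Phi> F)" by (rule norm_mult_ineq)
      also have "\<dots> \<le> 1 * norm (\<Phi> F)" by (intro mult_right_mono n ij) auto
      finally show "norm (E.X ?b i i * \<Phi> F) \<le> norm (\<Phi> F)" by simp
    qed auto
    finally show ?thesis by simp
  qed
  \<comment> \<open>The bumps reach interior points only; the two ends follow by continuity of the
    entry.\<close>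
  have "closure {0<..<1::real} = {0..1}" by simp
  then have c: "continuous_on (closure {0<..<1::real}) (\<lambda>t. cmod (F t i j))"
    using ok_continuous[OF F ij] by (simp add: continuous_on_norm)
  show ?thesis
    by (rule continuous_le_on_closure[OF c]) (use t inner in auto)
qed

text \<open>Subtract from F the segment (1 - t) F(0) + t F(1). Its two summands are admissible
  combinations of \<open>unitL\<close> and \<open>unitR\<close>, the rest vanishes at both ends and
  is one of \<open>unitE\<close>, and on each kind of combination the trace is forced to be the
  normalised matrix trace of the respective size.\<close>

lemma trace_eq_scalar:
  assumes \<tau>: "tracial_state \<tau>" and F: "ok F"
  shows "\<tau> (\<Phi> F) = \<tau> (scalar (\<lambda>t. (\<Sum>i<N. F t i i) / of_nat N))"
proof -
  obtain a b where cF: "\<And>i j. i < p * q \<Longrightarrow> j < p * q \<Longrightarrow> continuous_on {0..1} (\<lambda>t. F t i j)"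
    and a: "\<And>i j. i < p * q \<Longrightarrow> j < p * q \<Longrightarrow> F 0 i j = kron_left q a i j"
    and b: "\<And>i j. i < p * q \<Longrightarrow> j < p * q \<Longrightarrow> F 1 i j = kron_right q b i j"
    by (rule drop_funE[OF F]) (rule that; assumption)
  define G where "G k l t = F t k l - (complex_of_real (1 - t) * F 0 k l + complex_of_real t * F 1 k l)" for k l t
  have G: "G k l \<in> E.S" if "k < N" "l < N" for k l
    using that by (auto simp: cont_vanishing_def G_def N_def intro!: continuous_intros cF)
  let ?cL = "\<lambda>i j t. complex_of_real (1 - t) * a i j" and ?cR = "\<lambda>i j t. complex_of_real t * b i j"
  have cL: "?cL i j \<in> L.S" for i j by (auto simp: cont_vanishing_def intro!: continuous_intros)
  have cR: "?cR i j \<in> R.S" for i j by (auto simp: cont_vanishing_def intro!: continuous_intros)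
  let ?FL = "\<lambda>t. L.unit_comb (\<lambda>i j. ?cL i j t)" and ?FR = "\<lambda>t. R.unit_comb (\<lambda>i j. ?cR i j t)"
    and ?FE = "\<lambda>t. E.unit_comb (\<lambda>i j. G i j t)"
  have FL: "?FL t k l = complex_of_real (1 - t) * F 0 k l" if "k < N" "l < N" for t k l
    using that by (simp add: unit_comb_L a N_def)
  have FR: "?FR t k l = complex_of_real t * F 1 k l" if "k < N" "l < N" for t k l
    using that by (simp add: unit_comb_R b N_def)
  have okL: "ok ?FL" by (rule L.unit_comb_ok(1)[of "?cL"]) (rule cL)
  have okR: "ok ?FR" by (rule R.unit_comb_ok(1)[of "?cR"]) (rule cR)
  have okE: "ok ?FE" by (rule E.unit_comb_ok(1)[of G]) (rule G)
  have "\<Phi> F = \<Phi> (\<lambda>t k l. (?FL t k l + ?FR t k l) + ?FE t k l)"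
  proof (rule cong)
    fix t :: real and k l assume kl: "k < N" "l < N"
    show "F t k l = (?FL t k l + ?FR t k l) + ?FE t k l"
      unfolding FL[OF kl] FR[OF kl] unit_comb_E[OF kl] by (simp add: G_def)
  qed
  also have "\<dots> = (\<Phi> ?FL + \<Phi> ?FR) + \<Phi> ?FE"
    by (simp only: add[OF drop_fun_add[OF okL okR] okE] add[OF okL okR])
  finally have "\<tau> (\<Phi> F) = (\<tau> (\<Phi> ?FL) + \<tau> (\<Phi> ?FR)) + \<tau> (\<Phi> ?FE)"
    by (simp only: tracial_stateD[OF \<tau>])
  also have "\<tau> (\<Phi> ?FL) = \<tau> (scalar (\<lambda>t. \<Sum>i<p. ?cL i i t)) / of_nat p"
    unfolding scalar_def by (rule L.unit_comb_trace_state[OF \<tau>, of "?cL"]) (rule cL)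
  also have "\<dots> = \<tau> (scalar (\<lambda>t. (1 / of_nat p) * (\<Sum>i<p. ?cL i i t)))"
    by (subst scalar_scale) (auto intro!: continuous_intros simp: tracial_stateD[OF \<tau>])
  also have "\<tau> (\<Phi> ?FR) = \<tau> (scalar (\<lambda>t. \<Sum>i<q. ?cR i i t)) / of_nat q"
    unfolding scalar_def by (rule R.unit_comb_trace_state[OF \<tau>, of "?cR"]) (rule cR)
  also have "\<dots> = \<tau> (scalar (\<lambda>t. (1 / of_nat q) * (\<Sum>i<q. ?cR i i t)))"
    by (subst scalar_scale) (auto intro!: continuous_intros simp: tracial_stateD[OF \<tau>])
  also have "\<tau> (\<Phi> ?FE) = \<tau> (scalar (\<lambda>t. \<Sum>i<N. G i i t)) / of_nat N"
    unfolding scalar_def by (rule E.unit_comb_trace_state[OF \<tau>, of "G"]) (rule G)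
  also have "\<dots> = \<tau> (scalar (\<lambda>t. (1 / of_nat N) * (\<Sum>i<N. G i i t)))"
    by (subst scalar_scale) (auto intro!: continuous_intros cont_vanishingD[OF G] simp: tracial_stateD[OF \<tau>])
  also have "\<tau> (scalar (\<lambda>t. (1 / of_nat p) * (\<Sum>i<p. ?cL i i t))) +
      \<tau> (scalar (\<lambda>t. (1 / of_nat q) * (\<Sum>i<q. ?cR i i t))) +
      \<tau> (scalar (\<lambda>t. (1 / of_nat N) * (\<Sum>i<N. G i i t))) =
      \<tau> (scalar (\<lambda>t. ((1 / of_nat p) * (\<Sum>i<p. ?cL i i t) + (1 / of_nat q) * (\<Sum>i<q. ?cR i i t)) +
        (1 / of_nat N) * (\<Sum>i<N. G i i t)))"
    by (subst scalar_add, (intro continuous_intros cont_vanishingD[OF G]; simp)+)+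
       (simp add: tracial_stateD[OF \<tau>])
  also have "\<dots> = \<tau> (scalar (\<lambda>t. (\<Sum>i<N. F t i i) / of_nat N))"
  proof (rule arg_cong[where f = \<tau>], rule scalar_cong)
    fix t :: real
    \<comment> \<open>The three normalisations agree because a \<otimes> 1 has q times the trace of
      a, and 1 \<otimes> b has p times the trace of b.\<close>
    have "(\<Sum>i<N. F 0 i i) = (\<Sum>i<N. a (i div q) (i div q))"
      by (intro sum.cong refl) (simp add: a N_def)
    also have "\<dots> = (\<Sum>r<p. \<Sum>c<q. a r r)" by (rule sum_N)
    finally have s0: "(\<Sum>i<N. F 0 i i) = of_nat q * (\<Sum>r<p. a r r)" by (simp add: sum_distrib_left)
    have "(\<Sum>i<N. F 1 i i) = (\<Sum>i<N. b (i mod q) (i mod q))"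
      by (intro sum.cong refl) (simp add: b N_def)
    also have "\<dots> = (\<Sum>r<p. \<Sum>c<q. b c c)" by (rule sum_N)
    finally have s1: "(\<Sum>i<N. F 1 i i) = of_nat p * (\<Sum>c<q. b c c)" by simp
    have sG: "(\<Sum>i<N. G i i t) = (\<Sum>i<N. F t i i) -
        (complex_of_real (1 - t) * (of_nat q * (\<Sum>r<p. a r r)) + complex_of_real t * (of_nat p * (\<Sum>c<q. b c c)))"
      unfolding s0[symmetric] s1[symmetric] G_def by (simp add: sum_subtractf sum.distrib sum_distrib_left)
    show "((1 / of_nat p) * (\<Sum>i<p. ?cL i i t) + (1 / of_nat q) * (\<Sum>i<q. ?cR i i t)) +
        (1 / of_nat N) * (\<Sum>i<N. G i i t) = (\<Sum>i<N. F t i i) / of_nat N"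
      unfolding sG sum_distrib_left[symmetric] using p q by (simp add: N_def field_simps)
  qed
  finally show ?thesis .
qed

end

section \<open>Determinant and logarithm\<close>

lemma sum_diag_mult_commute:
  assumes "A \<in> carrier_mat n n" "B \<in> carrier_mat n (n::nat)"
  shows "(\<Sum>i<n. (A * B) $$ (i, i)) = (\<Sum>i<n. (B * A) $$ (i, i) :: complex)"
proof -
  have "(\<Sum>i<n. (A * B) $$ (i, i)) = (\<Sum>i<n. \<Sum>k<n. A $$ (i, k) * B $$ (k, i))"
    using assms by (simp add: scalar_prod_def atLeast0LessThan)
  also have "\<dots> = (\<Sum>k<n. \<Sum>i<n. B $$ (k, i) * A $$ (i, k))"
    by (subst sum.swap) (simp add: mult.commute)
  also have "\<dots> = (\<Sum>i<n. (B * A) $$ (i, i))"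
    using assms by (simp add: scalar_prod_def atLeast0LessThan)
  finally show ?thesis .
qed

lemma upper_triangular_pow:
  fixes B :: "complex mat"
  assumes B: "B \<in> carrier_mat n n" "upper_triangular B"
  shows "upper_triangular (B ^\<^sub>m k) \<and> (\<forall>i<n. (B ^\<^sub>m k) $$ (i, i) = (B $$ (i, i)) ^ k)"
proof (induction k)
  case 0
  then show ?case using B by (auto simp: upper_triangular_def)
next
  case (Suc k)
  have P: "B ^\<^sub>m k \<in> carrier_mat n n" using B by simp
  have lowB: "B $$ (i, j) = 0" if "j < i" "i < n" for i j
    using B that by (auto simp: upper_triangular_def)
  have lowP: "(B ^\<^sub>m k) $$ (i, j) = 0" if "j < i" "i < n" for i j
    using Suc B that by (auto simp: upper_triangular_def)
  have eq: "(B ^\<^sub>m Suc k) $$ (i, j) = (\<Sum>l<n. (B ^\<^sub>m k) $$ (i, l) * B $$ (l, j))" if "i < n" "j < n" for i j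
    using that B P by (simp add: scalar_prod_def atLeast0LessThan)
  have "(B ^\<^sub>m Suc k) $$ (i, j) = 0" if "j < i" "i < n" for i j
  proof -
    have "(B ^\<^sub>m k) $$ (i, l) * B $$ (l, j) = 0" if "l < n" for l
      using lowP[of l i] lowB[of j l] \<open>j < i\<close> \<open>i < n\<close> that by (cases "l < i") auto
    then show ?thesis unfolding eq[OF that(2) less_trans[OF that]] by (intro sum.neutral) auto
  qed
  then have "upper_triangular (B ^\<^sub>m Suc k)" using B by (auto simp: upper_triangular_def)
  moreover have "(B ^\<^sub>m Suc k) $$ (i, i) = (B $$ (i, i)) ^ Suc k" if i: "i < n" for i
  proof -
    have "(B ^\<^sub>m k) $$ (i, l) * B $$ (l, i) = (if l = i then (B ^\<^sub>m k) $$ (i, i) * B $$ (i, i) else 0)" if "l < n" for l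
      using lowP[of l i] lowB[of i l] i that by (cases l i rule: linorder_cases) auto
    then have "(B ^\<^sub>m Suc k) $$ (i, i) = (\<Sum>l<n. if l = i then (B ^\<^sub>m k) $$ (i, i) * B $$ (i, i) else 0)"
      unfolding eq[OF i i] by (intro sum.cong refl) auto
    then show ?thesis using i Suc by (simp add: mult.commute)
  qed
  ultimately show ?case by blast
qed

text \<open>An eigenvector v yields |l|^k |v_i| \<le> r^k M for every k, which is impossible if r <
  |l|. The bound is asked of the entries of the powers, since entries are what the norm of the
  C*-algebra controls.\<close>

lemma eigenvalue_bound_of_power_bound:
  fixes A :: "complex mat"
  assumes A: "A \<in> carrier_mat n n" and r: "0 \<le> r"
    and bound: "\<And>k i j. i < n \<Longrightarrow> j < n \<Longrightarrow> cmod ((A ^\<^sub>m k) $$ (i, j)) \<le> r ^ k"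
    and ev: "eigenvector A v l"
  shows "cmod l \<le> r"
proof -
  have v: "v \<in> carrier_vec n" "v \<noteq> 0\<^sub>v n" using ev A by (auto simp: eigenvector_def)
  then obtain i where i: "i < n" "v $ i \<noteq> 0" by (metis eq_vecI carrier_vecD index_zero_vec)
  define M where "M = (\<Sum>j<n. cmod (v $ j))"
  have le: "cmod l ^ k * cmod (v $ i) \<le> r ^ k * M" for k
  proof -
    have "l ^ k * v $ i = (A ^\<^sub>m k *\<^sub>v v) $ i"
      using eigenvector_pow[OF A ev, of k] v i by simp
    also have "\<dots> = (\<Sum>j<n. (A ^\<^sub>m k) $$ (i, j) * v $ j)"
      using A v i by (simp add: scalar_prod_def atLeast0LessThan)
    finally have "cmod (l ^ k * v $ i) = cmod (\<Sum>j<n. (A ^\<^sub>m k) $$ (i, j) * v $ j)" by simp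
    then have "cmod l ^ k * cmod (v $ i) = cmod (\<Sum>j<n. (A ^\<^sub>m k) $$ (i, j) * v $ j)"
      by (simp only: norm_mult norm_power)
    also have "\<dots> \<le> (\<Sum>j<n. r ^ k * cmod (v $ j))"
      by (rule order_trans[OF norm_sum], rule sum_mono)
         (use i bound in \<open>auto simp: norm_mult intro!: mult_right_mono\<close>)
    finally show ?thesis by (simp add: M_def sum_distrib_left)
  qed
  show ?thesis
  proof (rule ccontr)
    assume "\<not> cmod l \<le> r"
    then have l: "r < cmod l" by simp
    then have l0: "0 < cmod l" using r by linarith
    have "(\<lambda>k. M * (r / cmod l) ^ k) \<longlonglongrightarrow> M * 0"
      using l l0 r by (intro tendsto_intros LIMSEQ_power_zero) simp
    moreover have "cmod (v $ i) \<le> M * (r / cmod l) ^ k" for k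
      using le[of k] l0 by (simp add: power_divide field_simps)
    ultimately have "cmod (v $ i) \<le> 0"
      by (intro LIMSEQ_le_const[where X = "\<lambda>k. M * (r / cmod l) ^ k"]) auto
    then show False using i by simp
  qed
qed

text \<open>After triangularisation the traces of powers are power sums of the eigenvalues. These
  have modulus at most r < 1, so the series is the sum of the principal logarithms of 1 +
  eigenvalue, and exponentiating gives their product.\<close>

lemma exp_log_series_trace_eq_det:
  fixes A :: "complex mat"
  assumes A: "A \<in> carrier_mat n n" and r: "0 \<le> r" "r < 1"
    and bound: "\<And>k i j. i < n \<Longrightarrow> j < n \<Longrightarrow> cmod ((A ^\<^sub>m k) $$ (i, j)) \<le> r ^ k"
  shows "exp (\<Sum>k. complex_of_real (log_coeff k) * (\<Sum>i<n. (A ^\<^sub>m Suc k) $$ (i, i))) = det (1\<^sub>m n + A)"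
proof -
  obtain es where es: "char_poly A = (\<Prod>a\<leftarrow>es. [:- a, 1:])" "length es = n"
    using char_poly_factorized[OF A] by blast
  obtain B P Q where BPQ: "schur_decomposition A es = (B, P, Q)" by (metis prod_cases3)
  have sim: "similar_mat_wit A B P Q" and ut: "upper_triangular B" and diag: "diag_mat B = es"
    using schur_decomposition[OF A es(1) BPQ] by auto
  have c: "B \<in> carrier_mat n n" "P \<in> carrier_mat n n" "Q \<in> carrier_mat n n"
    and PQ: "P * Q = 1\<^sub>m n" "Q * P = 1\<^sub>m n" and AB: "A = P * B * Q"
    using sim A unfolding similar_mat_wit_def Let_def by auto
  have es_nth: "es ! i = B $$ (i, i)" if "i < n" for i
    using diag that c by (auto simp: diag_mat_def)
  have ev: "cmod (es ! i) \<le> r" if "i < n" for i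
  proof -
    have "poly (char_poly A) (es ! i) = 0"
      unfolding es(1) using that es(2) by (auto simp: poly_prod_list prod_list_zero_iff image_iff intro!: bexI[of _ "es ! i"])
    then have "eigenvalue A (es ! i)" using eigenvalue_root_char_poly[OF A] by blast
    then show ?thesis unfolding eigenvalue_def using eigenvalue_bound_of_power_bound[OF A r(1) bound] by blast
  qed
  have trace: "(\<Sum>i<n. (A ^\<^sub>m k) $$ (i, i)) = (\<Sum>i<n. (es ! i) ^ k)" for k
  proof -
    have pB: "B ^\<^sub>m k \<in> carrier_mat n n" using c by simp
    have "A ^\<^sub>m k = P * (B ^\<^sub>m k) * Q" by (rule similar_mat_wit_pow_id[OF sim])
    moreover have "(\<Sum>i<n. (P * (B ^\<^sub>m k) * Q) $$ (i, i)) = (\<Sum>i<n. (Q * (P * (B ^\<^sub>m k))) $$ (i, i))"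
      by (rule sum_diag_mult_commute) (use c pB in auto)
    ultimately have "(\<Sum>i<n. (A ^\<^sub>m k) $$ (i, i)) = (\<Sum>i<n. (Q * (P * (B ^\<^sub>m k))) $$ (i, i))"
      by (simp only:)
    also have "Q * (P * (B ^\<^sub>m k)) = Q * P * (B ^\<^sub>m k)"
      by (rule assoc_mult_mat[symmetric]) (use c pB in auto)
    also have "\<dots> = B ^\<^sub>m k"
      unfolding PQ by (rule left_mult_one_mat[OF pB])
    also have "(\<Sum>i<n. (B ^\<^sub>m k) $$ (i, i)) = (\<Sum>i<n. (es ! i) ^ k)"
      using upper_triangular_pow[OF c(1) ut] es_nth by (intro sum.cong refl) auto
    finally show ?thesis .
  qed
  have sums: "(\<lambda>k. complex_of_real (log_coeff k) * z ^ Suc k) sums ln (1 + z)" if "cmod z < 1" for z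
  proof -
    have "(\<lambda>k. (-1) ^ Suc k / of_nat k * z ^ k) sums ln (1 + z)" by (rule Ln_series[OF that])
    then have "(\<lambda>k. (-1) ^ Suc (Suc k) / of_nat (Suc k) * z ^ Suc k) sums ln (1 + z)"
      by (subst sums_Suc_iff) simp
    then show ?thesis by (simp add: log_coeff_def)
  qed
  have "(\<lambda>k. \<Sum>i<n. complex_of_real (log_coeff k) * (es ! i) ^ Suc k) sums (\<Sum>i<n. ln (1 + es ! i))"
    by (rule sums_sum) (use sums ev r in force)
  then have "(\<Sum>k. complex_of_real (log_coeff k) * (\<Sum>i<n. (A ^\<^sub>m Suc k) $$ (i, i))) = (\<Sum>i<n. ln (1 + es ! i))"
    unfolding trace by (simp add: sums_iff sum_distrib_left)
  moreover have "exp (\<Sum>i<n. ln (1 + es ! i)) = (\<Prod>i<n. 1 + es ! i)"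
  proof -
    have "1 + es ! i \<noteq> 0" if "i < n" for i
      using ev[OF that] r norm_triangle_ineq2[of 1 "- (es ! i)"] by (auto simp: add_eq_0_iff)
    then show ?thesis by (simp add: exp_sum)
  qed
  moreover have "det (1\<^sub>m n + A) = (\<Prod>i<n. 1 + es ! i)"
  proof -
    have "1\<^sub>m n + A = P * (1\<^sub>m n + B) * Q"
    proof -
      have "P * (1\<^sub>m n + B) * Q = (P * 1\<^sub>m n + P * B) * Q"
        using c by (subst mult_add_distrib_mat[of _ n n]) auto
      also have "\<dots> = P * 1\<^sub>m n * Q + P * B * Q"
        using c by (intro add_mult_distrib_mat[of _ n n]) auto
      finally show ?thesis using c PQ AB by simp
    qed
    then have "det (1\<^sub>m n + A) = det P * det (1\<^sub>m n + B) * det Q"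
      using c by (simp add: det_mult[of _ n])
    also have "det P * det (1\<^sub>m n + B) * det Q = det (P * Q) * det (1\<^sub>m n + B)"
      using c by (simp add: det_mult[of _ n])
    also have "det (P * Q) = 1" using PQ by simp
    also have "det (1\<^sub>m n + B) = prod_list (diag_mat (1\<^sub>m n + B))"
      by (rule det_upper_triangular[of _ n]) (use c ut in \<open>auto simp: upper_triangular_def\<close>)
    also have "\<dots> = (\<Prod>i<n. 1 + es ! i)"
      using c es_nth by (simp add: prod_list_diag_prod atLeast0LessThan)
    finally show ?thesis by simp
  qed
  ultimately show ?thesis by simp
qed

section \<open>Gaussian elimination with continuous coefficients\<close>

text \<open>A polynomial curve is smooth, so its image in the plane is a null set and arbitrarily
  small z lie off it; shifting by such a z removes all zeros.\<close>

lemma nonvanishing_approximation: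
  fixes x :: "real \<Rightarrow> complex"
  assumes x: "continuous_on {0..1} x" and k: "0 < \<kappa>"
  obtains y where "continuous_on {0..1} y" "\<And>t. t \<in> {0..1} \<Longrightarrow> y t \<noteq> 0"
    "\<And>t. t \<in> {0..1} \<Longrightarrow> cmod (y t - x t) < \<kappa>"
proof -
  obtain g :: "real \<Rightarrow> complex" where g: "polynomial_function g" "\<And>t. t \<in> {0..1} \<Longrightarrow> norm (x t - g t) < \<kappa> / 2"
    using Stone_Weierstrass_polynomial_function[OF compact_Icc x, of "\<kappa> / 2"] k by auto
  have "negligible (g ` {0..1})"
    by (rule negligible_differentiable_image_lowdim) (auto intro: differentiable_on_polynomial_function g)
  moreover have "\<not> negligible (ball (0::complex) (\<kappa> / 2))"
    using k by (intro open_not_negligible) auto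
  ultimately obtain z where z: "z \<in> ball 0 (\<kappa> / 2)" "z \<notin> g ` {0..1}"
    using negligible_subset by blast
  show thesis
  proof
    show "continuous_on {0..1} (\<lambda>t. g t - z)"
      by (intro continuous_intros continuous_on_polymonial_function g)
    show "g t - z \<noteq> 0" if "t \<in> {0..1}" for t using z that by auto
    show "cmod (g t - z - x t) < \<kappa>" if "t \<in> {0..1}" for t
      using g(2)[OF that] z(1) norm_triangle_ineq4[of "g t - x t" z]
      by (simp add: norm_minus_commute algebra_simps)
  qed
qed

text \<open>
  This is the statement that functions on an interval have stable rank one: a unimodular row can
  be shortened. The sum of all \<open>\<bar>y i\<bar>\<^sup>2\<close> replaces the single second entry.
\<close>

lemma unimodular_row_shortening:
  fixes x :: "real \<Rightarrow> complex"
  assumes I: "finite I" and x: "continuous_on {0..1} x"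
    and y: "\<And>i. i \<in> I \<Longrightarrow> y i \<in> cont_vanishing Z"
    and nz: "\<And>t. t \<in> {0..1} \<Longrightarrow> x t = 0 \<Longrightarrow> \<exists>i\<in>I. y i t \<noteq> 0"
  obtains c where "\<And>i. i \<in> I \<Longrightarrow> c i \<in> cont_vanishing Z"
    "\<And>t. t \<in> {0..1} \<Longrightarrow> x t + (\<Sum>i\<in>I. c i t * y i t) \<noteq> 0"
proof -
  define w where "w t = (\<Sum>i\<in>I. (cmod (y i t))\<^sup>2)" for t
  have cw: "continuous_on {0..1} w"
    unfolding w_def using y by (intro continuous_intros cont_vanishingD) auto
  have w0: "0 \<le> w t" for t by (simp add: w_def sum_nonneg)
  have cs: "continuous_on {0..1} (\<lambda>t. cmod (x t) + w t)" by (intro continuous_intros x cw)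
  have pos: "0 < cmod (x t) + w t" if t: "t \<in> {0..1}" for t
  proof (cases "x t = 0")
    case True
    then obtain i where "i \<in> I" "y i t \<noteq> 0" using nz[OF t True] by blast
    then have "0 < w t" unfolding w_def using I by (intro sum_pos2[of I i]) auto
    then show ?thesis using norm_ge_zero[of "x t"] by linarith
  qed (use w0[of t] in \<open>simp add: add_pos_nonneg\<close>)
  obtain t1 where t1: "t1 \<in> {0..1}" "\<And>t. t \<in> {0..1} \<Longrightarrow> cmod (x t1) + w t1 \<le> cmod (x t) + w t"
    using continuous_attains_inf[OF compact_Icc _ cs] by auto
  \<comment> \<open>Half the minimum of |x| + w: wherever w < \<kappa>, the term |x| exceeds
    \<kappa>.\<close>
  define \<kappa> where "\<kappa> = (cmod (x t1) + w t1) / 2"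
  have \<kappa>: "0 < \<kappa>" using pos[OF t1(1)] by (simp add: \<kappa>_def)
  obtain v where v: "continuous_on {0..1} v" "\<And>t. t \<in> {0..1} \<Longrightarrow> v t \<noteq> 0"
    "\<And>t. t \<in> {0..1} \<Longrightarrow> cmod (v t - x t) < \<kappa>"
    using nonvanishing_approximation[OF x \<kappa>] by blast
  \<comment> \<open>Where w \<ge> \<kappa> this gives h w = 1 and the correction turns x into v;
    elsewhere 0 \<le> h w \<le> 1, so the correction stays below \<kappa> and cannot cancel
    x.\<close>
  define h where "h t = w t / max ((w t)\<^sup>2) (\<kappa>\<^sup>2)" for t
  have ch: "continuous_on {0..1} h"
    unfolding h_def using \<kappa> by (intro continuous_intros cw) (auto simp: max_def)
  define c where "c i t = (v t - x t) * complex_of_real (h t) * cnj (y i t)" for i t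
  show thesis
  proof
    fix i assume "i \<in> I"
    then have "(\<lambda>t. cnj (y i t)) \<in> cont_vanishing Z"
      using y by (auto simp: cont_vanishing_def intro!: continuous_intros)
    then show "c i \<in> cont_vanishing Z"
      unfolding c_def by (intro cont_vanishing_mult continuous_intros v x ch)
  next
    fix t :: real assume t: "t \<in> {0..1}"
    have "c i t * y i t = (v t - x t) * complex_of_real (h t) * complex_of_real ((cmod (y i t))\<^sup>2)" for i
      unfolding complex_norm_square c_def by (simp add: mult_ac)
    then have "(\<Sum>i\<in>I. c i t * y i t) = (v t - x t) * complex_of_real (h t * w t)"
      by (simp add: w_def sum_distrib_left mult.assoc)
    also have "h t * w t = (w t)\<^sup>2 / max ((w t)\<^sup>2) (\<kappa>\<^sup>2)"
      by (simp add: h_def power2_eq_square)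
    finally have eq: "(\<Sum>i\<in>I. c i t * y i t) = (v t - x t) * complex_of_real ((w t)\<^sup>2 / max ((w t)\<^sup>2) (\<kappa>\<^sup>2))" .
    show "x t + (\<Sum>i\<in>I. c i t * y i t) \<noteq> 0"
    proof (cases "\<kappa> \<le> w t")
      case True
      then have "\<kappa>\<^sup>2 \<le> (w t)\<^sup>2" "0 < (w t)\<^sup>2" using \<kappa> by (auto intro: power_mono)
      then have one: "(w t)\<^sup>2 / max ((w t)\<^sup>2) (\<kappa>\<^sup>2) = 1" by (simp add: max_def)
      have "x t + (\<Sum>i\<in>I. c i t * y i t) = v t" unfolding eq one by simp
      then show ?thesis using v(2)[OF t] by simp
    next
      case False
      define \<rho> where "\<rho> = (w t)\<^sup>2 / max ((w t)\<^sup>2) (\<kappa>\<^sup>2)"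
      have m: "0 < max ((w t)\<^sup>2) (\<kappa>\<^sup>2)" using \<kappa> by (simp add: less_max_iff_disj)
      have \<rho>: "0 \<le> \<rho>" "\<rho> \<le> 1"
        using m unfolding \<rho>_def by (auto intro!: divide_nonneg_pos simp: divide_le_eq_1)
      have "cmod (v t - x t) * \<rho> \<le> cmod (v t - x t) * 1" using \<rho> by (intro mult_left_mono) auto
      also have "\<dots> < \<kappa>" using v(3)[OF t] by simp
      also have "\<kappa> < cmod (x t)" using t1(2)[OF t] False by (simp add: \<kappa>_def)
      finally have "cmod ((v t - x t) * complex_of_real \<rho>) < cmod (x t)"
        using \<rho> by (simp add: norm_mult)
      then show ?thesis unfolding eq \<rho>_def[symmetric] by (metis add_eq_0_iff less_irrefl norm_minus_cancel)
    qed
  qed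
qed

text \<open>Pointwise invertibility in the form of a trivial kernel: it passes to products at once,
  and it excludes a zero column without any determinant.\<close>

definition injective_fun :: "nat \<Rightarrow> (real \<Rightarrow> nat \<Rightarrow> nat \<Rightarrow> complex) \<Rightarrow> bool" where
  "injective_fun n F \<longleftrightarrow> (\<forall>t\<in>{0..1}. \<forall>v. (\<forall>i<n. (\<Sum>j<n. F t i j * v j) = 0) \<longrightarrow> (\<forall>j<n. v j = 0))"

lemma injective_funD:
  "injective_fun n F \<Longrightarrow> t \<in> {0..1} \<Longrightarrow> (\<And>i. i < n \<Longrightarrow> (\<Sum>j<n. F t i j * v j) = 0) \<Longrightarrow> j < n \<Longrightarrow> v j = 0"
  unfolding injective_fun_def by blast

lemma sum_cmat_mult:
  "(\<Sum>j<n. cmat_mult n A B i j * v j) = (\<Sum>k<n. A i k * (\<Sum>j<n. B k j * v j))"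
proof -
  have "(\<Sum>j<n. cmat_mult n A B i j * v j) = (\<Sum>j<n. \<Sum>k<n. A i k * (B k j * v j))"
    by (simp add: cmat_mult_def sum_distrib_right mult.assoc)
  also have "\<dots> = (\<Sum>k<n. \<Sum>j<n. A i k * (B k j * v j))" by (rule sum.swap)
  finally show ?thesis by (simp add: sum_distrib_left)
qed

lemma injective_fun_mult:
  assumes "injective_fun n F" "injective_fun n G"
  shows "injective_fun n (\<lambda>t. cmat_mult n (F t) (G t))"
  unfolding injective_fun_def
proof (intro ballI allI impI)
  fix t v j assume t: "t \<in> {0..1::real}" and h: "\<forall>i<n. (\<Sum>j<n. cmat_mult n (F t) (G t) i j * v j) = 0" and j: "j < n"
  have "(\<Sum>j<n. G t k j * v j) = 0" if "k < n" for k
    by (rule injective_funD[OF assms(1) t _ that]) (use h in \<open>simp add: sum_cmat_mult\<close>)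
  then show "v j = 0" using injective_funD[OF assms(2) t _ j] by blast
qed

definition one_plus :: "(real \<Rightarrow> nat \<Rightarrow> nat \<Rightarrow> complex) \<Rightarrow> real \<Rightarrow> nat \<Rightarrow> nat \<Rightarrow> complex" where
  "one_plus M t i j = cmat_one i j + M t i j"

lemma cmat_mult_one_plus:
  assumes "i < n"
  shows "cmat_mult n (one_plus M t) B i j = B i j + cmat_mult n (M t) B i j"
    and "j < n \<Longrightarrow> cmat_mult n B (one_plus M t) i j = B i j + cmat_mult n B (M t) i j"
proof -
  have "cmat_mult n (one_plus M t) B i j = cmat_mult n cmat_one B i j + cmat_mult n (M t) B i j"
    by (simp add: cmat_mult_def one_plus_def distrib_right sum.distrib)
  then show "cmat_mult n (one_plus M t) B i j = B i j + cmat_mult n (M t) B i j"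
    by (simp add: cmat_mult_one assms)
  assume "j < n"
  have "cmat_mult n B (one_plus M t) i j = cmat_mult n B cmat_one i j + cmat_mult n B (M t) i j"
    by (simp add: cmat_mult_def one_plus_def distrib_left sum.distrib)
  then show "cmat_mult n B (one_plus M t) i j = B i j + cmat_mult n B (M t) i j"
    using \<open>j < n\<close> by (simp add: cmat_mult_one assms)
qed

text \<open>The square-zero perturbations \<open>M\<close> for which \<open>1 + M\<close> serves as an elementary operation.\<close>

definition nilpotent_fun :: "real set \<Rightarrow> nat \<Rightarrow> (real \<Rightarrow> nat \<Rightarrow> nat \<Rightarrow> complex) \<Rightarrow> bool" where
  "nilpotent_fun Z n M \<longleftrightarrow> (\<forall>i<n. \<forall>j<n. (\<lambda>t. M t i j) \<in> cont_vanishing Z) \<and>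
     (\<forall>t\<in>{0..1}. \<forall>i<n. \<forall>j<n. cmat_mult n (M t) (M t) i j = 0)"

text \<open>With Z = {0, 1} these are loops based at the identity; with Z empty they are all
  continuous invertible functions, among them the constant matrices.\<close>

definition invertible_fun :: "real set \<Rightarrow> nat \<Rightarrow> (real \<Rightarrow> nat \<Rightarrow> nat \<Rightarrow> complex) \<Rightarrow> bool" where
  "invertible_fun Z n F \<longleftrightarrow>
     (\<forall>i<n. \<forall>j<n. (\<lambda>t. F t i j - cmat_one i j) \<in> cont_vanishing Z) \<and> injective_fun n F"

lemma invertible_fun_continuous:
  assumes "invertible_fun Z n F" "i < n" "j < n"
  shows "continuous_on {0..1} (\<lambda>t. F t i j)"
proof -
  have "continuous_on {0..1} (\<lambda>t. (F t i j - cmat_one i j) + cmat_one i j)"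
    using assms by (intro continuous_intros cont_vanishingD[where Z = Z]) (simp add: invertible_fun_def)
  then show ?thesis by simp
qed

lemma cont_vanishing_sum:
  "finite I \<Longrightarrow> (\<And>x. x \<in> I \<Longrightarrow> f x \<in> cont_vanishing Z) \<Longrightarrow> (\<lambda>t. \<Sum>x\<in>I. f x t) \<in> cont_vanishing Z"
  by (induction I rule: finite_induct) (auto intro: cont_vanishing_add cont_vanishing_zero)

text \<open>If v = -Mv, then Mv = -M^2 v = 0, hence v = 0.\<close>

lemma injective_one_plus:
  assumes "nilpotent_fun Z n M"
  shows "injective_fun n (one_plus M)"
  unfolding injective_fun_def
proof (intro ballI allI impI)
  fix t v j assume t: "t \<in> {0..1::real}" and h: "\<forall>i<n. (\<Sum>j<n. one_plus M t i j * v j) = 0" and j: "j < n"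
  have 1: "v i + (\<Sum>j<n. M t i j * v j) = 0" if "i < n" for i
  proof -
    have "(\<Sum>j<n. one_plus M t i j * v j) = (\<Sum>j<n. cmat_one i j * v j) + (\<Sum>j<n. M t i j * v j)"
      by (simp add: one_plus_def distrib_right sum.distrib)
    also have "(\<Sum>j<n. cmat_one i j * v j) = (\<Sum>j<n. if j = i then v i else 0)"
      by (intro sum.cong refl) (auto simp: cmat_one_def)
    finally show ?thesis using h that by simp
  qed
  have v: "v i = - (\<Sum>j<n. M t i j * v j)" if "i < n" for i
    using 1[OF that] by (simp add: eq_neg_iff_add_eq_0)
  have "(\<Sum>k<n. M t i k * v k) = 0" if i: "i < n" for i
  proof -
    have "(\<Sum>k<n. M t i k * v k) = (\<Sum>k<n. - (M t i k * (\<Sum>j<n. M t k j * v j)))"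
    proof (intro sum.cong refl)
      fix k assume "k \<in> {..<n}"
      then show "M t i k * v k = - (M t i k * (\<Sum>j<n. M t k j * v j))" by (subst v) auto
    qed
    also have "\<dots> = - (\<Sum>k<n. M t i k * (\<Sum>j<n. M t k j * v j))" by (rule sum_negf)
    also have "\<dots> = - (\<Sum>j<n. cmat_mult n (M t) (M t) i j * v j)" by (simp only: sum_cmat_mult)
    also have "\<dots> = 0" using assms t i by (simp add: nilpotent_fun_def)
    finally show ?thesis .
  qed
  then show "v j = 0" using v[OF j] j by simp
qed

lemma invertible_one_plus_mult:
  assumes M: "nilpotent_fun Z n M" and F: "invertible_fun Z n F"
  shows "invertible_fun Z n (\<lambda>t. cmat_mult n (one_plus M t) (F t))"
    and "invertible_fun Z n (\<lambda>t. cmat_mult n (F t) (one_plus M t))"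
proof -
  have S: "(\<lambda>t. M t i j) \<in> cont_vanishing Z" if "i < n" "j < n" for i j
    using M that by (simp add: nilpotent_fun_def)
  have T: "(\<lambda>t. F t i j - cmat_one i j) \<in> cont_vanishing Z" if "i < n" "j < n" for i j
    using F that by (simp add: invertible_fun_def)
  note c = invertible_fun_continuous[OF F]
  have inj: "injective_fun n F" using F by (simp add: invertible_fun_def)
  have "(\<lambda>t. cmat_mult n (one_plus M t) (F t) i j - cmat_one i j) \<in> cont_vanishing Z" if ij: "i < n" "j < n" for i j
  proof -
    have "(\<lambda>t. (F t i j - cmat_one i j) + (\<Sum>k<n. F t k j * M t i k)) \<in> cont_vanishing Z"
      by (intro cont_vanishing_add T ij cont_vanishing_sum cont_vanishing_mult c S) auto
    then show ?thesis
      unfolding cmat_mult_one_plus(1)[OF ij(1)] by (simp add: cmat_mult_def algebra_simps)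
  qed
  then show "invertible_fun Z n (\<lambda>t. cmat_mult n (one_plus M t) (F t))"
    unfolding invertible_fun_def using injective_fun_mult[OF injective_one_plus[OF M] inj] by blast
  have "(\<lambda>t. cmat_mult n (F t) (one_plus M t) i j - cmat_one i j) \<in> cont_vanishing Z" if ij: "i < n" "j < n" for i j
  proof -
    have "(\<lambda>t. (F t i j - cmat_one i j) + (\<Sum>k<n. F t i k * M t k j)) \<in> cont_vanishing Z"
      by (intro cont_vanishing_add T ij cont_vanishing_sum cont_vanishing_mult c S) auto
    then show ?thesis
      unfolding cmat_mult_one_plus(2)[OF ij] by (simp add: cmat_mult_def algebra_simps)
  qed
  then show "invertible_fun Z n (\<lambda>t. cmat_mult n (F t) (one_plus M t))"
    unfolding invertible_fun_def using injective_fun_mult[OF inj injective_one_plus[OF M]] by blast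
qed

text \<open>The goal W is left abstract because elimination is run twice: on loops, where W says
  that the element is a product of elements near 1, and on constant matrices at an end, where W says
  that the matrix extends to such a product.\<close>

locale elimination =
  fixes Z :: "real set" and n :: nat and W :: "(real \<Rightarrow> nat \<Rightarrow> nat \<Rightarrow> complex) \<Rightarrow> bool"
  assumes cancel_left: "invertible_fun Z n F \<Longrightarrow> nilpotent_fun Z n M \<Longrightarrow>
      W (\<lambda>t. cmat_mult n (one_plus M t) (F t)) \<Longrightarrow> W F"
    and cancel_right: "invertible_fun Z n F \<Longrightarrow> nilpotent_fun Z n M \<Longrightarrow>
      W (\<lambda>t. cmat_mult n (F t) (one_plus M t)) \<Longrightarrow> W F"
    and diagonal: "invertible_fun Z n F \<Longrightarrow>
      (\<And>t i j. t \<in> {0..1} \<Longrightarrow> i < n \<Longrightarrow> j < n \<Longrightarrow> i \<noteq> j \<Longrightarrow> F t i j = 0) \<Longrightarrow> W F"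
begin

definition reduced :: "nat \<Rightarrow> (real \<Rightarrow> nat \<Rightarrow> nat \<Rightarrow> complex) \<Rightarrow> bool" where
  "reduced k F \<longleftrightarrow> (\<forall>t\<in>{0..1}. \<forall>i<n. \<forall>j<n. i \<noteq> j \<longrightarrow> i < k \<or> j < k \<longrightarrow> F t i j = 0)"

lemma reducedD: "reduced k F \<Longrightarrow> t \<in> {0..1} \<Longrightarrow> i < n \<Longrightarrow> j < n \<Longrightarrow> i \<noteq> j \<Longrightarrow> i < k \<or> j < k \<Longrightarrow> F t i j = 0"
  unfolding reduced_def by blast

lemma row_nilpotent:
  assumes "k < n" "\<And>i. i \<in> {k<..<n} \<Longrightarrow> c i \<in> cont_vanishing Z"
  shows "nilpotent_fun Z n (\<lambda>t i j. of_bool (i = k \<and> k < j) * c j t)"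
  unfolding nilpotent_fun_def
proof (intro conjI allI impI ballI)
  show "(\<lambda>t. of_bool (i = k \<and> k < j) * c j t) \<in> cont_vanishing Z" if "i < n" "j < n" for i j
    using that assms(2)[of j] by (cases "i = k \<and> k < j") (auto simp: cont_vanishing_zero)
qed (auto simp: cmat_mult_def intro!: sum.neutral)

lemma column_nilpotent:
  assumes "k < n" "\<And>i. i \<in> {k<..<n} \<Longrightarrow> c i \<in> cont_vanishing Z"
  shows "nilpotent_fun Z n (\<lambda>t i j. of_bool (j = k \<and> k < i) * c i t)"
  unfolding nilpotent_fun_def
proof (intro conjI allI impI ballI)
  show "(\<lambda>t. of_bool (j = k \<and> k < i) * c i t) \<in> cont_vanishing Z" if "i < n" "j < n" for i j
    using that assms(2)[of i] by (cases "j = k \<and> k < i") (auto simp: cont_vanishing_zero)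
qed (auto simp: cmat_mult_def intro!: sum.neutral)

lemma offdiagonal_vanishing:
  assumes "invertible_fun Z n F" "i < n" "j < n" "i \<noteq> j"
  shows "(\<lambda>t. F t i j) \<in> cont_vanishing Z"
proof -
  have "(\<lambda>t. F t i j - cmat_one i j) \<in> cont_vanishing Z" using assms by (simp add: invertible_fun_def)
  then show ?thesis using assms(4) by (simp add: cmat_one_def)
qed

lemma quotient_vanishing:
  assumes F: "invertible_fun Z n F" and ij: "i < n" "j < n" "i \<noteq> j" "k < n"
    and nz: "\<And>t. t \<in> {0..1} \<Longrightarrow> F t k k \<noteq> 0"
  shows "(\<lambda>t. - (F t i j / F t k k)) \<in> cont_vanishing Z"
proof -
  have "(\<lambda>t. - (1 / F t k k) * F t i j) \<in> cont_vanishing Z"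
    using nz by (intro cont_vanishing_mult offdiagonal_vanishing[OF F] continuous_intros
        invertible_fun_continuous[OF F] ij) auto
  then show ?thesis by simp
qed

text \<open>One round makes the k-th pivot nonvanishing on the whole interval and then clears row
  and column k by division. The induction runs downwards from k = n, where the matrix is
  diagonal.\<close>

lemma reduced_imp_W: "k \<le> n \<Longrightarrow> invertible_fun Z n F \<Longrightarrow> reduced k F \<Longrightarrow> W F"
proof (induction k arbitrary: F rule: inc_induct)
  case base
  then show ?case by (intro diagonal) (auto intro: reducedD)
next
  case (step k)
  note F = step.prems(1) and red = step.prems(2) and kn = step.hyps(2)
  have inj: "injective_fun n F" using F by (simp add: invertible_fun_def)
  \<comment> \<open>The entries above the pivot vanish already, so if the pivot and everything below
    it vanished too, the k-th basis vector would lie in the kernel.\<close>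
  have col: "\<exists>i\<in>{k<..<n}. F t i k \<noteq> 0" if t: "t \<in> {0..1}" and 0: "F t k k = 0" for t
  proof (rule ccontr)
    assume "\<not> ?thesis"
    then have z: "F t i k = 0" if "i < n" for i
      using that 0 reducedD[OF red t that kn] by (cases i k rule: linorder_cases) auto
    have "(\<Sum>j<n. F t i j * of_bool (j = k)) = 0" if "i < n" for i
      by (rule sum.neutral) (use z that in auto)
    then have "(of_bool (k = k) :: complex) = 0"
      using injective_funD[OF inj t _ kn, of "\<lambda>j. of_bool (j = k)"] by blast
    then show False by simp
  qed
  obtain c where c: "\<And>i. i \<in> {k<..<n} \<Longrightarrow> c i \<in> cont_vanishing Z"
    "\<And>t. t \<in> {0..1} \<Longrightarrow> F t k k + (\<Sum>i\<in>{k<..<n}. c i t * F t i k) \<noteq> 0"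
    by (rule unimodular_row_shortening[of "{k<..<n}" "\<lambda>t. F t k k" "\<lambda>i t. F t i k" Z])
       (use col kn in \<open>auto intro!: invertible_fun_continuous[OF F] offdiagonal_vanishing[OF F]\<close>)
  \<comment> \<open>Adds the multiples c_i of the lower rows to row k, so that the pivot becomes the
    nowhere vanishing expression just obtained.\<close>
  define M1 where "M1 t i j = of_bool (i = k \<and> k < j) * c j t" for t i j
  have M1: "nilpotent_fun Z n M1"
    unfolding M1_def[abs_def] by (rule row_nilpotent[OF kn c(1)])
  define F1 where "F1 t = cmat_mult n (one_plus M1 t) (F t)" for t
  have F1: "invertible_fun Z n F1"
    unfolding F1_def[abs_def] by (rule invertible_one_plus_mult(1)[OF M1 F])
  have F1_k: "F1 t k j = F t k j + (\<Sum>i\<in>{k<..<n}. c i t * F t i j)" if "j < n" for t j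
  proof -
    have "cmat_mult n (M1 t) (F t) k j = (\<Sum>i\<in>{k<..<n}. c i t * F t i j)"
      unfolding cmat_mult_def by (rule sum.mono_neutral_cong_right) (auto simp: M1_def)
    then show ?thesis by (simp add: F1_def cmat_mult_one_plus(1)[OF kn])
  qed
  have F1_i: "F1 t i j = F t i j" if "i < n" "i \<noteq> k" for t i j
    unfolding F1_def cmat_mult_one_plus(1)[OF that(1)] using that(2) by (simp add: cmat_mult_def M1_def)
  have red1: "reduced k F1"
    unfolding reduced_def
  proof (intro ballI allI impI)
    fix t i j assume t: "t \<in> {0..1::real}" and ij: "i < n" "j < n" "i \<noteq> j" "i < k \<or> j < k"
    show "F1 t i j = 0"
    proof (cases "i = k")
      case True
      then have "j < k" using ij by auto
      then have "F t i j = 0 \<and> (\<Sum>i\<in>{k<..<n}. c i t * F t i j) = 0"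
        using reducedD[OF red t] ij by (auto intro!: sum.neutral)
      then show ?thesis using F1_k[OF ij(2), of t] True by simp
    next
      case False
      then show ?thesis using F1_i[OF ij(1)] reducedD[OF red t ij] by simp
    qed
  qed
  have nz1: "F1 t k k \<noteq> 0" if "t \<in> {0..1}" for t
    using c(2)[OF that] F1_k[OF kn] by simp
  \<comment> \<open>Clears column k below the pivot by multiplication from the left;
    \<open>M3\<close> clears row k from the right.\<close>
  define M2 where "M2 t i j = of_bool (j = k \<and> k < i) * (- (F1 t i k / F1 t k k))" for t i j
  have M2: "nilpotent_fun Z n M2"
    unfolding M2_def[abs_def]
    by (rule column_nilpotent[where c = "\<lambda>i t. - (F1 t i k / F1 t k k)", OF kn], rule quotient_vanishing[OF F1])
       (use kn nz1 in auto)
  define F2 where "F2 t = cmat_mult n (one_plus M2 t) (F1 t)" for t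
  have F2: "invertible_fun Z n F2"
    unfolding F2_def[abs_def] by (rule invertible_one_plus_mult(1)[OF M2 F1])
  have F2_ij: "F2 t i j = F1 t i j - of_bool (k < i) * (F1 t i k / F1 t k k) * F1 t k j" if "i < n" for t i j
  proof -
    have "cmat_mult n (M2 t) (F1 t) i j = (\<Sum>l<n. if l = k then - (of_bool (k < i) * (F1 t i k / F1 t k k)) * F1 t k j else 0)"
      unfolding cmat_mult_def by (intro sum.cong refl) (auto simp: M2_def)
    then show ?thesis using that kn by (simp add: F2_def cmat_mult_one_plus(1))
  qed
  have red2: "reduced k F2"
    unfolding reduced_def
  proof (intro ballI allI impI)
    fix t i j assume t: "t \<in> {0..1::real}" and ij: "i < n" "j < n" "i \<noteq> j" "i < k \<or> j < k"
    have "of_bool (k < i) * F1 t k j = 0"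
      using ij reducedD[OF red1 t kn ij(2)] by (cases "k < i") auto
    then show "F2 t i j = 0"
      using F2_ij[OF ij(1), of t j] reducedD[OF red1 t ij] by auto
  qed
  have col2: "F2 t i k = 0" if "t \<in> {0..1}" "i < n" "i \<noteq> k" for t i
    using F2_ij[OF that(2), of t k] nz1[OF that(1)] reducedD[OF red1 that(1,2) kn] that(3)
    by (cases "k < i") auto
  have nz2: "F2 t k k \<noteq> 0" if "t \<in> {0..1}" for t
    using F2_ij[OF kn, of t k] nz1[OF that] by simp
  define M3 where "M3 t i j = of_bool (i = k \<and> k < j) * (- (F2 t k j / F2 t k k))" for t i j
  have M3: "nilpotent_fun Z n M3"
    unfolding M3_def[abs_def]
    by (rule row_nilpotent[where c = "\<lambda>i t. - (F2 t k i / F2 t k k)", OF kn], rule quotient_vanishing[OF F2])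
       (use kn nz2 in auto)
  define F3 where "F3 t = cmat_mult n (F2 t) (one_plus M3 t)" for t
  have F3: "invertible_fun Z n F3"
    unfolding F3_def[abs_def] by (rule invertible_one_plus_mult(2)[OF M3 F2])
  have F3_ij: "F3 t i j = F2 t i j - F2 t i k * (of_bool (k < j) * (F2 t k j / F2 t k k))" if "i < n" "j < n" for t i j
  proof -
    have "cmat_mult n (F2 t) (M3 t) i j = (\<Sum>l<n. if l = k then - (F2 t i k * (of_bool (k < j) * (F2 t k j / F2 t k k))) else 0)"
      unfolding cmat_mult_def by (intro sum.cong refl) (auto simp: M3_def)
    then show ?thesis using that kn by (simp add: F3_def cmat_mult_one_plus(2))
  qed
  have "reduced (Suc k) F3"
    unfolding reduced_def
  proof (intro ballI allI impI)
    fix t i j assume t: "t \<in> {0..1::real}" and ij: "i < n" "j < n" "i \<noteq> j" "i < Suc k \<or> j < Suc k"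
    show "F3 t i j = 0"
    proof (cases "i = k")
      case True
      then show ?thesis
        using F3_ij[OF ij(1,2), of t] nz2[OF t] reducedD[OF red2 t ij(1-3)] ij(3) by (cases "k < j") auto
    next
      case False
      then have "F2 t i j = 0"
        using reducedD[OF red2 t ij(1-3)] col2[OF t ij(1)] ij(4) by (cases "j = k") auto
      then show ?thesis using F3_ij[OF ij(1,2), of t] col2[OF t ij(1) False] by simp
    qed
  qed
  then have "W F3" by (rule step.IH[OF F3])
  then have "W F2" unfolding F3_def[abs_def] by (rule cancel_right[OF F2 M3])
  then have "W F1" unfolding F2_def[abs_def] by (rule cancel_left[OF F1 M2])
  then show "W F" unfolding F1_def[abs_def] by (rule cancel_left[OF F M1])
qed

lemma invertible_imp_W: "invertible_fun Z n F \<Longrightarrow> W F"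
  by (rule reduced_imp_W[of 0]) (auto simp: reduced_def)

end

section \<open>Invertible elements of prime dimension drop algebras are products of elements near the unit\<close>

definition diag_upto :: "nat \<Rightarrow> (nat \<Rightarrow> complex) \<Rightarrow> nat \<Rightarrow> nat \<Rightarrow> complex" where
  "diag_upto k d i j = of_bool (i = j) * (if i < k then d i else 1)"

definition diag_single :: "nat \<Rightarrow> complex \<Rightarrow> nat \<Rightarrow> nat \<Rightarrow> complex" where
  "diag_single k c i j = cmat_one i j + (c - 1) * of_bool (i = k \<and> j = k)"

lemma diag_upto_0: "diag_upto 0 d = cmat_one"
  by (simp add: diag_upto_def cmat_one_def fun_eq_iff)

lemma diag_upto_Suc:
  assumes "k < n" "i < n" "j < n"
  shows "cmat_mult n (diag_upto k d) (diag_single k (d k)) i j = diag_upto (Suc k) d i j"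
proof -
  have "cmat_mult n (diag_upto k d) (diag_single k (d k)) i j =
      (\<Sum>l<n. if l = i then (if i < k then d i else 1) * diag_single k (d k) i j else 0)"
    unfolding cmat_mult_def by (intro sum.cong refl) (auto simp: diag_upto_def)
  also have "\<dots> = diag_upto (Suc k) d i j"
    using assms(2) by (auto simp: diag_upto_def diag_single_def cmat_one_def less_Suc_eq)
  finally show ?thesis .
qed

lemma cmat_inverse:
  assumes inj: "\<And>v. (\<And>i. i < n \<Longrightarrow> (\<Sum>j<n. a i j * v j) = 0) \<Longrightarrow> \<forall>j<n. v j = (0::complex)"
  obtains A where "\<And>i j. i < n \<Longrightarrow> j < n \<Longrightarrow> cmat_mult n A a i j = cmat_one i j"
    "\<And>i j. i < n \<Longrightarrow> j < n \<Longrightarrow> cmat_mult n a A i j = cmat_one i j"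
proof -
  let ?M = "mat n n (\<lambda>(i, j). a i j)"
  have M: "?M \<in> carrier_mat n n" by simp
  have "det ?M \<noteq> 0"
  proof
    assume "det ?M = 0"
    then obtain v where v: "v \<in> carrier_vec n" "v \<noteq> 0\<^sub>v n" "?M *\<^sub>v v = 0\<^sub>v n"
      using det_0_iff_vec_prod_zero[OF M] by blast
    have "(\<Sum>j<n. a i j * v $ j) = 0" if "i < n" for i
    proof -
      have "(?M *\<^sub>v v) $ i = 0" using v(3) that by simp
      then show ?thesis using that v(1) by (simp add: scalar_prod_def atLeast0LessThan)
    qed
    then have "\<forall>j<n. v $ j = 0" by (rule inj)
    then have "v = 0\<^sub>v n" using v(1) by (intro eq_vecI) auto
    then show False using v(2) by simp
  qed
  then have "?M \<in> Units (ring_mat TYPE(complex) n ())" by (rule det_non_zero_imp_unit[OF M])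
  then obtain B where B: "B \<in> carrier_mat n n" "B * ?M = 1\<^sub>m n" "?M * B = 1\<^sub>m n"
    unfolding Units_def ring_mat_def by auto
  show thesis
  proof
    fix i j assume ij: "i < n" "j < n"
    have "(B * ?M) $$ (i, j) = 1\<^sub>m n $$ (i, j)" by (simp only: B(2))
    then show "cmat_mult n (\<lambda>i j. B $$ (i, j)) a i j = cmat_one i j"
      using ij B(1) by (simp add: cmat_mult_def cmat_one_def scalar_prod_def atLeast0LessThan)
    have "(?M * B) $$ (i, j) = 1\<^sub>m n $$ (i, j)" by (simp only: B(3))
    then show "cmat_mult n a (\<lambda>i j. B $$ (i, j)) i j = cmat_one i j"
      using ij B(1) by (simp add: cmat_mult_def cmat_one_def scalar_prod_def atLeast0LessThan)
  qed
qed

lemma sum_cmat_one: "i < n \<Longrightarrow> (\<Sum>j<n. cmat_one i j * v j) = v i"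
proof -
  assume "i < n"
  have "(\<Sum>j<n. cmat_one i j * v j) = (\<Sum>j<n. if j = i then v i else 0)"
    by (intro sum.cong refl) (auto simp: cmat_one_def)
  then show ?thesis using \<open>i < n\<close> by simp
qed

lemma injective_fun_of_left_inverse:
  assumes "\<And>t i j. t \<in> {0..1} \<Longrightarrow> i < n \<Longrightarrow> j < n \<Longrightarrow> cmat_mult n (G t) (F t) i j = cmat_one i j"
  shows "injective_fun n F"
  unfolding injective_fun_def
proof (intro ballI allI impI)
  fix t v j assume t: "t \<in> {0..1::real}" and h: "\<forall>i<n. (\<Sum>j<n. F t i j * v j) = 0" and j: "j < n"
  have "v j = (\<Sum>l<n. cmat_mult n (G t) (F t) j l * v l)"
    using assms[OF t j] sum_cmat_one[OF j, of v] by simp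
  also have "\<dots> = 0" using h by (simp add: sum_cmat_mult)
  finally show "v j = 0" .
qed

context drop_embedding
begin

lemma Phi_one_plus: "ok M \<Longrightarrow> \<Phi> (one_plus M) = 1 + \<Phi> M"
  using add[OF ok_one, of M] by (simp add: one one_plus_def[abs_def])

lemma ok_one_plus: "ok M \<Longrightarrow> ok (one_plus M)"
  using drop_fun_add[OF ok_one, of M] by (simp add: one_plus_def[abs_def])

lemma nilpotent_in_near_products:
  assumes M: "ok M" and nil: "\<And>t i j. t \<in> {0..1} \<Longrightarrow> i < N \<Longrightarrow> j < N \<Longrightarrow> cmat_mult N (M t) (M t) i j = 0"
  shows "\<Phi> (one_plus M) \<in> near_products"
proof -
  have "\<Phi> M * \<Phi> M = \<Phi> (\<lambda>t. cmat_mult N (M t) (M t))" by (rule mult[OF M M, symmetric])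
  also have "\<dots> = \<Phi> (\<lambda>t i j. 0)" by (rule cong) (rule nil)
  finally have "\<Phi> M * \<Phi> M = 0" by (simp add: zero)
  then show ?thesis unfolding Phi_one_plus[OF M] by (rule one_plus_nilpotent_in_near_products)
qed

end

subsection \<open>Loops\<close>

context drop_embedding
begin

interpretation E: matrix_units p q N \<Phi> "{0, 1}" N unitE by (rule matrix_units_E)
interpretation L: matrix_units p q N \<Phi> "{1}" p unitL by (rule matrix_units_L)
interpretation R: matrix_units p q N \<Phi> "{0}" q unitR by (rule matrix_units_R)

definition wind :: "int \<Rightarrow> real \<Rightarrow> complex" where
  "wind k t = exp (2 * of_real pi * \<i> * of_int k * of_real t)"

lemma wind_add: "wind (k + l) t = wind k t * wind l t"
  by (simp add: wind_def exp_add[symmetric] algebra_simps)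

lemma wind_int: "wind k 0 = 1" "wind k 1 = 1"
  by (auto simp: wind_def exp_eq_1 intro!: exI[of _ k])

lemma wind_vanishing: "(\<lambda>t. wind k t - 1) \<in> E.S"
  using wind_int[of k] by (auto simp: cont_vanishing_def wind_def[abs_def] intro!: continuous_intros)

lemma wind_nonzero: "wind k t \<noteq> 0" by (simp add: wind_def)

definition "loop k i = 1 + E.X (\<lambda>t. wind k t - 1) i i"

lemma loop_add: "i < N \<Longrightarrow> loop k i * loop l i = loop (k + l) i"
proof -
  assume i: "i < N"
  have "loop k i * loop l i = 1 + E.X (\<lambda>t. (wind k t - 1) + (wind l t - 1) + (wind k t - 1) * (wind l t - 1)) i i"
    unfolding loop_def by (rule E.X_circle_mult[OF i wind_vanishing wind_vanishing])
  also have "(\<lambda>t. (wind k t - 1) + (wind l t - 1) + (wind k t - 1) * (wind l t - 1)) = (\<lambda>t. wind (k + l) t - 1)"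
    by (simp add: fun_eq_iff wind_add algebra_simps)
  finally show ?thesis by (simp add: loop_def)
qed

lemma loop_0: "loop 0 i = 1"
  by (simp add: loop_def wind_def E.X_zero)

lemma loop_commute: "i < N \<Longrightarrow> j < N \<Longrightarrow> loop k i * loop l j = loop l j * loop k i"
proof (cases "i = j")
  case True
  assume "i < N" then show ?thesis using True by (simp add: loop_add add.commute)
next
  case False
  assume "i < N" "j < N"
  then have "E.X (\<lambda>t. wind k t - 1) i i * E.X (\<lambda>t. wind l t - 1) j j = 0"
    "E.X (\<lambda>t. wind l t - 1) j j * E.X (\<lambda>t. wind k t - 1) i i = 0"
    using False by (auto simp: E.X_mult wind_vanishing)
  then show ?thesis by (simp add: loop_def algebra_simps)
qed

text \<open>Whitehead's factorisation with 1 + f = e^(2\<pi>it): up to products of elements near 1,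
  winding number moves freely from one corner to another.\<close>

lemma loop_shift: "i < N \<Longrightarrow> j < N \<Longrightarrow> loop 1 i * loop (-1) j \<in> near_products"
proof (cases "i = j")
  case True
  assume "i < N" then show ?thesis using True by (simp add: loop_add loop_0 one_in_near_products)
next
  case False
  assume ij: "i < N" "j < N"
  have "(\<lambda>t. - (wind 1 t - 1) / (1 + (wind 1 t - 1))) = (\<lambda>t. wind (-1) t - 1)"
  proof
    fix t
    have "wind (-1) t * wind 1 t = 1" unfolding wind_add[symmetric] by (simp add: wind_def)
    then show "- (wind 1 t - 1) / (1 + (wind 1 t - 1)) = wind (-1) t - 1"
      using wind_nonzero[of 1 t] by (simp add: field_simps)
  qed
  then show ?thesis
    using E.whitehead_in_near_products[OF ij False wind_vanishing[of 1]] wind_nonzero by (simp add: loop_def)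
qed

text \<open>Each corner of A contributes winding number one, and all of it is shifted into the
  corner \<open>i0\<close>.\<close>

lemma loop_sum_factor:
  assumes "finite A" "A \<subseteq> {..<N}" "i0 < N"
  shows "\<exists>u\<in>near_products. 1 + (\<Sum>i\<in>A. E.X (\<lambda>t. wind 1 t - 1) i i) = u * loop 1 i0 ^ card A"
  using assms(1,2)
proof (induction A rule: finite_induct)
  case empty
  then show ?case by (intro bexI[of _ 1]) (auto intro: one_in_near_products)
next
  case (insert i A)
  then obtain u where u: "u \<in> near_products"
    "1 + (\<Sum>i\<in>A. E.X (\<lambda>t. wind 1 t - 1) i i) = u * loop 1 i0 ^ card A" by auto
  have i: "i < N" using insert by auto
  have orth: "(\<Sum>j\<in>A. E.X (\<lambda>t. wind 1 t - 1) j j) * E.X (\<lambda>t. wind 1 t - 1) i i = 0"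
    unfolding sum_distrib_right
    by (rule sum.neutral) (use insert in \<open>auto simp: E.X_mult wind_vanishing\<close>)
  have "1 + (\<Sum>j\<in>insert i A. E.X (\<lambda>t. wind 1 t - 1) j j) =
      (1 + (\<Sum>j\<in>A. E.X (\<lambda>t. wind 1 t - 1) j j)) * loop 1 i"
    using insert orth by (simp add: loop_def algebra_simps)
  also have "\<dots> = u * (loop 1 i0 ^ card A * loop 1 i)" by (simp add: u mult.assoc)
  also have "loop 1 i0 ^ card A * loop 1 i = loop 1 i * loop 1 i0 ^ card A"
    by (rule power_commuting_commutes) (rule loop_commute[OF i assms(3), symmetric])
  also have "loop 1 i = loop 1 i * loop (-1) i0 * loop 1 i0"
    using loop_add[OF assms(3), of "-1" 1] by (simp add: mult.assoc loop_0)
  finally have "1 + (\<Sum>j\<in>insert i A. E.X (\<lambda>t. wind 1 t - 1) j j) =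
      (u * (loop 1 i * loop (-1) i0)) * loop 1 i0 ^ card (insert i A)"
    using insert by (simp add: mult.assoc)
  then show ?case
    using mult_in_near_products[OF u(1) loop_shift[OF i assms(3)]] by blast
qed

lemma loop_power_in_near_products:
  assumes A: "A \<subseteq> {..<N}" and i: "i < N"
    and P: "1 + (\<Sum>i\<in>A. E.X (\<lambda>t. wind 1 t - 1) i i) \<in> near_products"
  shows "loop 1 i ^ card A \<in> near_products"
  using loop_sum_factor[OF finite_subset[OF A finite_lessThan] A i] P near_products_cancel_left by metis

lemma sum_unitE: "(\<Sum>x\<in>A. s * unitE x x k l) = s * of_bool (k = l \<and> k \<in> A)" if "finite A"
proof -
  have "(\<Sum>x\<in>A. s * unitE x x k l) = (\<Sum>x\<in>A. if x = k then s * of_bool (k = l) else 0)"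
    by (intro sum.cong refl) (auto simp: unitE_def)
  then show ?thesis using that by simp
qed

text \<open>
  The loop of winding number 1 in one corner: its \<open>q\<close>-th and \<open>p\<close>-th powers are killed by
  contracting the copies of \<open>e\<^sub>0\<^sub>0 \<otimes> 1\<close> and \<open>1 \<otimes> e\<^sub>0\<^sub>0\<close> through the two ends.
\<close>

lemma loop_1_in_near_products:
  assumes i: "i < N"
  shows "loop 1 i \<in> near_products"
proof -
  have sumX: "(\<Sum>x\<in>A. E.X (\<lambda>t. wind 1 t - 1) x x) = \<Phi> (\<lambda>t k l. (wind 1 t - 1) * of_bool (k = l \<and> k \<in> A))"
    if "A \<subseteq> {..<N}" for A
  proof -
    have f: "finite A" using that finite_subset by blast
    have "(\<Sum>x\<in>A. E.X (\<lambda>t. wind 1 t - 1) x x) = \<Phi> (\<lambda>t k l. \<Sum>x\<in>A. (wind 1 t - 1) * unitE x x k l)"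
      unfolding E.X_def
      by (rule sum[symmetric, OF f]) (use that in \<open>auto intro!: E.units_ok wind_vanishing\<close>)
    then show ?thesis by (simp add: sum_unitE[OF f])
  qed
  have "loop 1 i ^ q \<in> near_products"
  proof -
    \<comment> \<open>Using t - 1 makes the exponent vanish at t = 1, as \<open>unitL\<close>
      requires, without changing its exponential.\<close>
    let ?g = "\<lambda>t. 2 * of_real pi * \<i> * of_real (t - 1)"
    have g: "?g \<in> L.S" by (auto simp: cont_vanishing_def intro!: continuous_intros)
    have e: "exp (?g t) = wind 1 t" for t
    proof -
      have "?g t = 2 * of_real pi * \<i> * of_int 1 * of_real t + (- (2 * of_real pi * \<i>))" by (simp add: algebra_simps)
      then show ?thesis by (simp add: wind_def exp_diff)
    qed
    have "1 + L.X (\<lambda>t. exp (?g t) - 1) 0 0 \<in> near_products"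
      by (rule L.exp_X_in_near_products[OF p g])
    \<comment> \<open>The corner e_00 \<otimes> 1 occupies the q indices below q, whence the q-th
      power.\<close>
    moreover have "L.X (\<lambda>t. exp (?g t) - 1) 0 0 = (\<Sum>x\<in>{..<q}. E.X (\<lambda>t. wind 1 t - 1) x x)"
    proof (subst sumX)
      show "{..<q} \<subseteq> {..<N}" using p by (auto simp: N_def intro: less_le_trans)
      show "L.X (\<lambda>t. exp (?g t) - 1) 0 0 = \<Phi> (\<lambda>t k l. (wind 1 t - 1) * of_bool (k = l \<and> k \<in> {..<q}))"
        unfolding L.X_def
      proof (rule cong)
        fix t :: real and k l
        have "unitL 0 0 k l = of_bool (k = l \<and> k \<in> {..<q})"
          using q by (auto simp: unitL_def div_eq_0_iff)
        then show "(exp (?g t) - 1) * unitL 0 0 k l = (wind 1 t - 1) * of_bool (k = l \<and> k \<in> {..<q})"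
          by (simp only: e)
      qed
    qed
    ultimately show ?thesis
      using loop_power_in_near_products[of "{..<q}" i] p i by (auto simp: N_def intro: less_le_trans)
  qed
  moreover have "loop 1 i ^ p \<in> near_products"
  proof -
    let ?g = "\<lambda>t. 2 * of_real pi * \<i> * of_real t"
    \<comment> \<open>The diagonal indices of 1 \<otimes> e_00, namely the p multiples of q below
      N.\<close>
    let ?A = "(\<lambda>r. r * q) ` {..<p}"
    have A: "?A \<subseteq> {..<N}" using q by (auto simp: N_def)
    have cA: "card ?A = p" using q by (simp add: card_image inj_on_def)
    have g: "?g \<in> R.S" by (auto simp: cont_vanishing_def intro!: continuous_intros)
    have "1 + R.X (\<lambda>t. exp (?g t) - 1) 0 0 \<in> near_products"
      by (rule R.exp_X_in_near_products[OF q g])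
    moreover have "R.X (\<lambda>t. exp (?g t) - 1) 0 0 = (\<Sum>x\<in>?A. E.X (\<lambda>t. wind 1 t - 1) x x)"
      unfolding sumX[OF A] R.X_def
    proof (rule cong)
      fix t :: real and k l assume kl: "k < N" "l < N"
      have "k \<in> ?A \<longleftrightarrow> k mod q = 0"
        using div_less[OF kl(1)] by (auto simp: image_iff intro!: bexI[of _ "k div q"])
      then have "unitR 0 0 k l = of_bool (k = l \<and> k \<in> ?A)"
        using div_mod_eq_iff[of k l q] by (auto simp: unitR_def)
      then show "(exp (?g t) - 1) * unitR 0 0 k l = (wind 1 t - 1) * of_bool (k = l \<and> k \<in> ?A)"
        by (simp add: wind_def)
    qed
    ultimately show ?thesis
      using loop_power_in_near_products[OF A i] by (simp only: cA)
  qed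
  \<comment> \<open>By Bezout the loop is a quotient of powers of its p-th and q-th powers.\<close>
  moreover obtain x y where xy: "p * x = q * y + 1"
    using bezout_nat[of p q] p coprime_pq by auto
  ultimately have "(loop 1 i ^ p) ^ x \<in> near_products" "(loop 1 i ^ q) ^ y \<in> near_products"
    by (auto intro: power_in_near_products)
  moreover have "(loop 1 i ^ p) ^ x = (loop 1 i ^ q) ^ y * loop 1 i"
    unfolding power_mult[symmetric] xy by (simp add: power_commutes)
  ultimately show ?thesis using near_products_cancel_left by metis
qed

lemma loop_in_near_products:
  assumes i: "i < N"
  shows "loop k i \<in> near_products"
proof -
  have nat: "loop (int n) i \<in> near_products" for n
  proof (induction n)
    case (Suc n)
    have "loop (int (Suc n)) i = loop 1 i * loop (int n) i" by (simp add: loop_add[OF i])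
    then show ?case using mult_in_near_products[OF loop_1_in_near_products[OF i] Suc] by simp
  qed (simp add: loop_0 one_in_near_products)
  show ?thesis
  proof (cases "0 \<le> k")
    case True
    then show ?thesis using nat[of "nat k"] by simp
  next
    case False
    have "loop (int (nat (- k))) i * loop k i = 1"
      unfolding loop_add[OF i] using False by (simp add: loop_0)
    then show ?thesis using near_products_cancel_left[OF nat[of "nat (- k)"]] one_in_near_products by metis
  qed
qed

text \<open>Choose a continuous logarithm l of 1 + f. As 1 + f is 1 at both ends, l(1) - l(0) =
  2\<pi>ik; removing l(0) and the linear function 2\<pi>ikt leaves an exponent vanishing at both
  ends, and the factor split off is the loop of winding number k.\<close>

lemma diagonal_loop_in_near_products:
  assumes i: "i < N" and f: "f \<in> E.S" and nz: "\<And>t. t \<in> {0..1} \<Longrightarrow> 1 + f t \<noteq> 0"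
  shows "1 + E.X f i i \<in> near_products"
proof -
  have "continuous_on {0..1} (\<lambda>t. 1 + f t)" by (intro continuous_intros cont_vanishingD[OF f])
  moreover have "contractible {0..1::real}" by (simp add: convex_imp_contractible)
  ultimately obtain l where l: "continuous_on {0..1} l" "\<And>t. t \<in> {0..1} \<Longrightarrow> 1 + f t = exp (l t)"
    using continuous_logarithm_on_contractible[of "{0..1}" "\<lambda>t. 1 + f t"] nz by blast
  have "exp (l 1 - l 0) = 1"
    using l(2)[of 0] l(2)[of 1] f by (simp add: cont_vanishing_def exp_diff)
  then obtain k :: int where k: "Re (l 1 - l 0) = 0" "Im (l 1 - l 0) = of_int (2 * k) * pi"
    unfolding exp_eq_1 by blast
  then have l1: "l 1 - l 0 = 2 * of_real pi * \<i> * of_int k" by (simp add: complex_eq_iff)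
  have el0: "exp (l 0) = 1" using l(2)[of 0] f by (simp add: cont_vanishing_def)
  define g where "g t = l t - l 0 - 2 * of_real pi * \<i> * of_int k * of_real t" for t
  have g: "g \<in> E.S"
    using l(1) l1 by (auto simp: cont_vanishing_def g_def[abs_def] intro!: continuous_intros)
  have eg: "(\<lambda>t. exp (g t) - 1) \<in> E.S" using E.exp_minus_one_in_S[OF g, of 1] by simp
  have "(1 + E.X (\<lambda>t. exp (g t) - 1) i i) * loop k i =
      1 + E.X (\<lambda>t. (exp (g t) - 1) + (wind k t - 1) + (exp (g t) - 1) * (wind k t - 1)) i i"
    unfolding loop_def by (rule E.X_circle_mult[OF i eg wind_vanishing])
  also have "E.X (\<lambda>t. (exp (g t) - 1) + (wind k t - 1) + (exp (g t) - 1) * (wind k t - 1)) i i = E.X f i i"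
  proof (rule E.X_cong)
    fix t :: real assume t: "t \<in> {0..1}"
    have "exp (g t) * wind k t = exp (g t + 2 * of_real pi * \<i> * of_int k * of_real t)"
      by (simp add: wind_def exp_add)
    also have "\<dots> = exp (l t)" using el0 by (simp add: g_def exp_diff)
    also have "\<dots> = 1 + f t" using l(2)[OF t] by simp
    finally show "(exp (g t) - 1) + (wind k t - 1) + (exp (g t) - 1) * (wind k t - 1) = f t"
      by (simp add: algebra_simps)
  qed
  finally show ?thesis
    using mult_in_near_products[OF E.exp_X_in_near_products[OF i g] loop_in_near_products[OF i, of k]] by simp
qed

lemma ok_of_vanishing:
  assumes "\<And>i j. i < N \<Longrightarrow> j < N \<Longrightarrow> (\<lambda>t. M t i j) \<in> E.S"
  shows "ok M"
  by (rule drop_funI[where a = "\<lambda>_ _. 0" and b = "\<lambda>_ _. 0"])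
     (use assms in \<open>auto simp: cont_vanishing_def N_def\<close>)

lemma ok_of_invertible_fun:
  assumes "invertible_fun {0, 1} N F"
  shows "ok F"
proof -
  have "ok (\<lambda>t i j. F t i j - cmat_one i j)"
    by (rule ok_of_vanishing) (use assms in \<open>simp add: invertible_fun_def\<close>)
  from drop_fun_add[OF this ok_one] show ?thesis by simp
qed

lemma diag_single_loop:
  assumes "k < N" "f \<in> E.S"
  shows "ok (\<lambda>t. diag_single k (1 + f t))" "\<Phi> (\<lambda>t. diag_single k (1 + f t)) = 1 + E.X f k k"
proof -
  have eq: "(\<lambda>t. diag_single k (1 + f t)) = one_plus (\<lambda>t i j. f t * unitE k k i j)"
    by (auto simp: fun_eq_iff diag_single_def one_plus_def unitE_def)
  note o = E.units_ok[OF assms(1,1,2)]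
  show "ok (\<lambda>t. diag_single k (1 + f t))" unfolding eq by (rule ok_one_plus[OF o])
  show "\<Phi> (\<lambda>t. diag_single k (1 + f t)) = 1 + E.X f k k"
    unfolding eq E.X_def by (rule Phi_one_plus[OF o])
qed

text \<open>Square-zero perturbations are handled by \<open>nilpotent_in_near_products\<close>, and
  a diagonal function is peeled off into loops living in a single corner each.\<close>

lemma loop_elimination: "elimination {0, 1} N (\<lambda>F. \<Phi> F \<in> near_products)"
proof
  fix F M assume F: "invertible_fun {0, 1} N F" and M: "nilpotent_fun {0, 1} N M"
  have okM: "ok M" by (rule ok_of_vanishing) (use M in \<open>simp add: nilpotent_fun_def\<close>)
  note okF = ok_of_invertible_fun[OF F] and ok1 = ok_one_plus[OF okM]
  have P: "\<Phi> (one_plus M) \<in> near_products"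
    by (rule nilpotent_in_near_products[OF okM]) (use M in \<open>simp add: nilpotent_fun_def\<close>)
  show "\<Phi> F \<in> near_products" if "\<Phi> (\<lambda>t. cmat_mult N (one_plus M t) (F t)) \<in> near_products"
    using that near_products_cancel_left[OF P] by (simp add: mult[OF ok1 okF])
  show "\<Phi> F \<in> near_products" if "\<Phi> (\<lambda>t. cmat_mult N (F t) (one_plus M t)) \<in> near_products"
    using that near_products_cancel_right[OF P] by (simp add: mult[OF okF ok1])
next
  fix F assume F: "invertible_fun {0, 1} N F"
    and d: "\<And>t i j. t \<in> {0..1} \<Longrightarrow> i < N \<Longrightarrow> j < N \<Longrightarrow> i \<noteq> j \<Longrightarrow> F t i j = 0"
  let ?d = "\<lambda>t i. F t i i"
  have f: "(\<lambda>t. ?d t k - 1) \<in> E.S" if "k < N" for k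
  proof -
    have "(\<lambda>t. F t k k - cmat_one k k) \<in> E.S" using F that by (simp add: invertible_fun_def)
    then show ?thesis by (simp add: cmat_one_def)
  qed
  have nz: "?d t k \<noteq> 0" if t: "t \<in> {0..1}" and k: "k < N" for t k
  proof
    assume z: "?d t k = 0"
    have "(\<Sum>j<N. F t i j * of_bool (j = k)) = 0" if "i < N" for i
    proof (intro sum.neutral ballI)
      fix j
      show "F t i j * of_bool (j = k) = 0"
        using z d[OF t that k] by (cases "j = k"; cases "i = k") auto
    qed
    then have "(of_bool (k = k) :: complex) = 0"
      using injective_funD[OF F[unfolded invertible_fun_def, THEN conjunct2] t _ k, of "\<lambda>j. of_bool (j = k)"]
      by blast
    then show False by simp
  qed
  have "k \<le> N \<Longrightarrow> ok (\<lambda>t. diag_upto k (?d t)) \<and> \<Phi> (\<lambda>t. diag_upto k (?d t)) \<in> near_products" for k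
  proof (induction k)
    case 0
    then show ?case by (simp add: diag_upto_0 ok_one one one_in_near_products)
  next
    case (Suc k)
    then have k: "k < N" and IH: "ok (\<lambda>t. diag_upto k (?d t))" "\<Phi> (\<lambda>t. diag_upto k (?d t)) \<in> near_products" by auto
    note s = diag_single_loop[OF k f[OF k], simplified]
    have P: "1 + E.X (\<lambda>t. ?d t k - 1) k k \<in> near_products"
      by (rule diagonal_loop_in_near_products[OF k f[OF k]]) (use nz k in simp)
    let ?G = "\<lambda>t. cmat_mult N (diag_upto k (?d t)) (diag_single k (?d t k))"
    have eq: "?G t i j = diag_upto (Suc k) (?d t) i j" if "i < N" "j < N" for t i j
      by (rule diag_upto_Suc[OF k that])
    have okG: "ok ?G" by (rule ok_mult[OF IH(1) s(1)])
    have "ok (\<lambda>t. diag_upto (Suc k) (?d t))"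
      using okG eq unfolding drop_fun_def by (simp add: N_def)
    moreover have "\<Phi> ?G = \<Phi> (\<lambda>t. diag_upto (Suc k) (?d t))" by (rule cong) (rule eq)
    moreover have "\<Phi> ?G \<in> near_products"
      unfolding mult[OF IH(1) s(1)] s(2) by (rule mult_in_near_products[OF IH(2) P])
    ultimately show ?case by simp
  qed
  from this[of N] have "\<Phi> (\<lambda>t. diag_upto N (?d t)) \<in> near_products" by simp
  moreover have "\<Phi> (\<lambda>t. diag_upto N (?d t)) = \<Phi> F"
    by (rule cong) (use d in \<open>auto simp: diag_upto_def\<close>)
  ultimately show "\<Phi> F \<in> near_products" by simp
qed

lemma loop_matrix_in_near_products: "invertible_fun {0, 1} N F \<Longrightarrow> \<Phi> F \<in> near_products"
  by (rule elimination.invertible_imp_W[OF loop_elimination])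

end

subsection \<open>Prescribing the value at one end\<close>

context matrix_units
begin

text \<open>The vector v is placed in column 0 of a matrix V, so that av = 0 becomes aV = 0 and can
  be transported into M_N, where F(z0) is injective.\<close>

lemma injective_of_unit_comb:
  assumes inj: "injective_fun N F" and z0: "z0 \<in> {0..1}"
    and F: "\<And>k l. k < N \<Longrightarrow> l < N \<Longrightarrow> F z0 k l = unit_comb a k l"
    and v: "\<And>i. i < m \<Longrightarrow> (\<Sum>j<m. a i j * v j) = 0"
  shows "\<forall>j<m. v j = 0"
proof (intro allI impI)
  fix i assume i: "i < m"
  define V where "V r j = v r * of_bool (j = (0::nat))" for r j
  have aV: "cmat_mult m a V r s = 0" if "r < m" for r s
    using v[OF that] by (cases "s = 0") (simp_all add: cmat_mult_def V_def)
  have 0: "unit_comb V y l = 0" if y: "y < N" and l: "l < N" for y l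
  proof (rule injective_funD[OF inj z0 _ y, of "\<lambda>y. unit_comb V y l"])
    fix k assume k: "k < N"
    have "(\<Sum>y<N. F z0 k y * unit_comb V y l) = cmat_mult N (unit_comb a) (unit_comb V) k l"
      unfolding cmat_mult_def by (intro sum.cong refl) (use F k in simp)
    also have "\<dots> = unit_comb (\<lambda>_ _. 0) k l"
      unfolding unit_comb_mult[OF k l] by (rule arg_cong2[OF unit_comb_cong]) (use aV in auto)
    also have "\<dots> = 0" by (simp add: unit_comb_def)
    finally show "(\<Sum>y<N. F z0 k y * unit_comb V y l) = 0" .
  qed
  obtain k l where kl: "k < N" "l < N" "e 0 0 k l \<noteq> 0" using units_nonzero[OF m] by blast
  \<comment> \<open>Multiplication by e_0i moves v_i to the corner (0, 0), where a nonzero entry of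
    the unit detects it.\<close>
  let ?E = "\<lambda>a b. of_bool (a = 0 \<and> b = i)"
  have "0 = cmat_mult N (unit_comb ?E) (unit_comb V) k l"
    unfolding cmat_mult_def by (rule sum.neutral[symmetric]) (use 0 kl in auto)
  also have "\<dots> = unit_comb (cmat_mult m ?E V) k l" by (rule unit_comb_mult[OF kl(1,2)])
  also have "cmat_mult m ?E V = (\<lambda>a b. v i * of_bool (a = 0 \<and> b = 0))"
  proof (intro ext)
    fix a b
    have "cmat_mult m ?E V a b = (\<Sum>k<m. if k = i then of_bool (a = 0) * V i b else 0)"
      unfolding cmat_mult_def by (intro sum.cong refl) auto
    then show "cmat_mult m ?E V a b = v i * of_bool (a = 0 \<and> b = 0)" using i by (simp add: V_def)
  qed
  also have "unit_comb (\<lambda>a b. v i * of_bool (a = 0 \<and> b = 0)) k l = v i * e 0 0 k l"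
    by (simp only: unit_comb_scale unit_comb_single[OF m m])
  finally show "v i = 0" using kl(3) by simp
qed

text \<open>A is realised at \<open>z0\<close> by an invertible function that is 1 on Z and already
  a product of elements near 1. Multiplying by it alters the fibre at \<open>z0\<close> and leaves
  those over Z alone.\<close>

definition liftable :: "real \<Rightarrow> (nat \<Rightarrow> nat \<Rightarrow> complex) \<Rightarrow> bool" where
  "liftable z0 A \<longleftrightarrow> (\<exists>G. ok G \<and> injective_fun N G \<and> \<Phi> G \<in> near_products \<and>
     (\<forall>k<N. \<forall>l<N. G z0 k l = unit_comb A k l) \<and> (\<forall>z\<in>Z. \<forall>k<N. \<forall>l<N. G z k l = cmat_one k l))"

lemma liftableI:
  assumes "ok G" "injective_fun N G" "\<Phi> G \<in> near_products"
    "\<And>k l. k < N \<Longrightarrow> l < N \<Longrightarrow> G z0 k l = unit_comb A k l"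
    "\<And>z k l. z \<in> Z \<Longrightarrow> k < N \<Longrightarrow> l < N \<Longrightarrow> G z k l = cmat_one k l"
  shows "liftable z0 A"
  unfolding liftable_def using assms by (intro exI[of _ G] conjI allI impI ballI)

lemma liftable_cong: "liftable z0 A \<Longrightarrow> (\<And>i j. i < m \<Longrightarrow> j < m \<Longrightarrow> A i j = B i j) \<Longrightarrow> liftable z0 B"
  unfolding liftable_def using unit_comb_cong[of A B] by simp

lemma liftable_mult:
  assumes "liftable z0 A" "liftable z0 B"
  shows "liftable z0 (cmat_mult m A B)"
proof -
  obtain G where G: "ok G" "injective_fun N G" "\<Phi> G \<in> near_products"
    "\<forall>k<N. \<forall>l<N. G z0 k l = unit_comb A k l" "\<forall>z\<in>Z. \<forall>k<N. \<forall>l<N. G z k l = cmat_one k l"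
    using assms(1) unfolding liftable_def by blast
  obtain H where H: "ok H" "injective_fun N H" "\<Phi> H \<in> near_products"
    "\<forall>k<N. \<forall>l<N. H z0 k l = unit_comb B k l" "\<forall>z\<in>Z. \<forall>k<N. \<forall>l<N. H z k l = cmat_one k l"
    using assms(2) unfolding liftable_def by blast
  show ?thesis
  proof (rule liftableI)
    show "ok (\<lambda>t. cmat_mult N (G t) (H t))" by (rule ok_mult[OF G(1) H(1)])
    show "injective_fun N (\<lambda>t. cmat_mult N (G t) (H t))" by (rule injective_fun_mult[OF G(2) H(2)])
    show "\<Phi> (\<lambda>t. cmat_mult N (G t) (H t)) \<in> near_products"
      unfolding mult[OF G(1) H(1)] by (rule mult_in_near_products[OF G(3) H(3)])
  next
    fix k l assume kl: "k < N" "l < N"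
    have "cmat_mult N (G z0) (H z0) k l = cmat_mult N (unit_comb A) (unit_comb B) k l"
      by (rule cmat_mult_cong) (use G(4) H(4) kl in auto)
    then show "cmat_mult N (G z0) (H z0) k l = unit_comb (cmat_mult m A B) k l"
      by (simp only: unit_comb_mult[OF kl])
  next
    fix z k l assume z: "z \<in> Z" and kl: "k < N" "l < N"
    have "cmat_mult N (G z) (H z) k l = cmat_mult N cmat_one cmat_one k l"
      by (rule cmat_mult_cong) (use G(5) H(5) kl z in auto)
    then show "cmat_mult N (G z) (H z) k l = cmat_one k l"
      by (simp only: cmat_mult_one(2)[OF kl(1)])
  qed
qed

text \<open>Scaling M by a function that is 1 at \<open>z0\<close> and 0 on Z keeps its square
  zero.\<close>

lemma liftable_one_plus_nilpotent:
  assumes s: "s \<in> S" "s z0 = 1" and nil: "\<And>i j. i < m \<Longrightarrow> j < m \<Longrightarrow> cmat_mult m M M i j = 0"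
  shows "liftable z0 (\<lambda>i j. cmat_one i j + M i j)"
proof -
  let ?M = "\<lambda>t k l. s t * unit_comb M k l"
  have sq: "cmat_mult N (?M t) (?M t) k l = 0" if "k < N" "l < N" for t k l
  proof -
    have "cmat_mult N (?M t) (?M t) k l = s t * s t * cmat_mult N (unit_comb M) (unit_comb M) k l"
      by (simp add: cmat_mult_def sum_distrib_left mult_ac)
    also have "cmat_mult N (unit_comb M) (unit_comb M) k l = unit_comb (\<lambda>_ _. 0) k l"
      unfolding unit_comb_mult[OF that] by (rule arg_cong2[OF unit_comb_cong]) (use nil in auto)
    finally show ?thesis by (simp add: unit_comb_def)
  qed
  have okM: "ok ?M" by (rule ok_unit_comb[OF s(1)])
  show ?thesis
  proof (rule liftableI)
    show "ok (one_plus ?M)" by (rule ok_one_plus[OF okM])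
    show "\<Phi> (one_plus ?M) \<in> near_products" by (rule nilpotent_in_near_products[OF okM]) (rule sq)
    have "nilpotent_fun {} N ?M"
      using sq cont_vanishingD[OF s(1)] unfolding nilpotent_fun_def
      by (auto simp: cont_vanishing_def intro!: continuous_intros)
    then show "injective_fun N (one_plus ?M)" by (rule injective_one_plus)
  next
    fix k l assume "k < N" "l < N"
    then show "one_plus ?M z0 k l = unit_comb (\<lambda>i j. cmat_one i j + M i j) k l"
      by (simp add: one_plus_def unit_comb_add unit_comb_one s(2))
  next
    fix z k l assume "z \<in> Z"
    then show "one_plus ?M z k l = cmat_one k l" using s(1) by (simp add: one_plus_def cont_vanishing_def)
  qed
qed

text \<open>In one corner, exp(s Ln c) is 1 on Z and c at \<open>z0\<close>.\<close>

lemma liftable_diag_single: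
  assumes s: "s \<in> S" "s z0 = 1" and i: "i < m" and c: "c \<noteq> 0"
  shows "liftable z0 (diag_single i c)"
proof -
  let ?f = "\<lambda>\<sigma> t. exp (\<sigma> * (s t * Ln c)) - 1"
  let ?M = "\<lambda>\<sigma> t k l. ?f \<sigma> t * e i i k l"
  have g: "(\<lambda>t. s t * Ln c) \<in> S" using cont_vanishing_mult[OF continuous_on_const s(1), of "Ln c"] by (simp add: mult.commute)
  have f: "?f \<sigma> \<in> S" for \<sigma> by (rule exp_minus_one_in_S[OF g])
  have okM: "ok (?M \<sigma>)" for \<sigma> by (rule units_ok[OF i i f])
  have inv: "cmat_mult N (one_plus (?M (-1)) t) (one_plus (?M 1) t) k l = cmat_one k l" if kl: "k < N" "l < N" for t k l
  proof -
    have "cmat_mult N (one_plus (?M (-1)) t) (one_plus (?M 1) t) k l =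
        cmat_one k l + ?M 1 t k l + (?M (-1) t k l + cmat_mult N (?M (-1) t) (?M 1 t) k l)"
      unfolding cmat_mult_one_plus(1)[OF kl(1)] cmat_mult_one_plus(2)[OF kl] by (simp add: one_plus_def)
    also have "cmat_mult N (?M (-1) t) (?M 1 t) k l = ?f (-1) t * ?f 1 t * cmat_mult N (e i i) (e i i) k l"
      by (simp add: cmat_mult_def sum_distrib_left mult_ac)
    also have "cmat_mult N (e i i) (e i i) k l = e i i k l" using units_mult[OF i i i i kl] by simp
    also have "cmat_one k l + ?M 1 t k l + (?M (-1) t k l + ?f (-1) t * ?f 1 t * e i i k l) =
        cmat_one k l + (?f 1 t + ?f (-1) t + ?f (-1) t * ?f 1 t) * e i i k l"
      by (simp add: algebra_simps)
    also have "?f 1 t + ?f (-1) t + ?f (-1) t * ?f 1 t = 0"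
      by (simp add: algebra_simps exp_add[symmetric])
    finally show ?thesis by simp
  qed
  show ?thesis
  proof (rule liftableI)
    show "ok (one_plus (?M 1))" by (rule ok_one_plus[OF okM])
    have "\<Phi> (one_plus (?M 1)) = 1 + X (\<lambda>t. exp (s t * Ln c) - 1) i i"
      unfolding Phi_one_plus[OF okM] X_def by simp
    then show "\<Phi> (one_plus (?M 1)) \<in> near_products" using exp_X_in_near_products[OF i g] by simp
    show "injective_fun N (one_plus (?M 1))" by (rule injective_fun_of_left_inverse) (rule inv)
  next
    fix k l assume kl: "k < N" "l < N"
    have "unit_comb (diag_single i c) k l = cmat_one k l + (c - 1) * e i i k l"
      unfolding diag_single_def[abs_def] unit_comb_add unit_comb_scale unit_comb_single[OF i i] unit_comb_one[OF kl] ..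
    then show "one_plus (?M 1) z0 k l = unit_comb (diag_single i c) k l"
      using c by (simp add: one_plus_def s(2))
  next
    fix z k l assume "z \<in> Z"
    then show "one_plus (?M 1) z k l = cmat_one k l" using s(1) by (simp add: one_plus_def cont_vanishing_def)
  qed
qed

text \<open>A matrix enters as the value at t = 0 of a function, so that the general elimination
  applies. An elementary factor 1 + M is cancelled by lifting its inverse 1 - M.\<close>

lemma end_elimination:
  assumes s: "s \<in> S" "s z0 = 1"
  shows "elimination {} m (\<lambda>F. liftable z0 (F 0))"
proof
  fix F M assume F: "invertible_fun {} m F" and M: "nilpotent_fun {} m M"
  have sq: "cmat_mult m (M 0) (M 0) i j = 0" if "i < m" "j < m" for i j
    using M that by (simp add: nilpotent_fun_def)
  let ?M' = "\<lambda>i j. - M 0 i j"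
  have sq': "cmat_mult m ?M' ?M' i j = 0" if "i < m" "j < m" for i j
    using sq[OF that] by (simp add: cmat_mult_def)
  note lift' = liftable_one_plus_nilpotent[OF s sq']
  let ?I = "\<lambda>i j. cmat_one i j + - M 0 i j"
  have I: "?I = one_plus (\<lambda>t i j. - M t i j) 0" by (simp add: one_plus_def[abs_def])
  have inv: "cmat_mult m ?I (one_plus M 0) i j = cmat_one i j" "cmat_mult m (one_plus M 0) ?I i j = cmat_one i j"
    if ij: "i < m" "j < m" for i j
  proof -
    have n: "cmat_mult m ?M' (M 0) i j = 0" "cmat_mult m (M 0) ?M' i j = 0"
      using sq[OF ij] by (simp_all add: cmat_mult_def sum_negf)
    show "cmat_mult m ?I (one_plus M 0) i j = cmat_one i j"
      unfolding I cmat_mult_one_plus(1)[OF ij(1)] cmat_mult_one_plus(2)[OF ij] n by (simp add: one_plus_def)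
    show "cmat_mult m (one_plus M 0) ?I i j = cmat_one i j"
      unfolding I cmat_mult_one_plus(1)[OF ij(1)] cmat_mult_one_plus(2)[OF ij] n by (simp add: one_plus_def)
  qed
  show "liftable z0 (F 0)" if W: "liftable z0 (cmat_mult m (one_plus M 0) (F 0))"
  proof (rule liftable_cong[OF liftable_mult[OF lift' W]])
    fix i j assume ij: "i < m" "j < m"
    have "cmat_mult m ?I (cmat_mult m (one_plus M 0) (F 0)) i j = cmat_mult m (cmat_mult m ?I (one_plus M 0)) (F 0) i j"
      by (rule cmat_mult_assoc[symmetric])
    also have "\<dots> = cmat_mult m cmat_one (F 0) i j"
      by (rule cmat_mult_cong) (use inv(1) ij in auto)
    finally show "cmat_mult m ?I (cmat_mult m (one_plus M 0) (F 0)) i j = F 0 i j"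
      by (simp only: cmat_mult_one(2)[OF ij(1)])
  qed
  show "liftable z0 (F 0)" if W: "liftable z0 (cmat_mult m (F 0) (one_plus M 0))"
  proof (rule liftable_cong[OF liftable_mult[OF W lift']])
    fix i j assume ij: "i < m" "j < m"
    have "cmat_mult m (cmat_mult m (F 0) (one_plus M 0)) ?I i j = cmat_mult m (F 0) (cmat_mult m (one_plus M 0) ?I) i j"
      by (rule cmat_mult_assoc)
    also have "\<dots> = cmat_mult m (F 0) cmat_one i j"
      by (rule cmat_mult_cong) (use inv(2) ij in auto)
    finally show "cmat_mult m (cmat_mult m (F 0) (one_plus M 0)) ?I i j = F 0 i j"
      using ij(2) by (simp only: cmat_mult_one(1)[OF ij(1)]) simp
  qed
next
  fix F assume F: "invertible_fun {} m F"
    and d: "\<And>t i j. t \<in> {0..1} \<Longrightarrow> i < m \<Longrightarrow> j < m \<Longrightarrow> i \<noteq> j \<Longrightarrow> F t i j = 0"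
  let ?d = "\<lambda>i. F 0 i i"
  have nz: "?d k \<noteq> 0" if k: "k < m" for k
  proof
    assume z: "?d k = 0"
    have "(\<Sum>j<m. F 0 i j * of_bool (j = k)) = 0" if "i < m" for i
    proof (intro sum.neutral ballI)
      fix j
      show "F 0 i j * of_bool (j = k) = 0"
        using z d[of 0, OF _ that k] by (cases "j = k"; cases "i = k") auto
    qed
    then have "(of_bool (k = k) :: complex) = 0"
      using injective_funD[OF F[unfolded invertible_fun_def, THEN conjunct2] _ _ k, of 0 "\<lambda>j. of_bool (j = k)"]
      by auto
    then show False by simp
  qed
  have "k \<le> m \<Longrightarrow> liftable z0 (diag_upto k ?d)" for k
  proof (induction k)
    case 0
    have "liftable z0 (\<lambda>i j. cmat_one i j + 0)"
      by (rule liftable_one_plus_nilpotent[OF s]) (simp add: cmat_mult_def)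
    then show ?case by (simp add: diag_upto_0)
  next
    case (Suc k)
    then have k: "k < m" by simp
    have "liftable z0 (cmat_mult m (diag_upto k ?d) (diag_single k (?d k)))"
      by (rule liftable_mult[OF _ liftable_diag_single[OF s k nz[OF k]]]) (use Suc in simp)
    then show ?case by (rule liftable_cong) (rule diag_upto_Suc[OF k])
  qed
  from this[of m] have "liftable z0 (diag_upto m ?d)" by simp
  then show "liftable z0 (F 0)"
    by (rule liftable_cong) (use d in \<open>auto simp: diag_upto_def\<close>)
qed

lemma liftable_of_injective:
  assumes s: "s \<in> S" "s z0 = 1"
    and inj: "\<And>v. (\<And>i. i < m \<Longrightarrow> (\<Sum>j<m. a i j * v j) = 0) \<Longrightarrow> \<forall>j<m. v j = 0"
  shows "liftable z0 a"
proof -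
  have "injective_fun m (\<lambda>t. a)" using inj unfolding injective_fun_def by blast
  then have "invertible_fun {} m (\<lambda>t. a)"
    by (simp add: invertible_fun_def cont_vanishing_def)
  then show ?thesis by (rule elimination.invertible_imp_W[OF end_elimination[OF s], of "\<lambda>t. a"])
qed

text \<open>The value of F at \<open>z0\<close> is invertible inside the fibre M_m and not merely in
  M_N; lifting that inverse allows this end to be normalised to 1.\<close>

lemma inverse_liftable:
  assumes s: "s \<in> S" "s z0 = 1" and z0: "z0 \<in> {0..1}" and inj: "injective_fun N F"
    and F: "\<And>k l. k < N \<Longrightarrow> l < N \<Longrightarrow> F z0 k l = unit_comb a k l"
  obtains G where "ok G" "injective_fun N G" "\<Phi> G \<in> near_products"
    "\<And>k l. k < N \<Longrightarrow> l < N \<Longrightarrow> cmat_mult N (G z0) (F z0) k l = cmat_one k l"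
    "\<And>z k l. z \<in> Z \<Longrightarrow> k < N \<Longrightarrow> l < N \<Longrightarrow> G z k l = cmat_one k l"
proof -
  have inja: "\<forall>j<m. v j = 0" if "\<And>i. i < m \<Longrightarrow> (\<Sum>j<m. a i j * v j) = 0" for v
    using injective_of_unit_comb[of F z0 a v, OF inj z0 F that] .
  obtain A where A: "\<And>i j. i < m \<Longrightarrow> j < m \<Longrightarrow> cmat_mult m A a i j = cmat_one i j"
    "\<And>i j. i < m \<Longrightarrow> j < m \<Longrightarrow> cmat_mult m a A i j = cmat_one i j"
    by (rule cmat_inverse[of m a, OF inja]) (assumption, blast)
  have "liftable z0 A"
  proof (rule liftable_of_injective[OF s])
    fix v assume v: "\<And>i. i < m \<Longrightarrow> (\<Sum>j<m. A i j * v j) = 0"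
    show "\<forall>j<m. v j = 0"
    proof (intro allI impI)
      fix j assume j: "j < m"
      have "v j = (\<Sum>l<m. cmat_mult m a A j l * v l)" using A(2)[OF j] sum_cmat_one[OF j, of v] by simp
      also have "\<dots> = 0" using v by (simp add: sum_cmat_mult)
      finally show "v j = 0" .
    qed
  qed
  then obtain G where G: "ok G" "injective_fun N G" "\<Phi> G \<in> near_products"
    "\<forall>k<N. \<forall>l<N. G z0 k l = unit_comb A k l" "\<forall>z\<in>Z. \<forall>k<N. \<forall>l<N. G z k l = cmat_one k l"
    unfolding liftable_def by blast
  show thesis
  proof (rule that[OF G(1-3)])
    fix k l assume kl: "k < N" "l < N"
    have "cmat_mult N (G z0) (F z0) k l = cmat_mult N (unit_comb A) (unit_comb a) k l"
      by (rule cmat_mult_cong) (use G(4) F kl in auto)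
    also have "\<dots> = unit_comb cmat_one k l"
      unfolding unit_comb_mult[OF kl] by (rule arg_cong2[OF unit_comb_cong]) (use A in auto)
    finally show "cmat_mult N (G z0) (F z0) k l = cmat_one k l" by (simp only: unit_comb_one[OF kl])
  qed (use G(5) in blast)
qed

end

context drop_embedding
begin

interpretation L: matrix_units p q N \<Phi> "{1}" p unitL by (rule matrix_units_L)
interpretation R: matrix_units p q N \<Phi> "{0}" q unitR by (rule matrix_units_R)

text \<open>G and H normalise the ends 0 and 1 respectively, each being 1 at the opposite end. Hence
  HGF is a loop based at the identity, to which the elimination for loops applies.\<close>

lemma injective_in_near_products:
  assumes F: "ok F" and inj: "injective_fun N F"
  shows "\<Phi> F \<in> near_products"
proof -
  obtain a b where cF: "\<And>i j. i < p * q \<Longrightarrow> j < p * q \<Longrightarrow> continuous_on {0..1} (\<lambda>t. F t i j)"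
    and a: "\<And>i j. i < p * q \<Longrightarrow> j < p * q \<Longrightarrow> F 0 i j = kron_left q a i j"
    and b: "\<And>i j. i < p * q \<Longrightarrow> j < p * q \<Longrightarrow> F 1 i j = kron_right q b i j"
    by (rule drop_funE[OF F]) (rule that; assumption)
  have Fa: "F 0 k l = L.unit_comb a k l" and Fb: "F 1 k l = R.unit_comb b k l" if "k < N" "l < N" for k l
    using that a b by (simp_all add: unit_comb_L unit_comb_R N_def)
  have sL: "(\<lambda>t. complex_of_real (1 - t)) \<in> L.S" and sR: "complex_of_real \<in> R.S"
    by (auto simp: cont_vanishing_def intro!: continuous_intros)
  obtain G where G: "ok G" "injective_fun N G" "\<Phi> G \<in> near_products"
    "\<And>k l. k < N \<Longrightarrow> l < N \<Longrightarrow> cmat_mult N (G 0) (F 0) k l = cmat_one k l"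
    "\<And>z k l. z \<in> {1} \<Longrightarrow> k < N \<Longrightarrow> l < N \<Longrightarrow> G z k l = cmat_one k l"
    by (rule L.inverse_liftable[OF sL _ _ inj Fa]) simp_all
  obtain H where H: "ok H" "injective_fun N H" "\<Phi> H \<in> near_products"
    "\<And>k l. k < N \<Longrightarrow> l < N \<Longrightarrow> cmat_mult N (H 1) (F 1) k l = cmat_one k l"
    "\<And>z k l. z \<in> {0} \<Longrightarrow> k < N \<Longrightarrow> l < N \<Longrightarrow> H z k l = cmat_one k l"
    by (rule R.inverse_liftable[OF sR _ _ inj Fb]) simp_all
  define K where "K t = cmat_mult N (H t) (cmat_mult N (G t) (F t))" for t
  note okGF = ok_mult[OF G(1) F]
  have okK: "ok K" unfolding K_def[abs_def] by (rule ok_mult[OF H(1) okGF])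
  have K0: "K 0 k l = cmat_one k l" if kl: "k < N" "l < N" for k l
  proof -
    have "K 0 k l = cmat_mult N cmat_one (cmat_mult N (G 0) (F 0)) k l"
      unfolding K_def by (rule cmat_mult_cong) (use H(5) kl in auto)
    then show ?thesis using cmat_mult_one(2)[OF kl(1)] G(4)[OF kl] by simp
  qed
  have K1: "K 1 k l = cmat_one k l" if kl: "k < N" "l < N" for k l
  proof -
    have "cmat_mult N (G 1) (F 1) x l = F 1 x l" if "x < N" for x
    proof -
      have "cmat_mult N (G 1) (F 1) x l = cmat_mult N cmat_one (F 1) x l"
        by (rule cmat_mult_cong) (use G(5) that in auto)
      then show ?thesis using cmat_mult_one(2)[OF that] by simp
    qed
    then have "K 1 k l = cmat_mult N (H 1) (F 1) k l"
      unfolding K_def by (intro cmat_mult_cong) auto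
    then show ?thesis using H(4)[OF kl] by simp
  qed
  have "injective_fun N K"
    unfolding K_def[abs_def] by (rule injective_fun_mult[OF H(2) injective_fun_mult[OF G(2) inj]])
  moreover have "(\<lambda>t. K t k l - cmat_one k l) \<in> cont_vanishing {0, 1}" if "k < N" "l < N" for k l
    using K0 K1 ok_continuous[OF okK] that by (auto simp: cont_vanishing_def intro!: continuous_intros)
  ultimately have "\<Phi> K \<in> near_products"
    by (intro loop_matrix_in_near_products) (simp add: invertible_fun_def)
  moreover have "\<Phi> K = \<Phi> H * (\<Phi> G * \<Phi> F)"
    unfolding K_def[abs_def] mult[OF H(1) okGF] mult[OF G(1) F] ..
  ultimately show ?thesis
    using near_products_cancel_left[OF H(3)] near_products_cancel_left[OF G(3)] by metis
qed

end

section \<open>The determinant of a product\<close>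

abbreviation to_mat :: "nat \<Rightarrow> (nat \<Rightarrow> nat \<Rightarrow> complex) \<Rightarrow> complex mat" where
  "to_mat n A \<equiv> mat n n (\<lambda>(i, j). A i j)"

primrec cmat_pow :: "nat \<Rightarrow> (nat \<Rightarrow> nat \<Rightarrow> complex) \<Rightarrow> nat \<Rightarrow> nat \<Rightarrow> nat \<Rightarrow> complex" where
  "cmat_pow n A 0 = cmat_one"
| "cmat_pow n A (Suc k) = cmat_mult n (cmat_pow n A k) A"

lemma to_mat_mult: "to_mat n (cmat_mult n A B) = to_mat n A * to_mat n B"
  by (rule eq_matI) (auto simp: cmat_mult_def scalar_prod_def atLeast0LessThan)

lemma to_mat_one: "to_mat n cmat_one = 1\<^sub>m n"
  by (rule eq_matI) (auto simp: cmat_one_def)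

lemma to_mat_pow: "to_mat n (cmat_pow n A k) = to_mat n A ^\<^sub>m k"
proof (induction k)
  case 0
  have "dim_row (to_mat n A) = n" by simp
  then show ?case by (simp only: cmat_pow.simps to_mat_one pow_mat.simps)
qed (simp only: cmat_pow.simps to_mat_mult pow_mat.simps)

lemma to_mat_pow_index: "i < n \<Longrightarrow> j < n \<Longrightarrow> (to_mat n A ^\<^sub>m k) $$ (i, j) = cmat_pow n A k i j"
  by (simp flip: to_mat_pow)

lemma det_to_mat_mult: "det (to_mat n (cmat_mult n A B)) = det (to_mat n A) * det (to_mat n B)"
  unfolding to_mat_mult by (rule det_mult) auto

context drop_embedding
begin

definition "minus_one F t i j = F t i j - cmat_one i j" for F :: "real \<Rightarrow> nat \<Rightarrow> nat \<Rightarrow> complex"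

lemma ok_minus_one: "ok F \<Longrightarrow> ok (minus_one F)"
  using drop_fun_add[OF _ drop_fun_scale[OF ok_one, of "-1"], of F] by (simp add: minus_one_def[abs_def])

lemma Phi_minus_one: "ok F \<Longrightarrow> \<Phi> (minus_one F) = \<Phi> F - 1"
  using add[OF _ drop_fun_scale[OF ok_one, of "-1"], of F] scale[OF ok_one, of "-1"]
  by (simp add: minus_one_def[abs_def] one scaleC_minus_left)

lemma pow_minus_one:
  assumes F: "ok F"
  shows "ok (\<lambda>t. cmat_pow N (minus_one F t) k) \<and> \<Phi> (\<lambda>t. cmat_pow N (minus_one F t) k) = (\<Phi> F - 1) ^ k"
proof (induction k)
  case (Suc k)
  then show ?case
    using ok_mult[OF _ ok_minus_one[OF F]] mult[OF _ ok_minus_one[OF F]] Phi_minus_one[OF F]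
    by (simp add: power_commutes)
qed (simp add: ok_one one)

text \<open>\<open>entry_le_norm\<close> carries the norm bound on the powers in the algebra to
  every entry of every fibre; this is the power bound that the determinant formula asks for.\<close>

lemma pow_minus_one_bound:
  assumes F: "ok F" and r: "norm (\<Phi> F - 1) \<le> r" and tij: "t \<in> {0..1}" "i < N" "j < N"
  shows "cmod (cmat_pow N (minus_one F t) k i j) \<le> r ^ k"
proof -
  have "cmod (cmat_pow N (minus_one F t) k i j) \<le> norm ((\<Phi> F - 1) ^ k)"
    using entry_le_norm[OF conjunct1[OF pow_minus_one[OF F]] tij(2,3,1)] pow_minus_one[OF F] by metis
  also have "\<dots> \<le> norm (\<Phi> F - 1) ^ k" by (rule norm_power_ineq)
  also have "\<dots> \<le> r ^ k" using r by (intro power_mono) auto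
  finally show ?thesis .
qed

text \<open>The normalised trace, in the fibre over t, of the k-th term of the logarithm series;
  summed over k it becomes the normalised trace of the logarithm.\<close>

definition "log_term F k t = complex_of_real (log_coeff k) * ((\<Sum>i<N. cmat_pow N (minus_one F t) (Suc k) i i) / of_nat N)"

definition "log_trace F t = (\<Sum>k. log_term F k t)"

lemma log_term_bound:
  assumes F: "ok F" and r: "norm (\<Phi> F - 1) \<le> r" and t: "t \<in> {0..1}"
  shows "cmod (log_term F k t) \<le> r ^ Suc k"
proof -
  have "cmod (\<Sum>i<N. cmat_pow N (minus_one F t) (Suc k) i i) \<le> (\<Sum>i<N. r ^ Suc k)"
    by (rule order_trans[OF norm_sum], rule sum_mono, rule pow_minus_one_bound[OF F r t]) auto
  then have "cmod ((\<Sum>i<N. cmat_pow N (minus_one F t) (Suc k) i i) / of_nat N) \<le> r ^ Suc k"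
    using N_pos by (simp add: norm_divide field_simps del: power_Suc cmat_pow.simps)
  moreover have "0 \<le> r" using r norm_ge_zero order_trans by blast
  ultimately have "\<bar>log_coeff k\<bar> * cmod ((\<Sum>i<N. cmat_pow N (minus_one F t) (Suc k) i i) / of_nat N) \<le> 1 * r ^ Suc k"
    by (intro mult_mono abs_log_coeff_le) auto
  then show ?thesis by (simp only: log_term_def norm_mult norm_of_real mult_1_left)
qed

lemma log_trace_uniform_limit:
  assumes F: "ok F" and r: "norm (\<Phi> F - 1) < 1"
  shows "uniform_limit {0..1} (\<lambda>n t. \<Sum>k<n. log_term F k t) (log_trace F) sequentially"
  unfolding log_trace_def[abs_def]
  by (rule Weierstrass_m_test[where M = "\<lambda>n. norm (\<Phi> F - 1) ^ Suc n"])
     (rule log_term_bound[OF F order_refl], assumption, rule summable_power_Suc[OF norm_ge_zero r])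

lemma continuous_trace_pow:
  assumes F: "ok F"
  shows "continuous_on {0..1} (\<lambda>t. (\<Sum>i<N. cmat_pow N (minus_one F t) k i i) / of_nat N)"
  by (intro continuous_intros ok_continuous[OF conjunct1[OF pow_minus_one[OF F]]]) (use N_pos in auto)

lemma continuous_log_term: "ok F \<Longrightarrow> continuous_on {0..1} (log_term F k)"
  unfolding log_term_def[abs_def] by (intro continuous_on_mult continuous_on_const continuous_trace_pow)

lemma continuous_log_trace:
  assumes F: "ok F" and r: "norm (\<Phi> F - 1) < 1"
  shows "continuous_on {0..1} (log_trace F)"
  by (rule uniform_limit_theorem[OF _ log_trace_uniform_limit[OF F r]])
     (intro always_eventually allI continuous_on_sum continuous_log_term[OF F], rule sequentially_bot)

text \<open>Term by term this is \<open>trace_eq_scalar\<close> for the powers of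
  \<open>\<Phi> F - 1\<close>. Summation passes through because \<open>\<tau>\<close> is bounded and
  because uniform convergence on the interval is norm convergence of scalar functions.\<close>

lemma trace_near_log:
  assumes \<tau>: "tracial_state \<tau>" and F: "ok F" and r: "norm (\<Phi> F - 1) < 1"
  shows "\<tau> (near_log (\<Phi> F)) = \<tau> (scalar (log_trace F))"
proof -
  note bl = bounded_linear_tracial_state[OF \<tau>]
  note cT = continuous_log_term[OF F]
  have eq: "\<tau> (log_coeff k *\<^sub>R (\<Phi> F - 1) ^ Suc k) = \<tau> (scalar (log_term F k))" for k
  proof -
    let ?t = "\<lambda>t. (\<Sum>i<N. cmat_pow N (minus_one F t) (Suc k) i i) / of_nat N"
    have "\<tau> ((\<Phi> F - 1) ^ Suc k) = \<tau> (\<Phi> (\<lambda>t. cmat_pow N (minus_one F t) (Suc k)))"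
      by (simp only: pow_minus_one[OF F])
    also have "\<dots> = \<tau> (scalar ?t)"
      by (rule trace_eq_scalar[OF \<tau> conjunct1[OF pow_minus_one[OF F]]])
    finally have tr: "\<tau> ((\<Phi> F - 1) ^ Suc k) = \<tau> (scalar ?t)" .
    have "\<tau> (log_coeff k *\<^sub>R (\<Phi> F - 1) ^ Suc k) = complex_of_real (log_coeff k) * \<tau> (scalar ?t)"
      unfolding tracial_stateD(8)[OF \<tau>] tr by (rule scaleR_conv_of_real)
    also have "\<dots> = \<tau> (scalar (log_term F k))"
      unfolding log_term_def[abs_def] scalar_scale[OF continuous_trace_pow[OF F]]
      by (rule tracial_stateD(2)[OF \<tau>, symmetric])
    finally show ?thesis .
  qed
  have "(\<lambda>k. log_coeff k *\<^sub>R (\<Phi> F - 1) ^ Suc k) sums near_log (\<Phi> F)"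
    unfolding near_log_def by (rule summable_sums[OF summable_log_series[OF r]])
  then have "(\<lambda>k. \<tau> (scalar (log_term F k))) sums \<tau> (near_log (\<Phi> F))"
    unfolding eq[symmetric] by (rule bounded_linear.sums[OF bl])
  then have 1: "(\<lambda>n. \<Sum>k<n. \<tau> (scalar (log_term F k))) \<longlonglongrightarrow> \<tau> (near_log (\<Phi> F))" by (simp add: sums_def)
  have cS: "continuous_on {0..1} (\<lambda>t. \<Sum>k<n. log_term F k t)" for n by (intro continuous_on_sum cT)
  have sumT: "(\<Sum>k<n. scalar (log_term F k)) = scalar (\<lambda>t. \<Sum>k<n. log_term F k t)" for n
  proof (induction n)
    case 0
    show ?case using scalar_const[of 0] by simp
  next
    case (Suc n)
    have "scalar (\<lambda>t. \<Sum>k<Suc n. log_term F k t) = scalar (\<lambda>t. \<Sum>k<n. log_term F k t) + scalar (log_term F n)"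
      using scalar_add[OF cS cT, of n n] by (simp only: sum.lessThan_Suc)
    then show ?case using Suc by (simp only: sum.lessThan_Suc)
  qed
  have "(\<lambda>n. scalar (\<lambda>t. \<Sum>k<n. log_term F k t)) \<longlonglongrightarrow> scalar (log_trace F)"
  proof (rule LIMSEQ_I)
    fix \<epsilon> :: real assume \<epsilon>: "0 < \<epsilon>"
    have "\<forall>\<^sub>F n in sequentially. \<forall>t\<in>{0..1}. dist (\<Sum>k<n. log_term F k t) (log_trace F t) < \<epsilon> / 2"
      using uniform_limitD[OF log_trace_uniform_limit[OF F r], of "\<epsilon> / 2"] \<epsilon> by simp
    then obtain n0 where n0: "\<And>n t. n \<ge> n0 \<Longrightarrow> t \<in> {0..1} \<Longrightarrow> dist (\<Sum>k<n. log_term F k t) (log_trace F t) < \<epsilon> / 2"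
      unfolding eventually_sequentially by blast
    show "\<exists>n0. \<forall>n\<ge>n0. norm (scalar (\<lambda>t. \<Sum>k<n. log_term F k t) - scalar (log_trace F)) < \<epsilon>"
    proof (intro exI[of _ n0] allI impI)
      fix n assume n: "n \<ge> n0"
      have c: "continuous_on {0..1} (\<lambda>t. - 1 * log_trace F t)"
        by (intro continuous_intros continuous_log_trace[OF F r])
      have "scalar (\<lambda>t. \<Sum>k<n. log_term F k t) - scalar (log_trace F) =
          scalar (\<lambda>t. \<Sum>k<n. log_term F k t) + scalar (\<lambda>t. - 1 * log_trace F t)"
        unfolding scalar_scale[OF continuous_log_trace[OF F r]] by (simp add: scaleC_minus_left)
      also have "\<dots> = scalar (\<lambda>t. (\<Sum>k<n. log_term F k t) + - 1 * log_trace F t)"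
        by (rule scalar_add[OF cS c, symmetric])
      finally have "norm (scalar (\<lambda>t. \<Sum>k<n. log_term F k t) - scalar (log_trace F)) =
          norm (scalar (\<lambda>t. (\<Sum>k<n. log_term F k t) + - 1 * log_trace F t))" by simp
      also have "\<dots> \<le> \<epsilon> / 2"
      proof (rule norm_scalar_le)
        show "continuous_on {0..1} (\<lambda>t. (\<Sum>k<n. log_term F k t) + - 1 * log_trace F t)"
          by (intro continuous_on_add cS c)
        show "cmod ((\<Sum>k<n. log_term F k t) + - 1 * log_trace F t) \<le> \<epsilon> / 2" if "t \<in> {0..1}" for t
          using n0[OF n that] by (simp add: dist_norm)
      qed (use \<epsilon> in simp)
      also have "\<dots> < \<epsilon>" using \<epsilon> by simp
      finally show "norm (scalar (\<lambda>t. \<Sum>k<n. log_term F k t) - scalar (log_trace F)) < \<epsilon>" .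
    qed
  qed
  then have "(\<lambda>n. \<tau> (scalar (\<lambda>t. \<Sum>k<n. log_term F k t))) \<longlonglongrightarrow> \<tau> (scalar (log_trace F))"
    by (rule bounded_linear.tendsto[OF bl])
  moreover have "\<tau> (scalar (\<lambda>t. \<Sum>k<n. log_term F k t)) = (\<Sum>k<n. \<tau> (scalar (log_term F k)))" for n
    unfolding sumT[symmetric] by (rule linear_sum[OF bounded_linear.linear[OF bl]])
  ultimately have "(\<lambda>n. \<Sum>k<n. \<tau> (scalar (log_term F k))) \<longlonglongrightarrow> \<tau> (scalar (log_trace F))" by simp
  with 1 show ?thesis by (rule LIMSEQ_unique)
qed

definition "list_mult Fs t = foldr (\<lambda>F A. cmat_mult N (F t) A) Fs cmat_one"

lemma list_mult_Cons: "list_mult (F # Fs) = (\<lambda>t. cmat_mult N (F t) (list_mult Fs t))"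
  by (simp add: list_mult_def fun_eq_iff)

lemma list_mult_Nil: "list_mult [] = (\<lambda>t. cmat_one)"
  by (simp add: list_mult_def fun_eq_iff)

lemma list_mult_ok: "(\<And>F. F \<in> set Fs \<Longrightarrow> ok F) \<Longrightarrow> ok (list_mult Fs)"
  by (induction Fs) (auto simp: list_mult_Nil list_mult_Cons intro: ok_one ok_mult)

lemma Phi_list_mult: "(\<And>F. F \<in> set Fs \<Longrightarrow> ok F) \<Longrightarrow> \<Phi> (list_mult Fs) = prod_list (map \<Phi> Fs)"
  by (induction Fs) (auto simp: list_mult_Nil list_mult_Cons one mult list_mult_ok)

end

text \<open>
  Evaluation at \<open>z\<^sub>0\<close> lands in the copy of the matrices of size \<open>m\<close> spanned by the units, and
  the compression to the indices \<open>\<iota> i\<close> recovers the small matrix.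
\<close>

locale evaluation_units = matrix_units p q N \<Phi> Z m e
  for p q N :: nat and \<Phi> :: "(real \<Rightarrow> nat \<Rightarrow> nat \<Rightarrow> complex) \<Rightarrow> 'a::unital_cstar_algebra"
    and Z :: "real set" and m :: nat and e :: "nat \<Rightarrow> nat \<Rightarrow> nat \<Rightarrow> nat \<Rightarrow> complex" +
  fixes z0 :: real and \<iota> :: "nat \<Rightarrow> nat"
  assumes z0: "z0 \<in> {0..1}"
    and \<iota>_less: "i < m \<Longrightarrow> \<iota> i < N"
    and \<iota>_entry: "i < m \<Longrightarrow> j < m \<Longrightarrow> i' < m \<Longrightarrow> j' < m \<Longrightarrow> e i j (\<iota> i') (\<iota> j') = of_bool (i = i' \<and> j = j')"
    and units_trace: "i < m \<Longrightarrow> j < m \<Longrightarrow> of_nat m * (\<Sum>k<N. e i j k k) = of_nat N * of_bool (i = j)"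
    and evaluation: "drop_fun p q F \<Longrightarrow> k < N \<Longrightarrow> l < N \<Longrightarrow> F z0 k l = unit_comb (\<lambda>i j. F z0 (\<iota> i) (\<iota> j)) k l"
begin

definition "ev F i j = F z0 (\<iota> i) (\<iota> j)" for F :: "real \<Rightarrow> nat \<Rightarrow> nat \<Rightarrow> complex"

lemma unit_comb_entry:
  assumes "i < m" "j < m"
  shows "unit_comb A (\<iota> i) (\<iota> j) = A i j"
proof -
  have "unit_comb A (\<iota> i) (\<iota> j) = (\<Sum>a<m. if a = i then (\<Sum>b<m. if b = j then A i j else 0) else 0)"
    unfolding unit_comb_def by (intro sum.cong refl) (use \<iota>_entry assms in \<open>auto intro!: sum.cong\<close>)
  then show ?thesis using assms by simp
qed

lemma ev_eq: "ok F \<Longrightarrow> k < N \<Longrightarrow> l < N \<Longrightarrow> F z0 k l = unit_comb (ev F) k l"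
  using evaluation[of F k l] by (simp add: ev_def[abs_def])

lemma ev_mult:
  assumes "ok F" "ok G" "i < m" "j < m"
  shows "ev (\<lambda>t. cmat_mult N (F t) (G t)) i j = cmat_mult m (ev F) (ev G) i j"
proof -
  have "ev (\<lambda>t. cmat_mult N (F t) (G t)) i j = cmat_mult N (unit_comb (ev F)) (unit_comb (ev G)) (\<iota> i) (\<iota> j)"
    unfolding ev_def[of "\<lambda>t. cmat_mult N (F t) (G t)"]
    by (rule cmat_mult_cong) (use ev_eq assms \<iota>_less in auto)
  also have "\<dots> = unit_comb (cmat_mult m (ev F) (ev G)) (\<iota> i) (\<iota> j)"
    by (rule unit_comb_mult) (use \<iota>_less assms in auto)
  finally show ?thesis by (simp add: unit_comb_entry assms)
qed

lemma ev_one: "i < m \<Longrightarrow> j < m \<Longrightarrow> ev (\<lambda>t. cmat_one) i j = cmat_one i j"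
  unfolding ev_def using unit_comb_one[of "\<iota> i" "\<iota> j"] unit_comb_entry[of i j cmat_one] \<iota>_less by simp

lemma det_ev_mult:
  assumes "ok F" "ok G"
  shows "det (to_mat m (ev (\<lambda>t. cmat_mult N (F t) (G t)))) = det (to_mat m (ev F)) * det (to_mat m (ev G))"
proof -
  have "to_mat m (ev (\<lambda>t. cmat_mult N (F t) (G t))) = to_mat m (cmat_mult m (ev F) (ev G))"
    by (rule eq_matI) (use ev_mult[OF assms] in auto)
  then show ?thesis by (simp only: det_to_mat_mult)
qed

lemma ev_pow: "ok F \<Longrightarrow> k < N \<Longrightarrow> l < N \<Longrightarrow>
  cmat_pow N (minus_one F z0) x k l = unit_comb (cmat_pow m (ev (minus_one F)) x) k l"
proof (induction x arbitrary: k l)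
  case 0
  then show ?case by (simp add: unit_comb_one)
next
  case (Suc x)
  have "cmat_pow N (minus_one F z0) (Suc x) k l =
      cmat_mult N (unit_comb (cmat_pow m (ev (minus_one F)) x)) (unit_comb (ev (minus_one F))) k l"
    unfolding cmat_pow.simps
    by (rule cmat_mult_cong) (use Suc ev_eq[OF ok_minus_one[OF Suc.prems(1)]] in auto)
  then show ?case by (simp only: unit_comb_mult[OF Suc.prems(2,3)] cmat_pow.simps)
qed

lemma unit_comb_trace: "of_nat m * (\<Sum>k<N. unit_comb A k k) = of_nat N * (\<Sum>i<m. A i i)"
proof -
  have "(\<Sum>k<N. unit_comb A k k) = (\<Sum>i<m. \<Sum>k<N. \<Sum>j<m. A i j * e i j k k)"
    unfolding unit_comb_def by (rule sum.swap)
  also have "\<dots> = (\<Sum>i<m. \<Sum>j<m. \<Sum>k<N. A i j * e i j k k)"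
    by (intro sum.cong refl sum.swap)
  finally have "of_nat m * (\<Sum>k<N. unit_comb A k k) = (\<Sum>i<m. \<Sum>j<m. A i j * (of_nat m * (\<Sum>k<N. e i j k k)))"
    by (simp add: sum_distrib_left mult.left_commute)
  also have "\<dots> = (\<Sum>i<m. \<Sum>j<m. if j = i then A i i * of_nat N else 0)"
    by (intro sum.cong refl) (use units_trace in auto)
  also have "\<dots> = of_nat N * (\<Sum>i<m. A i i)" by (simp add: sum_distrib_left mult.commute)
  finally show ?thesis .
qed

text \<open>Spreading a matrix of size m over the units multiplies its trace by N/m, so m times the
  normalised trace is already the trace of a logarithm in M_m. At the ends m is p or q instead of N,
  which is what narrows down the logarithm.\<close>

lemma exp_log_trace_eq_det:
  assumes F: "ok F" and r: "norm (\<Phi> F - 1) < 1"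
  shows "exp (of_nat m * log_trace F z0) = det (to_mat m (ev F))"
proof -
  let ?A = "ev (minus_one F)"
  have bound: "cmod ((to_mat m ?A ^\<^sub>m k) $$ (i, j)) \<le> norm (\<Phi> F - 1) ^ k" if "i < m" "j < m" for i j k
  proof -
    have "(to_mat m ?A ^\<^sub>m k) $$ (i, j) = cmat_pow N (minus_one F z0) k (\<iota> i) (\<iota> j)"
      using that ev_pow[OF F \<iota>_less \<iota>_less] by (simp add: to_mat_pow_index unit_comb_entry)
    then show ?thesis using pow_minus_one_bound[OF F order_refl z0 \<iota>_less[OF that(1)] \<iota>_less[OF that(2)]] by simp
  qed
  have "summable (\<lambda>k. log_term F k z0)"
    by (rule summable_comparison_test'[OF summable_power_Suc[OF norm_ge_zero r], of 0])
       (rule log_term_bound[OF F order_refl z0])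
  then have "of_nat m * log_trace F z0 = (\<Sum>k. of_nat m * log_term F k z0)"
    unfolding log_trace_def by (rule suminf_mult[symmetric])
  also have "\<dots> = (\<Sum>k. complex_of_real (log_coeff k) * (\<Sum>i<m. (to_mat m ?A ^\<^sub>m Suc k) $$ (i, i)))"
  proof (rule suminf_cong)
    fix k
    have "of_nat m * (\<Sum>i<N. cmat_pow N (minus_one F z0) (Suc k) i i) =
        of_nat m * (\<Sum>i<N. unit_comb (cmat_pow m ?A (Suc k)) i i)"
      by (intro arg_cong[where f = "(*) (of_nat m)"] sum.cong refl) (rule ev_pow[OF F], auto)
    also have "\<dots> = of_nat N * (\<Sum>i<m. cmat_pow m ?A (Suc k) i i)" by (rule unit_comb_trace)
    also have "(\<Sum>i<m. cmat_pow m ?A (Suc k) i i) = (\<Sum>i<m. (to_mat m ?A ^\<^sub>m Suc k) $$ (i, i))"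
      by (intro sum.cong refl to_mat_pow_index[symmetric]) auto
    finally have eq: "of_nat m * (\<Sum>i<N. cmat_pow N (minus_one F z0) (Suc k) i i) =
        of_nat N * (\<Sum>i<m. (to_mat m ?A ^\<^sub>m Suc k) $$ (i, i))" .
    have "of_nat m * log_term F k z0 =
        complex_of_real (log_coeff k) * ((of_nat m * (\<Sum>i<N. cmat_pow N (minus_one F z0) (Suc k) i i)) / of_nat N)"
      by (simp only: log_term_def mult.left_commute times_divide_eq_right)
    then show "of_nat m * log_term F k z0 =
        complex_of_real (log_coeff k) * (\<Sum>i<m. (to_mat m ?A ^\<^sub>m Suc k) $$ (i, i))"
      unfolding eq using N_pos by simp
  qed
  finally have "exp (of_nat m * log_trace F z0) = det (1\<^sub>m m + to_mat m ?A)"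
    using exp_log_series_trace_eq_det[of "to_mat m ?A" m, OF _ norm_ge_zero r bound] by simp
  also have "1\<^sub>m m + to_mat m ?A = to_mat m (ev F)"
  proof (rule eq_matI)
    fix i j assume "i < dim_row (to_mat m (ev F))" "j < dim_col (to_mat m (ev F))"
    then have ij: "i < m" "j < m" by auto
    have "cmat_one (\<iota> i) (\<iota> j) = cmat_one i j" using ev_one[OF ij] by (simp add: ev_def)
    then show "(1\<^sub>m m + to_mat m ?A) $$ (i, j) = to_mat m (ev F) $$ (i, j)"
      using ij by (simp add: ev_def minus_one_def cmat_one_def)
  qed auto
  finally show ?thesis .
qed

text \<open>Both exponentials are the determinant of the evaluated product in M_m, computed once
  factor by factor and once for the product as a whole.\<close>

lemma exp_sum_log_trace:
  assumes Fs: "\<And>F. F \<in> set Fs \<Longrightarrow> ok F \<and> norm (\<Phi> F - 1) < 1"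
    and r: "norm (\<Phi> (list_mult Fs) - 1) < 1"
  shows "exp (of_nat m * ((\<Sum>F\<leftarrow>Fs. log_trace F z0) - log_trace (list_mult Fs) z0)) = 1"
proof -
  have "det (to_mat m (ev (list_mult Fs))) = exp (of_nat m * (\<Sum>F\<leftarrow>Fs. log_trace F z0))"
    using Fs
  proof (induction Fs)
    case Nil
    have "to_mat m (ev (\<lambda>t. cmat_one)) = 1\<^sub>m m"
      by (rule eq_matI) (use ev_one in \<open>auto simp: cmat_one_def\<close>)
    then show ?case by (simp add: list_mult_Nil)
  next
    case (Cons F Fs)
    then have "ok F" "norm (\<Phi> F - 1) < 1" "ok (list_mult Fs)" by (auto intro: list_mult_ok)
    then show ?case
      using Cons by (simp add: list_mult_Cons det_ev_mult exp_log_trace_eq_det distrib_left exp_add)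
  qed
  moreover have "det (to_mat m (ev (list_mult Fs))) = exp (of_nat m * log_trace (list_mult Fs) z0)"
    by (rule exp_log_trace_eq_det[symmetric, OF list_mult_ok r]) (use Fs in blast)
  ultimately show ?thesis by (simp add: right_diff_distrib exp_diff)
qed

end

text \<open>The function nH takes values in 2\<pi>i\<int>, so distinct values of H are at least
  2\<pi>/n apart, and a continuous function with such a range on an interval is constant.\<close>

lemma constant_of_exp_multiple:
  fixes H :: "real \<Rightarrow> complex"
  assumes n: "0 < n" and H: "continuous_on {0..1} H"
    and e: "\<And>t. t \<in> {0..1} \<Longrightarrow> exp (of_nat n * H t) = 1" and t: "t \<in> {0..1}"
  shows "H t = H 0"
proof -
  have "H constant_on {0..1}"
  proof (rule continuous_discrete_range_constant[OF _ H])
    fix x :: real assume x: "x \<in> {0..1}"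
    show "\<exists>\<epsilon>>0. \<forall>y. y \<in> {0..1} \<and> H y \<noteq> H x \<longrightarrow> \<epsilon> \<le> norm (H y - H x)"
    proof (intro exI[of _ "2 * pi / real n"] conjI allI impI)
      fix y :: real assume y: "y \<in> {0..1} \<and> H y \<noteq> H x"
      have "exp (of_nat n * (H y - H x)) = 1"
        using e[of x] e[of y] x y by (simp add: right_diff_distrib exp_diff)
      then obtain k :: int where k: "Re (of_nat n * (H y - H x)) = 0"
        "Im (of_nat n * (H y - H x)) = of_int (2 * k) * pi"
        unfolding exp_eq_1 by blast
      have "k \<noteq> 0"
      proof
        assume "k = 0"
        then have "of_nat n * (H y - H x) = 0" using k by (simp add: complex_eq_iff)
        then show False using n y by simp
      qed
      then have "1 \<le> \<bar>real_of_int k\<bar>" by linarith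
      then have "2 * pi \<le> \<bar>Im (of_nat n * (H y - H x))\<bar>" unfolding k(2) by (simp add: abs_mult)
      also have "\<dots> \<le> norm (of_nat n * (H y - H x))" by (rule abs_Im_le_cmod)
      also have "\<dots> = real n * norm (H y - H x)" by (simp add: norm_mult)
      finally show "2 * pi / real n \<le> norm (H y - H x)" using n by (simp add: field_simps)
    qed (use n in simp)
  qed simp
  then show ?thesis using t unfolding constant_on_def by force
qed

section \<open>Evaluation in the fibres and comparison of logarithms\<close>

context drop_embedding
begin

lemma evaluation_units_E: "t \<in> {0..1} \<Longrightarrow> evaluation_units p q N \<Phi> {0, 1} N unitE t (\<lambda>i. i)"
proof -
  assume t: "t \<in> {0..1}"
  interpret E: matrix_units p q N \<Phi> "{0, 1}" N unitE by (rule matrix_units_E)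
  show ?thesis
  proof unfold_locales
    fix i j assume "i < N" "j < N"
    have "(\<Sum>k<N. unitE i j k k) = (\<Sum>k<N. if k = i then of_bool (i = j) else 0)"
      by (intro sum.cong refl) (auto simp: unitE_def)
    then show "of_nat N * (\<Sum>k<N. unitE i j k k) = of_nat N * of_bool (i = j)" using \<open>i < N\<close> by simp
  next
    fix F :: "real \<Rightarrow> nat \<Rightarrow> nat \<Rightarrow> complex" and k l assume "k < N" "l < N"
    then show "F t k l = E.unit_comb (\<lambda>i j. F t i j) k l" by (simp add: unit_comb_E)
  qed (use t in \<open>auto simp: unitE_def\<close>)
qed

text \<open>The index iq is the first one in the i-th block, where a \<otimes> 1 displays the
  entries of a. At the other end the first block, the indices below q, displays b.\<close>

lemma evaluation_units_L: "evaluation_units p q N \<Phi> {1} p unitL 0 (\<lambda>i. i * q)"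
proof -
  interpret L: matrix_units p q N \<Phi> "{1}" p unitL by (rule matrix_units_L)
  show ?thesis
  proof unfold_locales
    show "i * q < N" if "i < p" for i using mult_add_less[OF that q] by simp
  next
    fix i j assume ij: "i < p" "j < p"
    have "(\<Sum>k<N. unitL i j k k) = (\<Sum>k<N. of_bool (k div q = i \<and> i = j))"
      by (intro sum.cong refl) (auto simp: unitL_def)
    also have "\<dots> = (\<Sum>r<p. \<Sum>c<q. of_bool (r = i \<and> i = j))" by (rule sum_N)
    also have "\<dots> = (\<Sum>r<p. if r = i then of_nat q * of_bool (i = j) else 0)"
      by (intro sum.cong refl) auto
    finally show "of_nat p * (\<Sum>k<N. unitL i j k k) = of_nat N * of_bool (i = j)"
      using ij by (simp add: N_def)
  next
    fix F :: "real \<Rightarrow> nat \<Rightarrow> nat \<Rightarrow> complex" and k l assume F: "ok F" and kl: "k < N" "l < N"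
    obtain a where a: "\<And>i j. i < N \<Longrightarrow> j < N \<Longrightarrow> F 0 i j = kron_left q a i j"
      by (rule drop_funE[OF F]) (simp add: N_def, blast)
    have red: "(k div q) * q < N" "(l div q) * q < N"
      using mult_add_less[OF div_less q] kl by auto
    show "F 0 k l = L.unit_comb (\<lambda>i j. F 0 (i * q) (j * q)) k l"
      using a kl red q by (simp add: unit_comb_L)
  qed (use q in \<open>auto simp: unitL_def\<close>)
qed

lemma evaluation_units_R: "evaluation_units p q N \<Phi> {0} q unitR 1 (\<lambda>i. i)"
proof -
  interpret R: matrix_units p q N \<Phi> "{0}" q unitR by (rule matrix_units_R)
  have lt: "i < N" if "i < q" for i using mult_add_less[OF p that] by simp
  show ?thesis
  proof unfold_locales
    fix i j assume ij: "i < q" "j < q"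
    have "(\<Sum>k<N. unitR i j k k) = (\<Sum>k<N. of_bool (k mod q = i \<and> i = j))"
      by (intro sum.cong refl) (auto simp: unitR_def)
    also have "\<dots> = (\<Sum>r<p. \<Sum>c<q. of_bool (c = i \<and> i = j))" by (rule sum_N)
    also have "\<dots> = (\<Sum>r<p. \<Sum>c<q. if c = i then of_bool (i = j) else 0)"
      by (intro sum.cong refl) auto
    finally show "of_nat q * (\<Sum>k<N. unitR i j k k) = of_nat N * of_bool (i = j)"
      using ij by (simp add: N_def)
  next
    fix F :: "real \<Rightarrow> nat \<Rightarrow> nat \<Rightarrow> complex" and k l assume F: "ok F" and kl: "k < N" "l < N"
    obtain b where b: "\<And>i j. i < N \<Longrightarrow> j < N \<Longrightarrow> F 1 i j = kron_right q b i j"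
      by (rule drop_funE[OF F]) (simp add: N_def, blast)
    show "F 1 k l = R.unit_comb (\<lambda>i j. F 1 i j) k l"
      using b kl lt q by (simp add: unit_comb_R)
  qed (use lt in \<open>auto simp: unitR_def\<close>)
qed

text \<open>Its determinant in each fibre is an exponential, hence nonzero.\<close>

lemma near_one_injective:
  assumes F: "ok F" and r: "norm (\<Phi> F - 1) < 1"
  shows "injective_fun N F"
  unfolding injective_fun_def
proof (intro ballI allI impI)
  fix t v j assume t: "t \<in> {0..1::real}" and h: "\<forall>i<N. (\<Sum>j<N. F t i j * v j) = 0" and j: "j < N"
  interpret E: evaluation_units p q N \<Phi> "{0, 1}" N unitE t "\<lambda>i. i" by (rule evaluation_units_E[OF t])
  have "exp (of_nat N * log_trace F t) = det (to_mat N (F t))"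
    using E.exp_log_trace_eq_det[OF F r] by (simp add: E.ev_def[abs_def])
  then have "det (to_mat N (F t)) \<noteq> 0" by (metis exp_not_eq_zero)
  moreover have "to_mat N (F t) *\<^sub>v vec N v = 0\<^sub>v N"
    by (rule eq_vecI) (use h in \<open>auto simp: scalar_prod_def atLeast0LessThan\<close>)
  ultimately have "vec N v = 0\<^sub>v N"
    using det_0_iff_vec_prod_zero[of "to_mat N (F t)" N] by (metis mat_carrier vec_carrier)
  then show "v j = 0" using j by (metis index_vec index_zero_vec(1))
qed

text \<open>The product is only assumed to be close to 1, since a relation survives the
  approximation of its factors only approximately; the logarithm of the product therefore stays on
  the right.\<close>

lemma exp_trace_log_list_mult:
  assumes \<tau>: "tracial_state \<tau>"
    and Fs: "\<And>F. F \<in> set Fs \<Longrightarrow> ok F \<and> norm (\<Phi> F - 1) < 1"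
    and r: "norm (\<Phi> (list_mult Fs) - 1) < 1"
  shows "exp (\<Sum>F\<leftarrow>Fs. \<tau> (near_log (\<Phi> F))) = exp (\<tau> (near_log (\<Phi> (list_mult Fs))))"
proof -
  interpret L: evaluation_units p q N \<Phi> "{1}" p unitL 0 "\<lambda>i. i * q" by (rule evaluation_units_L)
  interpret R: evaluation_units p q N \<Phi> "{0}" q unitR 1 "\<lambda>i. i" by (rule evaluation_units_R)
  let ?P = "list_mult Fs"
  have okP: "ok ?P" by (rule list_mult_ok) (use Fs in blast)
  have cl: "continuous_on {0..1} (\<lambda>t. \<Sum>F\<leftarrow>Gs. log_trace F t) \<and>
      (\<Sum>F\<leftarrow>Gs. \<tau> (near_log (\<Phi> F))) = \<tau> (scalar (\<lambda>t. \<Sum>F\<leftarrow>Gs. log_trace F t))" if "set Gs \<subseteq> set Fs" for Gs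
    using that
  proof (induction Gs)
    case Nil
    then show ?case using scalar_const[of 0] tracial_stateD(5)[OF \<tau>] by simp
  next
    case (Cons G Gs)
    then have G: "ok G" "norm (\<Phi> G - 1) < 1" using Fs by auto
    note c = continuous_log_trace[OF G]
    show ?case
      using Cons c trace_near_log[OF \<tau> G]
      by (auto intro!: continuous_intros simp: scalar_add tracial_stateD[OF \<tau>])
  qed
  note cS = cl[OF subset_refl, THEN conjunct1] and tS = cl[OF subset_refl, THEN conjunct2]
  note cP = continuous_log_trace[OF okP r]
  define H where "H t = (\<Sum>F\<leftarrow>Fs. log_trace F t) - log_trace ?P t" for t
  have cH: "continuous_on {0..1} H" unfolding H_def[abs_def] by (intro continuous_intros cS cP)
  have eN: "exp (of_nat N * H t) = 1" if t: "t \<in> {0..1}" for t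
    unfolding H_def by (rule evaluation_units.exp_sum_log_trace[OF evaluation_units_E[OF t] Fs r])
  have ep: "exp (of_nat p * H 0) = 1" unfolding H_def by (rule L.exp_sum_log_trace[OF Fs r])
  have eq: "exp (of_nat q * H 1) = 1" unfolding H_def by (rule R.exp_sum_log_trace[OF Fs r])
  have const: "H t = H 0" if "t \<in> {0..1}" for t by (rule constant_of_exp_multiple[OF N_pos cH eN that])
  obtain x y where xy: "p * x = q * y + 1" using bezout_nat[of p q] p coprime_pq by auto
  \<comment> \<open>As H is constant, the conditions from both ends concern H(0), and Bezout
    isolates exp(H(0)) = 1.\<close>
  have "1 = exp (of_nat p * H 0) ^ x" by (simp add: ep)
  also have "\<dots> = exp (of_nat (p * x) * H 0)" by (simp add: exp_of_nat_mult[symmetric] mult_ac)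
  also have "\<dots> = exp (of_nat q * H 0) ^ y * exp (H 0)"
    unfolding xy by (simp add: exp_of_nat_mult[symmetric] exp_add[symmetric] algebra_simps)
  also have "exp (of_nat q * H 0) = 1" using eq const[of 1] by simp
  finally have e0: "exp (H 0) = 1" by simp
  have "(\<Sum>F\<leftarrow>Fs. \<tau> (near_log (\<Phi> F))) = \<tau> (scalar (\<lambda>t. H 0 + log_trace ?P t))"
    unfolding tS
  proof (intro arg_cong[where f = \<tau>] scalar_cong)
    fix t :: real assume "t \<in> {0..1}"
    then have "H t = H 0" by (rule const)
    then show "(\<Sum>F\<leftarrow>Fs. log_trace F t) = H 0 + log_trace ?P t"
      unfolding H_def[of t] by (simp add: algebra_simps)
  qed
  also have "\<dots> = H 0 + \<tau> (near_log (\<Phi> ?P))"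
    by (subst scalar_add) (auto intro: cP simp: scalar_const tracial_stateD[OF \<tau>] trace_near_log[OF \<tau> okP r])
  finally show ?thesis by (simp add: exp_add e0)
qed

end

section \<open>The determinant of a prime dimension drop limit\<close>

lemma prime_dim_drop_limitE:
  assumes "prime_dim_drop_limit TYPE('a::unital_cstar_algebra)"
  obtains p q and \<Phi> :: "nat \<Rightarrow> (real \<Rightarrow> nat \<Rightarrow> nat \<Rightarrow> complex) \<Rightarrow> 'a::unital_cstar_algebra" where
    "\<And>n. drop_embedding (p n) (q n) (p n * q n) (\<Phi> n)"
    "\<And>m n. m \<le> n \<Longrightarrow> \<Phi> m ` {F. drop_fun (p m) (q m) F} \<subseteq> \<Phi> n ` {F. drop_fun (p n) (q n) F}"
    "\<And>x \<epsilon>. 0 < \<epsilon> \<Longrightarrow> \<exists>n F. drop_fun (p n) (q n) F \<and> norm (\<Phi> n F - x) < \<epsilon>"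
proof -
  obtain p q and \<phi> :: "nat \<Rightarrow> (real \<Rightarrow> complex mat) \<Rightarrow> 'a" where
    pq: "\<forall>n. 0 < p n \<and> 0 < q n \<and> coprime (p n) (q n)"
    and emb: "\<forall>n. dim_drop_embedding (p n) (q n) (\<phi> n)"
    and inc: "\<forall>n. \<phi> n ` dim_drop (p n) (q n) \<subseteq> \<phi> (Suc n) ` dim_drop (p (Suc n)) (q (Suc n))"
    and dense: "closure (\<Union>n. \<phi> n ` dim_drop (p n) (q n)) = UNIV"
    using assms unfolding prime_dim_drop_limit_def by (elim exE conjE) (rule that)
  define \<Phi> where "\<Phi> n = \<phi> n \<circ> drop_mat (p n) (q n)" for n
  have im: "\<phi> n ` dim_drop (p n) (q n) = \<Phi> n ` {F. drop_fun (p n) (q n) F}" for n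
    unfolding \<Phi>_def by (rule drop_embedding_of_dim_drop_embedding(2)) (use pq emb in auto)
  show thesis
  proof (rule that)
    show "drop_embedding (p n) (q n) (p n * q n) (\<Phi> n)" for n
      unfolding \<Phi>_def by (rule drop_embedding_of_dim_drop_embedding(1)) (use pq emb in auto)
    show "\<Phi> m ` {F. drop_fun (p m) (q m) F} \<subseteq> \<Phi> n ` {F. drop_fun (p n) (q n) F}" if "m \<le> n" for m n
      by (rule lift_Suc_mono_le[of "\<lambda>n. \<Phi> n ` {F. drop_fun (p n) (q n) F}", OF _ that])
         (rule inc[rule_format, unfolded im])
    fix x :: 'a and \<epsilon> :: real assume "0 < \<epsilon>"
    have "x \<in> closure (\<Union>n. \<phi> n ` dim_drop (p n) (q n))" using dense by simp
    then have "\<exists>y\<in>(\<Union>n. \<phi> n ` dim_drop (p n) (q n)). dist y x < \<epsilon>"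
      using \<open>0 < \<epsilon>\<close> unfolding closure_approachable by (elim allE impE)
    then obtain y n where y: "y \<in> \<Phi> n ` {F. drop_fun (p n) (q n) F}" "dist y x < \<epsilon>"
      unfolding im by (elim bexE UN_E)
    from y(1) obtain F where "y = \<Phi> n F" "drop_fun (p n) (q n) F" by (elim imageE CollectE)
    then show "\<exists>n F. drop_fun (p n) (q n) F \<and> norm (\<Phi> n F - x) < \<epsilon>"
      using y(2) by (intro exI[of _ n] exI[of _ F]) (simp add: dist_norm)
  qed
qed

text \<open>For an approximant x within 1/8 of u, \<open>star x * x\<close> is within 1/8 + 1/8 +
  1/64 of 1, hence injective in each fibre, and therefore so is x. The same 1/8 is below the 1/4
  that lets u inherit the factorisation of x.\<close>

lemma unitary_in_near_products_of_limit:
  fixes u :: "'a::unital_cstar_algebra"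
  assumes lim: "prime_dim_drop_limit TYPE('a)" and u: "is_unitary u"
  shows "u \<in> near_products"
proof -
  obtain p q and \<Phi> :: "nat \<Rightarrow> (real \<Rightarrow> nat \<Rightarrow> nat \<Rightarrow> complex) \<Rightarrow> 'a" where
    emb: "\<And>n. drop_embedding (p n) (q n) (p n * q n) (\<Phi> n)"
    and dense: "\<And>x \<epsilon>. 0 < \<epsilon> \<Longrightarrow> \<exists>n F. drop_fun (p n) (q n) F \<and> norm (\<Phi> n F - x) < \<epsilon>"
    using prime_dim_drop_limitE[OF lim] by metis
  obtain n F where F: "drop_fun (p n) (q n) F" "norm (\<Phi> n F - u) < 1/8" using dense[of "1/8" u] by auto
  interpret drop_embedding "p n" "q n" "p n * q n" "\<Phi> n" by (rule emb)
  define N where "N = p n * q n"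
  let ?G = "\<lambda>t. cmat_mult N (\<lambda>i j. cnj (F t j i)) (F t)"
  define d where "d = \<Phi> n F - u"
  have okA: "ok (\<lambda>t i j. cnj (F t j i))" by (rule drop_fun_adjoint[OF F(1)])
  have "\<Phi> n ?G = star (\<Phi> n F) * \<Phi> n F"
    using mult[OF okA F(1)] adjoint[OF F(1)] by (simp add: N_def)
  also have "\<dots> - 1 = star u * d + star d * u + star d * d"
    using u by (simp add: d_def is_unitary_def star_diff algebra_simps)
  finally have "norm (\<Phi> n ?G - 1) = norm (star u * d + star d * u + star d * d)" by (simp only:)
  also have "\<dots> \<le> norm (star u * d) + norm (star d * u) + norm (star d * d)"
    by (rule order_trans[OF norm_triangle_ineq add_right_mono[OF norm_triangle_ineq]])
  also have "\<dots> \<le> 1 * norm d + norm d * 1 + norm d * norm d"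
    using norm_mult_ineq[of "star u" d] norm_mult_ineq[of "star d" u] norm_mult_ineq[of "star d" d] norm_unitary[OF u]
    by simp
  also have "\<dots> \<le> 1/8 + 1/8 + 1/8 * (1/8)"
    using F(2) unfolding d_def[symmetric] by (intro add_mono mult_mono) auto
  finally have "norm (\<Phi> n ?G - 1) < 1" by simp
  then have inj: "injective_fun N ?G"
    unfolding N_def by (intro near_one_injective ok_mult okA F(1))
  have "injective_fun N F"
    unfolding injective_fun_def
  proof (intro ballI allI impI)
    fix t v j assume t: "t \<in> {0..1::real}" and h: "\<forall>i<N. (\<Sum>j<N. F t i j * v j) = 0" and j: "j < N"
    show "v j = 0"
      by (rule injective_funD[OF inj t _ j]) (use h in \<open>simp add: sum_cmat_mult\<close>)
  qed
  then have "\<Phi> n F \<in> near_products"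
    using injective_in_near_products[OF F(1)] by (simp add: N_def)
  then show ?thesis by (rule unitary_in_near_products[OF _ u]) (use F(2) in simp)
qed

text \<open>The images increase, so finitely many stages have a common later one; asserting the
  approximation at all later stages is what carries the induction.\<close>

lemma simultaneous_approximation:
  fixes \<Phi> :: "nat \<Rightarrow> 'f \<Rightarrow> 'a::real_normed_vector"
  assumes inc: "\<And>m n. m \<le> n \<Longrightarrow> \<Phi> m ` A m \<subseteq> \<Phi> n ` A n"
    and dense: "\<And>x. \<exists>n F. F \<in> A n \<and> norm (\<Phi> n F - x) < \<epsilon>"
  shows "\<exists>n0. \<forall>n\<ge>n0. \<exists>Fs. list_all2 (\<lambda>F x. F \<in> A n \<and> norm (\<Phi> n F - x) < \<epsilon>) Fs xs"
proof (induction xs)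
  case (Cons x xs)
  then obtain n0 where n0: "\<And>n. n \<ge> n0 \<Longrightarrow> \<exists>Fs. list_all2 (\<lambda>F x. F \<in> A n \<and> norm (\<Phi> n F - x) < \<epsilon>) Fs xs" by blast
  obtain n1 F where F: "F \<in> A n1" "norm (\<Phi> n1 F - x) < \<epsilon>" using dense by blast
  show ?case
  proof (intro exI[of _ "max n0 n1"] allI impI)
    fix n assume n: "max n0 n1 \<le> n"
    then obtain Fs where Fs: "list_all2 (\<lambda>F x. F \<in> A n \<and> norm (\<Phi> n F - x) < \<epsilon>) Fs xs" using n0[of n] by auto
    have "\<Phi> n1 F \<in> \<Phi> n ` A n" using inc[of n1 n] n F(1) by auto
    then obtain G where "G \<in> A n" "\<Phi> n G = \<Phi> n1 F" by auto
    then have "list_all2 (\<lambda>F x. F \<in> A n \<and> norm (\<Phi> n F - x) < \<epsilon>) (G # Fs) (x # xs)" using Fs F(2) by simp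
    then show "\<exists>Fs. list_all2 (\<lambda>F x. F \<in> A n \<and> norm (\<Phi> n F - x) < \<epsilon>) Fs (x # xs)" by blast
  qed
qed auto

text \<open>The factors are approximated within 1/(k+1) at a common stage, logarithms are compared
  there, and k tends to infinity: the product of the approximants tends to 1, whose logarithm is
  0.\<close>

lemma exp_trace_log_eq_1:
  fixes xs :: "'a::unital_cstar_algebra list"
  assumes lim: "prime_dim_drop_limit TYPE('a)" and \<tau>: "tracial_state \<tau>"
    and xs: "\<And>x. x \<in> set xs \<Longrightarrow> norm (x - 1) < 1/2" and prod: "prod_list xs = 1"
  shows "exp (\<Sum>x\<leftarrow>xs. \<tau> (near_log x)) = 1"
proof -
  obtain p q and \<Phi> :: "nat \<Rightarrow> (real \<Rightarrow> nat \<Rightarrow> nat \<Rightarrow> complex) \<Rightarrow> 'a" where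
    emb: "\<And>n. drop_embedding (p n) (q n) (p n * q n) (\<Phi> n)"
    and inc: "\<And>m n. m \<le> n \<Longrightarrow> \<Phi> m ` {F. drop_fun (p m) (q m) F} \<subseteq> \<Phi> n ` {F. drop_fun (p n) (q n) F}"
    and dense: "\<And>x \<epsilon>. 0 < \<epsilon> \<Longrightarrow> \<exists>n F. drop_fun (p n) (q n) F \<and> norm (\<Phi> n F - x) < \<epsilon>"
    using prime_dim_drop_limitE[OF lim] by metis
  have "\<exists>n Fs. list_all2 (\<lambda>F x. drop_fun (p n) (q n) F \<and> norm (\<Phi> n F - x) < 1 / real (Suc k)) Fs xs" for k
  proof -
    have "\<exists>n0. \<forall>n\<ge>n0. \<exists>Fs. list_all2 (\<lambda>F x. F \<in> {F. drop_fun (p n) (q n) F} \<and>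
        norm (\<Phi> n F - x) < 1 / real (Suc k)) Fs xs"
      by (rule simultaneous_approximation[OF inc]) (use dense[of "1 / real (Suc k)"] in simp_all)
    then obtain n0 where n0: "\<forall>n\<ge>n0. \<exists>Fs. list_all2 (\<lambda>F x. F \<in> {F. drop_fun (p n) (q n) F} \<and>
        norm (\<Phi> n F - x) < 1 / real (Suc k)) Fs xs" by (rule exE)
    from n0[THEN spec, THEN mp, OF order_refl] show ?thesis
      unfolding mem_Collect_eq by (rule exI)
  qed
  then have "\<forall>k. \<exists>n Fs. list_all2 (\<lambda>F x. drop_fun (p n) (q n) F \<and> norm (\<Phi> n F - x) < 1 / real (Suc k)) Fs xs" ..
  from choice[OF this] obtain n where
    "\<forall>k. \<exists>Fs. list_all2 (\<lambda>F x. drop_fun (p (n k)) (q (n k)) F \<and> norm (\<Phi> (n k) F - x) < 1 / real (Suc k)) Fs xs"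
    by (rule exE)
  from choice[OF this] obtain Fs where
    "\<forall>k. list_all2 (\<lambda>F x. drop_fun (p (n k)) (q (n k)) F \<and> norm (\<Phi> (n k) F - x) < 1 / real (Suc k)) (Fs k) xs"
    by (rule exE)
  then have nFs: "list_all2 (\<lambda>F x. drop_fun (p (n k)) (q (n k)) F \<and> norm (\<Phi> (n k) F - x) < 1 / real (Suc k)) (Fs k) xs" for k ..
  have len: "length (Fs k) = length xs" for k using list_all2_lengthD[OF nFs] .
  have ok: "drop_fun (p (n k)) (q (n k)) (Fs k ! i)" and near: "norm (\<Phi> (n k) (Fs k ! i) - xs ! i) < 1 / real (Suc k)"
    if "i < length xs" for k i
    using list_all2_nthD2[OF nFs that] by auto
  define Y where "Y k i = \<Phi> (n k) (Fs k ! i)" for k i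
  have Ylim: "(\<lambda>k. Y k i) \<longlonglongrightarrow> xs ! i" if i: "i < length xs" for i
  proof -
    have "(\<lambda>k. Y k i - xs ! i) \<longlonglongrightarrow> 0"
    proof (rule tendsto_norm_zero_cancel, rule tendsto_sandwich[OF _ _ tendsto_const])
      show "(\<lambda>k. 1 / real (Suc k)) \<longlonglongrightarrow> 0" by (rule LIMSEQ_Suc[OF lim_1_over_n])
      show "\<forall>\<^sub>F k in sequentially. norm (Y k i - xs ! i) \<le> 1 / real (Suc k)"
        using near[OF i] by (auto simp: Y_def less_imp_le)
    qed simp
    then show ?thesis by (simp add: LIM_zero_cancel)
  qed
  have mapY: "map (Y k) [0..<length xs] = map (\<Phi> (n k)) (Fs k)" for k
    by (rule nth_equalityI) (auto simp: len Y_def)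
  have Plim: "(\<lambda>k. prod_list (map (\<Phi> (n k)) (Fs k))) \<longlonglongrightarrow> 1"
    using prod_list_approx[of xs Y, OF Ylim] by (simp add: mapY prod)
  have "\<forall>\<^sub>F k in sequentially. norm (prod_list (map (\<Phi> (n k)) (Fs k)) - 1) < 1"
    using tendstoD[OF Plim, of 1] by (simp add: dist_norm)
  \<comment> \<open>For k \<ge> 1 the error is at most 1/2, so approximants of elements within 1/2
    of 1 are at distance less than 1 from 1.\<close>
  moreover have "\<forall>\<^sub>F k in sequentially. (1::nat) \<le> k" by (rule eventually_ge_at_top)
  ultimately have ev: "\<forall>\<^sub>F k in sequentially. exp (\<Sum>i<length xs. \<tau> (near_log (Y k i))) =
      exp (\<tau> (near_log (prod_list (map (\<Phi> (n k)) (Fs k)))))"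
  proof eventually_elim
    case (elim k)
    interpret drop_embedding "p (n k)" "q (n k)" "p (n k) * q (n k)" "\<Phi> (n k)" by (rule emb)
    have F: "ok F \<and> norm (\<Phi> (n k) F - 1) < 1" if F: "F \<in> set (Fs k)" for F
    proof -
      obtain i where i: "i < length xs" "F = Fs k ! i" using F len[of k] unfolding in_set_conv_nth by auto
      have "norm (xs ! i - 1) < 1/2" using xs i by simp
      moreover have "1 / real (Suc k) \<le> 1/2" using elim(2) by (simp add: field_simps)
      moreover have "norm (\<Phi> (n k) (Fs k ! i) - 1) \<le> norm (\<Phi> (n k) (Fs k ! i) - xs ! i) + norm (xs ! i - 1)"
        using norm_triangle_ineq[of "\<Phi> (n k) (Fs k ! i) - xs ! i" "xs ! i - 1"] by simp
      ultimately have "norm (\<Phi> (n k) F - 1) < 1"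
        using near[OF i(1), of k] unfolding i(2) by linarith
      then show ?thesis using ok[OF i(1)] i(2) by simp
    qed
    have P: "\<Phi> (n k) (list_mult (Fs k)) = prod_list (map (\<Phi> (n k)) (Fs k))"
      by (rule Phi_list_mult) (use F in blast)
    have "exp (\<Sum>F\<leftarrow>Fs k. \<tau> (near_log (\<Phi> (n k) F))) = exp (\<tau> (near_log (\<Phi> (n k) (list_mult (Fs k)))))"
      by (rule exp_trace_log_list_mult[OF \<tau> F]) (use elim(1) P in simp_all)
    moreover have "(\<Sum>F\<leftarrow>Fs k. \<tau> (near_log (\<Phi> (n k) F))) = (\<Sum>i<length xs. \<tau> (near_log (Y k i)))"
      by (simp add: sum_list_sum_nth len Y_def atLeast0LessThan)
    ultimately show ?case by (simp only: P)
  qed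
  note bl = bounded_linear_tracial_state[OF \<tau>]
  have "(\<lambda>k. exp (\<Sum>i<length xs. \<tau> (near_log (Y k i)))) \<longlonglongrightarrow> exp (\<Sum>i<length xs. \<tau> (near_log (xs ! i)))"
    by (intro tendsto_exp tendsto_sum bounded_linear.tendsto[OF bl] tendsto_near_log Ylim xs) auto
  moreover have "(\<lambda>k. exp (\<tau> (near_log (prod_list (map (\<Phi> (n k)) (Fs k)))))) \<longlonglongrightarrow> exp (\<tau> (near_log 1))"
    by (intro tendsto_exp bounded_linear.tendsto[OF bl] tendsto_near_log Plim) auto
  then have "(\<lambda>k. exp (\<Sum>i<length xs. \<tau> (near_log (Y k i)))) \<longlonglongrightarrow> exp (\<tau> (near_log 1))"
    by (rule Lim_transform_eventually) (use ev in \<open>auto elim: eventually_mono\<close>)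
  ultimately have "exp (\<Sum>i<length xs. \<tau> (near_log (xs ! i))) = exp (\<tau> (near_log 1))" by (rule LIMSEQ_unique)
  then show ?thesis
    by (simp add: sum_list_sum_nth atLeast0LessThan tracial_stateD(5)[OF \<tau>])
qed

section \<open>The determinant on unitaries\<close>

definition log_det :: "('a::unital_cstar_algebra \<Rightarrow> complex) \<Rightarrow> 'a list \<Rightarrow> complex" where
  "log_det \<tau> xs = exp (\<Sum>x\<leftarrow>xs. \<tau> (near_log x))"

text \<open>The de la Harpe--Skandalis determinant, for invertible elements connected to the unit.\<close>

definition hs_det :: "('a::unital_cstar_algebra \<Rightarrow> complex) \<Rightarrow> 'a \<Rightarrow> complex" where
  "hs_det \<tau> u = log_det \<tau> (SOME xs. (\<forall>x\<in>set xs. near_one x) \<and> prod_list xs = u)"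

lemma hs_det_nonzero: "hs_det \<tau> u \<noteq> 0"
  by (simp add: hs_det_def log_det_def)

text \<open>Any two factorisations of the same element become relations with product 1 when a fixed
  factorisation of the inverse is appended. By \<open>exp_trace_log_eq_1\<close> both then have the
  same determinant.\<close>

lemma hs_det_prod_list:
  fixes xs :: "'a::unital_cstar_algebra list"
  assumes lim: "prime_dim_drop_limit TYPE('a)" and \<tau>: "tracial_state \<tau>" and xs: "\<forall>x\<in>set xs. near_one x"
  shows "hs_det \<tau> (prod_list xs) = log_det \<tau> xs"
proof -
  define ys where "ys = (SOME ys. (\<forall>x\<in>set ys. near_one x) \<and> prod_list ys = prod_list xs)"
  have ys: "(\<forall>x\<in>set ys. near_one x) \<and> prod_list ys = prod_list xs"
    unfolding ys_def by (rule someI[of _ xs]) (use xs in simp)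
  have "prod_list xs \<in> near_products" unfolding near_products_def using xs by blast
  then obtain z where "z \<in> near_products" "prod_list xs * z = 1" by (rule near_products_inverse)
  then obtain zs where zs: "\<forall>x\<in>set zs. near_one x" "prod_list xs * prod_list zs = 1"
    unfolding near_products_def by blast
  have "log_det \<tau> (ws @ zs) = 1" if "\<forall>x\<in>set ws. near_one x" "prod_list ws = prod_list xs" for ws
    unfolding log_det_def
    by (rule exp_trace_log_eq_1[OF lim \<tau>]) (use that zs in \<open>auto simp: near_one_def\<close>)
  then have "log_det \<tau> ws * log_det \<tau> zs = 1" if "\<forall>x\<in>set ws. near_one x" "prod_list ws = prod_list xs" for ws
    using that by (simp add: log_det_def exp_add)
  then have "log_det \<tau> ys * log_det \<tau> zs = log_det \<tau> xs * log_det \<tau> zs" using ys xs by simp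
  then have "log_det \<tau> ys = log_det \<tau> xs" by (simp add: log_det_def)
  then show ?thesis by (simp add: hs_det_def ys_def)
qed

lemma hs_det_mult:
  fixes u v :: "'a::unital_cstar_algebra"
  assumes lim: "prime_dim_drop_limit TYPE('a)" and \<tau>: "tracial_state \<tau>"
    and uv: "is_unitary u" "is_unitary v"
  shows "hs_det \<tau> (u * v) = hs_det \<tau> u * hs_det \<tau> v"
proof -
  obtain xs ys where xs: "\<forall>x\<in>set xs. near_one x" "u = prod_list xs" and ys: "\<forall>x\<in>set ys. near_one x" "v = prod_list ys"
    using unitary_in_near_products_of_limit[OF lim] uv unfolding near_products_def by blast
  have "u * v = prod_list (xs @ ys)" by (simp add: xs ys)
  then show ?thesis
    using hs_det_prod_list[OF lim \<tau>, of xs] hs_det_prod_list[OF lim \<tau>, of ys] hs_det_prod_list[OF lim \<tau>, of "xs @ ys"] xs ys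
    by (simp add: log_det_def exp_add ball_Un)
qed

text \<open>Being contractive and compatible with the logarithm series, \<open>\<theta>\<close> maps
  a factorisation of u to one of its image; \<open>\<tau>\<close> composed with
  \<open>\<theta>\<close> is again a tracial state, hence \<open>\<tau>\<close> by
  uniqueness.\<close>

lemma hs_det_automorphism:
  fixes u :: "'a::unital_cstar_algebra"
  assumes lim: "prime_dim_drop_limit TYPE('a)" and \<tau>: "tracial_state \<tau>"
    and unique: "\<And>\<sigma>. tracial_state \<sigma> \<Longrightarrow> \<sigma> = \<tau>" and \<theta>: "star_automorphism \<theta>" and u: "is_unitary u"
  shows "hs_det \<tau> (\<theta> u) = hs_det \<tau> u"
proof -
  note t = star_automorphismD[OF \<theta>]
  obtain xs where xs: "\<forall>x\<in>set xs. near_one x" "u = prod_list xs"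
    using unitary_in_near_products_of_limit[OF lim u] unfolding near_products_def by blast
  have n: "norm (\<theta> x - 1) \<le> norm (x - 1)" for x
    using star_automorphism_norm_le[OF \<theta>, of "x - 1"] by (simp add: t)
  have near: "near_one (\<theta> x)" if x: "near_one x" for x
  proof -
    obtain y where y: "x * y = 1" "y * x = 1" "norm (y - 1) < 1/2" and x: "norm (x - 1) < 1/2"
      using x unfolding near_one_def by blast
    show ?thesis
    proof (rule near_oneI2)
      show "\<theta> x * \<theta> y = 1" "\<theta> y * \<theta> x = 1" using y t by metis+
      show "norm (\<theta> x - 1) < 1/2" "norm (\<theta> y - 1) < 1/2" using n[of x] n[of y] x y by linarith+
    qed
  qed
  have "\<tau> \<circ> \<theta> = \<tau>" by (rule unique[OF tracial_state_comp_automorphism[OF \<tau> \<theta>]])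
  then have \<tau>\<theta>: "\<tau> (\<theta> x) = \<tau> x" for x by (metis comp_apply)
  have log: "\<tau> (near_log (\<theta> x)) = \<tau> (near_log x)" if "near_one x" for x
    using star_automorphism_near_log[OF \<theta>, of x] that \<tau>\<theta> by (simp add: near_one_def flip: star_automorphism_near_log[OF \<theta>])
  have "\<theta> (prod_list xs) = prod_list (map \<theta> xs)"
    by (induction xs) (simp_all add: t)
  then have "hs_det \<tau> (\<theta> u) = log_det \<tau> (map \<theta> xs)"
    using hs_det_prod_list[OF lim \<tau>, of "map \<theta> xs"] xs near by simp
  also have "\<dots> = log_det \<tau> xs"
    unfolding log_det_def using log xs(1) by (simp add: comp_def cong: map_cong)
  also have "\<dots> = hs_det \<tau> u" using hs_det_prod_list[OF lim \<tau> xs(1)] xs(2) by simp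
  finally show ?thesis .
qed

lemma exp_trace_near_log_scalar:
  fixes \<tau> :: "'a::unital_cstar_algebra \<Rightarrow> complex"
  assumes \<tau>: "tracial_state \<tau>" and \<mu>: "cmod (\<mu> - 1) < 1"
  shows "exp (\<tau> (near_log (scaleC \<mu> 1))) = \<mu>"
proof -
  have d: "scaleC \<mu> 1 - 1 = scaleC (\<mu> - 1) (1::'a)" by (simp add: scaleC_diff_left)
  have pow: "(scaleC \<mu> 1 - 1) ^ k = scaleC ((\<mu> - 1) ^ k) (1::'a)" for k
    unfolding d by (induction k) (simp_all add: mult_scaleC_left scaleC_scaleC)
  have n: "norm (scaleC \<mu> 1 - (1::'a)) < 1" unfolding d using \<mu> by (simp add: norm_scaleC)
  have "(\<lambda>k. log_coeff k *\<^sub>R (scaleC \<mu> 1 - 1) ^ Suc k) sums near_log (scaleC \<mu> (1::'a))"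
    unfolding near_log_def by (rule summable_sums[OF summable_log_series[OF n]])
  then have "(\<lambda>k. \<tau> (log_coeff k *\<^sub>R (scaleC \<mu> 1 - 1) ^ Suc k)) sums \<tau> (near_log (scaleC \<mu> (1::'a)))"
    by (rule bounded_linear.sums[OF bounded_linear_tracial_state[OF \<tau>]])
  then have "(\<lambda>k. complex_of_real (log_coeff k) * (\<mu> - 1) ^ Suc k) sums \<tau> (near_log (scaleC \<mu> (1::'a)))"
    unfolding pow tracial_stateD(8)[OF \<tau>] tracial_stateD(2,3)[OF \<tau>] by (simp add: scaleR_conv_of_real)
  moreover have "(\<lambda>k. complex_of_real (log_coeff k) * (\<mu> - 1) ^ Suc k) sums ln (1 + (\<mu> - 1))"
  proof -
    have "(\<lambda>k. (-1) ^ Suc k / of_nat k * (\<mu> - 1) ^ k) sums ln (1 + (\<mu> - 1))" by (rule Ln_series[OF \<mu>])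
    then have "(\<lambda>k. (-1) ^ Suc (Suc k) / of_nat (Suc k) * (\<mu> - 1) ^ Suc k) sums ln (1 + (\<mu> - 1))"
      by (subst sums_Suc_iff) simp
    then show ?thesis by (simp add: log_coeff_def)
  qed
  ultimately have "\<tau> (near_log (scaleC \<mu> (1::'a))) = ln (1 + (\<mu> - 1))" by (rule sums_unique2)
  moreover have "\<mu> \<noteq> 0" using \<mu> by auto
  ultimately show ?thesis by simp
qed

text \<open>l is the (n+1)-th power of exp(Ln l / (n+1)), which is within 1/4 of 1 for suitable n;
  on such a scalar the logarithm series is the principal logarithm.\<close>

lemma hs_det_scalar:
  assumes lim: "prime_dim_drop_limit TYPE('a::unital_cstar_algebra)" and \<tau>: "tracial_state (\<tau> :: 'a \<Rightarrow> complex)"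
    and l: "cmod l = 1"
  shows "hs_det \<tau> (scaleC l 1) = l"
proof -
  have l0: "l \<noteq> 0" using l by auto
  have "(\<lambda>n. exp (Ln l / of_nat (Suc n))) \<longlonglongrightarrow> exp 0"
    by (intro tendsto_exp LIMSEQ_Suc[of "\<lambda>n. Ln l / of_nat n"] lim_const_over_n)
  then have "\<forall>\<^sub>F n in sequentially. dist (exp (Ln l / of_nat (Suc n))) 1 < 1/4"
    using tendstoD[of _ "exp 0" _ "1/4"] by simp
  then obtain n where n: "cmod (exp (Ln l / of_nat (Suc n)) - 1) < 1/4"
    unfolding eventually_sequentially dist_norm by blast
  define \<mu> where "\<mu> = exp (Ln l / of_nat (Suc n))"
  have "\<mu> ^ Suc n = exp (of_nat (Suc n) * (Ln l / of_nat (Suc n)))"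
    unfolding \<mu>_def by (rule exp_of_nat_mult[symmetric])
  also have "of_nat (Suc n) * (Ln l / of_nat (Suc n)) = Ln l" by (simp del: of_nat_Suc)
  finally have \<mu>l: "\<mu> ^ Suc n = l" using l0 by simp
  have "norm (scaleC \<mu> 1 - (1::'a)) < 1/4"
    using n norm_scaleC[of "\<mu> - 1" "1::'a"] by (simp add: \<mu>_def scaleC_diff_left)
  then have near: "\<forall>x\<in>set (replicate (Suc n) (scaleC \<mu> (1::'a))). near_one x"
    using near_oneI[of "scaleC \<mu> (1::'a)"] by simp
  have "prod_list (replicate k (scaleC \<mu> (1::'a))) = scaleC (\<mu> ^ k) 1" for k
    by (induction k) (simp_all add: mult_scaleC_left scaleC_scaleC)
  then have "hs_det \<tau> (scaleC l 1) = log_det \<tau> (replicate (Suc n) (scaleC \<mu> (1::'a)))"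
    using hs_det_prod_list[OF lim \<tau> near] \<mu>l by metis
  also have "\<dots> = exp (\<tau> (near_log (scaleC \<mu> 1))) ^ Suc n"
    unfolding log_det_def map_replicate sum_list_replicate by (rule exp_of_nat_mult)
  also have "\<dots> = l"
    using exp_trace_near_log_scalar[OF \<tau>, of \<mu>] n \<mu>l by (simp add: \<mu>_def)
  finally show ?thesis .
qed

theorem theoremA:
  fixes G :: "('g, 'm) monoid_scheme"
    and \<omega> :: "'g \<times> 'g \<times> 'g \<Rightarrow> complex"
  assumes "group G"
    and "\<omega> \<in> carrier (cocycles3 G)"
    and "is_jiang_su TYPE('a::unital_cstar_algebra)"
    and "\<exists>(\<theta> :: 'g \<Rightarrow> 'a \<Rightarrow> 'a) u. anomalous_action G \<omega> \<theta> u"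
  shows "H3_class G \<omega> = \<one>\<^bsub>H3 G\<^esub>"
proof -
  interpret group G by fact
  obtain \<theta> :: "'g \<Rightarrow> 'a \<Rightarrow> 'a" and u where act: "anomalous_action G \<omega> \<theta> u" using assms(4) by blast
  have lim: "prime_dim_drop_limit TYPE('a)" using assms(3) by (simp add: is_jiang_su_def)
  obtain \<tau> :: "'a \<Rightarrow> complex" where \<tau>: "tracial_state \<tau>" and unique: "\<And>\<sigma>. tracial_state \<sigma> \<Longrightarrow> \<sigma> = \<tau>"
    using assms(3) unfolding is_jiang_su_def by blast
  have \<omega>: "\<omega> \<in> carrier G \<times> carrier G \<times> carrier G \<rightarrow>\<^sub>E sphere 0 1"
    using assms(2) by (simp add: cocycles3_def)
  have aut: "star_automorphism (\<theta> g)" if "g \<in> carrier G" for g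
    using act that by (simp add: anomalous_action_def)
  have unit: "is_unitary (u g h)" if "g \<in> carrier G" "h \<in> carrier G" for g h
    using act that by (simp add: anomalous_action_def)
  have \<theta>_unit: "is_unitary (\<theta> g v)" if "g \<in> carrier G" "is_unitary v" for g v
    using that(2) star_automorphismD(3-5)[OF aut[OF that(1)]] unfolding is_unitary_def by metis
  \<comment> \<open>\<open>sgn\<close> divides by the modulus. Being multiplicative, it carries the
    identity between determinants to one between circle values, and it fixes the values of
    \<omega>.\<close>
  define c where "c = (\<lambda>(g, h)\<in>carrier G \<times> carrier G. sgn (hs_det \<tau> (u g h)))"
  have c: "c \<in> carrier G \<times> carrier G \<rightarrow>\<^sub>E sphere 0 1"
    by (auto simp: c_def norm_sgn hs_det_nonzero)
  have "\<omega> = coboundary2 G c"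
  proof (rule PiE_ext[OF \<omega>])
    have n1: "cmod (c (g, h)) = 1" if "g \<in> carrier G" "h \<in> carrier G" for g h
      using PiE_mem[OF c, of "(g, h)"] that by auto
    show "coboundary2 G c \<in> carrier G \<times> carrier G \<times> carrier G \<rightarrow>\<^sub>E sphere 0 1"
      by (auto simp: coboundary2_def norm_mult norm_inverse n1)
    fix x assume "x \<in> carrier G \<times> carrier G \<times> carrier G"
    then obtain g h k where x: "x = (g, h, k)" and ghk: "g \<in> carrier G" "h \<in> carrier G" "k \<in> carrier G" by auto
    have w1: "cmod (\<omega> (g, h, k)) = 1" using PiE_mem[OF \<omega>, of "(g, h, k)"] ghk by simp
    have "scaleC (\<omega> (g, h, k)) (u (g \<otimes>\<^bsub>G\<^esub> h) k * u g h) = u g (h \<otimes>\<^bsub>G\<^esub> k) * \<theta> g (u h k)"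
      using act ghk by (simp add: anomalous_action_def)
    moreover have "scaleC (\<omega> (g, h, k)) (u (g \<otimes>\<^bsub>G\<^esub> h) k * u g h) = scaleC (\<omega> (g, h, k)) 1 * (u (g \<otimes>\<^bsub>G\<^esub> h) k * u g h)"
      by (simp add: mult_scaleC_left)
    moreover have "is_unitary (scaleC (\<omega> (g, h, k)) (1::'a))"
      using w1 by (simp add: is_unitary_def star_scaleC mult_scaleC_left scaleC_scaleC complex_norm_square[symmetric] mult.commute)
    ultimately have "\<omega> (g, h, k) * (hs_det \<tau> (u (g \<otimes>\<^bsub>G\<^esub> h) k) * hs_det \<tau> (u g h)) =
        hs_det \<tau> (u g (h \<otimes>\<^bsub>G\<^esub> k)) * hs_det \<tau> (u h k)"
      using hs_det_mult[OF lim \<tau>] hs_det_scalar[OF lim \<tau> w1] hs_det_automorphism[OF lim \<tau> unique aut unit]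
        unit \<theta>_unit is_unitary_mult ghk by (metis m_closed)
    then have "sgn (\<omega> (g, h, k)) * (c (g \<otimes>\<^bsub>G\<^esub> h, k) * c (g, h)) = c (g, h \<otimes>\<^bsub>G\<^esub> k) * c (h, k)"
      using ghk by (simp add: c_def flip: sgn_mult)
    moreover have "sgn (\<omega> (g, h, k)) = \<omega> (g, h, k)" using w1 by (simp add: sgn_eq)
    moreover have "c (g \<otimes>\<^bsub>G\<^esub> h, k) \<noteq> 0" "c (g, h) \<noteq> 0" using n1[of "g \<otimes>\<^bsub>G\<^esub> h" k] n1[of g h] ghk by auto
    ultimately show "\<omega> x = coboundary2 G c x"
      using ghk by (simp add: x coboundary2_def field_simps)
  qed
  then have mem: "\<omega> \<in> coboundaries3 G" using c unfolding coboundaries3_def by blast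
  interpret Z: comm_group "cocycles3 G" by (rule comm_group_cocycles3) fact
  show ?thesis
    unfolding H3_class_def H3_def
    using Z.coset_join2[OF assms(2) subgroup_coboundaries3[OF assms(1)] mem] by (simp add: FactGroup_def)
qed

end
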